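(* Let $n\ge 1$. Let $1\le p\le 2\le p_1,p_2,\widetilde p_1,\widetilde p_2\le\infty$, $0<q,q_1,q_2,\widetilde q_1,\widetilde q_2\le\infty$ and $s,s_1,s_2,\widetilde s_1,\widetilde s_2\in\mathbb{R}$ be such that $$\frac1p\le\frac1{p_1}+\frac1{p_2},\quad \frac1p\le\frac1{\widetilde p_1}+\frac1{\widetilde p_2},\quad \frac1q=\frac1{q_1}+\frac1{q_2}=\frac1{\widetilde q_1}+\frac1{\widetilde q_2},\quad s=s_1+s_2=\widetilde s_1+\widetilde s_2 .$$ For a symbol $\sigma$, consider the property $$( * )_\sigma:\ \text{there is } C>0 \text{ such that } \|T_\sigma(f_1,f_2)\|_{B^s_{p,q}}\le C\Big(\|f_1\|_{B^{s_1}_{p_1,q_1}}\|f_2\|_{B^{s_2}_{p_2,q_2}}+\|f_1\|_{B^{\widetilde s_1}_{\widetilde p_1,\widetilde q_1}}\|f_2\|_{B^{\widetilde s_2}_{\widetilde p_2,\widetilde q_2}}\Big)\ \text{ for all } f_1,f_2\in\mathcal{S}(\mathbb{R}^n).$$ (1) If $( * )_\sigma$ holds for all $\sigma\in BS^{-n/2}_{0,0}$, then $\min\{s_i,\widetilde s_i\}\le n/2$ for $i=1,2$ and $s\ge-n/2$. (2) Let $m_1,m_2\in\mathbb{R}$ with $m_1+m_2=-n/2$. If $( * )_\sigma$ holds for all $\sigma\in BS^{(m_1,m_2)}_{0,0}$, then $\min\{s_i,\widetilde s_i\}\le m_i+n/2$ for $i=1,2$ and $s\ge-n/2$.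
   Context: Convention: $1/\infty=0$. $\mathcal{S}(\mathbb{R}^n)$ is the Schwartz space, and $\widehat f(\xi)=\mathcal{F}f(\xi)=\int_{\mathbb{R}^n}e^{-ix\cdot\xi}f(x)\,dx$. For a multiplier $m$, $m(D)f=\mathcal{F}^{-1}[m\widehat f]$. Symbol classes: for $m\in\mathbb{R}$, $BS^m_{0,0}$ is the set of all $\sigma(x,\xi_1,\xi_2)\in C^\infty((\mathbb{R}^n)^3)$ such that for all multi-indices $\alpha,\beta_1,\beta_2\in\mathbb{N}_0^n$ there is a constant $C_{\alpha,\beta_1,\beta_2}$ with $|\partial_x^\alpha\partial_{\xi_1}^{\beta_1}\partial_{\xi_2}^{\beta_2}\sigma(x,\xi_1,\xi_2)|\le C_{\alpha,\beta_1,\beta_2}(1+|\xi_1|+|\xi_2|)^m$ everywhere. For $m_1,m_2\in\mathbb{R}$, $BS^{(m_1,m_2)}_{0,0}$ is defined in the same way with the bound $C_{\alpha,\beta_1,\beta_2}(1+|\xi_1|)^{m_1}(1+|\xi_2|)^{m_2}$. Bilinear pseudo-differential operator: for $f_1,f_2\in\mathcal{S}(\mathbb{R}^n)$, $$T_\sigma(f_1,f_2)(x)=\frac1{(2\pi)^{2n}}\int_{(\mathbb{R}^n)^2}e^{ix\cdot(\xi_1+\xi_2)}\sigma(x,\xi_1,\xi_2)\widehat{f_1}(\xi_1)\widehat{f_2}(\xi_2)\,d\xi_1d\xi_2 .$$ Besov spaces: let $\psi_0\in\mathcal{S}(\mathbb{R}^n)$ with $\operatorname{supp}\psi_0\subset\{|\xi|\le2\}$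 and $\psi_0=1$ on $\{|\xi|\le1\}$; set $\psi(\xi)=\psi_0(\xi)-\psi_0(2\xi)$ and $\psi_\ell(\xi)=\psi(2^{-\ell}\xi)$ for $\ell\ge1$. For $0<p,q\le\infty$, $s\in\mathbb{R}$, $\|f\|_{B^s_{p,q}}=\big(\sum_{\ell=0}^\infty2^{\ell sq}\|\psi_\ell(D)f\|_{L^p}^q\big)^{1/q}$, with the supremum over $\ell$ of $2^{\ell s}\|\psi_\ell(D)f\|_{L^p}$ when $q=\infty$. (Different choices of $\psi_0$ give equivalent quasi-norms.) The constant $C$ in $( * )_\sigma$ may depend on $\sigma$. *)

theory Defs
  imports "HOL-Analysis.Analysis" "HOL-Probability.Essential_Supremum"
begin

text \<open>
  A multi-index is encoded as a list of standard basis vectors, each coordinate direction being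
  repeated according to its multiplicity; the head of the list is the outermost derivative.
  On smooth functions the order of the list is irrelevant.
\<close>

primrec iter_pderiv :: "'a::euclidean_space list \<Rightarrow> ('a \<Rightarrow> complex) \<Rightarrow> 'a \<Rightarrow> complex" where
  "iter_pderiv [] f = f"
| "iter_pderiv (v # vs) f = (\<lambda>x. frechet_derivative (iter_pderiv vs f) (at x) v)"

definition smooth_fun :: "('a::euclidean_space \<Rightarrow> complex) \<Rightarrow> bool" where
  "smooth_fun f \<longleftrightarrow> (\<forall>vs\<in>lists Basis. \<forall>x. iter_pderiv vs f differentiable (at x))"

definition schwartz :: "('a::euclidean_space \<Rightarrow> complex) set" where
  "schwartz = {f. smooth_fun f \<and>
     (\<forall>k::nat. \<forall>vs\<in>lists Basis. \<exists>C. \<forall>x. norm x ^ k * cmod (iter_pderiv vs f x) \<le> C)}"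

definition fourier :: "('a::euclidean_space \<Rightarrow> complex) \<Rightarrow> 'a \<Rightarrow> complex" where
  "fourier f \<xi> = (LINT x|lborel. cis (- (x \<bullet> \<xi>)) * f x)"

definition inv_fourier :: "('a::euclidean_space \<Rightarrow> complex) \<Rightarrow> 'a \<Rightarrow> complex" where
  "inv_fourier g x =
     complex_of_real (1 / (2 * pi) ^ DIM('a)) * (LINT \<xi>|lborel. cis (x \<bullet> \<xi>) * g \<xi>)"

definition multiplier_op ::
  "('a::euclidean_space \<Rightarrow> complex) \<Rightarrow> ('a \<Rightarrow> complex) \<Rightarrow> 'a \<Rightarrow> complex" where
  "multiplier_op m f = inv_fourier (\<lambda>\<xi>. m \<xi> * fourier f \<xi>)"

text \<open>
  Symbols are functions of the triple \<open>(x, \<xi>\<^sub>1, \<xi>\<^sub>2)\<close>.  The bounding weight is a parameter.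
\<close>

definition symbols_bounded_by ::
  "('a \<Rightarrow> 'a \<Rightarrow> real) \<Rightarrow> ('a::euclidean_space \<times> 'a \<times> 'a \<Rightarrow> complex) set" where
  "symbols_bounded_by w = {\<sigma>. smooth_fun \<sigma> \<and>
     (\<forall>\<alpha>\<in>lists Basis. \<forall>\<beta>1\<in>lists Basis. \<forall>\<beta>2\<in>lists Basis. \<exists>C. \<forall>x \<xi>1 \<xi>2.
        cmod (iter_pderiv
          (map (\<lambda>v. (v, 0, 0)) \<alpha> @ map (\<lambda>v. (0, v, 0)) \<beta>1 @ map (\<lambda>v. (0, 0, v)) \<beta>2)
          \<sigma> (x, \<xi>1, \<xi>2)) \<le> C * w \<xi>1 \<xi>2)}"

definition BS :: "real \<Rightarrow> ('a::euclidean_space \<times> 'a \<times> 'a \<Rightarrow> complex) set" where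
  "BS m = symbols_bounded_by (\<lambda>\<xi>1 \<xi>2. (1 + norm \<xi>1 + norm \<xi>2) powr m)"

definition BS2 :: "real \<Rightarrow> real \<Rightarrow> ('a::euclidean_space \<times> 'a \<times> 'a \<Rightarrow> complex) set" where
  "BS2 m1 m2 = symbols_bounded_by (\<lambda>\<xi>1 \<xi>2. (1 + norm \<xi>1) powr m1 * (1 + norm \<xi>2) powr m2)"

definition bilinear_op ::
  "('a::euclidean_space \<times> 'a \<times> 'a \<Rightarrow> complex) \<Rightarrow> ('a \<Rightarrow> complex) \<Rightarrow> ('a \<Rightarrow> complex) \<Rightarrow> 'a \<Rightarrow> complex"
  where
  "bilinear_op \<sigma> f1 f2 x =
     complex_of_real (1 / (2 * pi) ^ (2 * DIM('a))) *
     (LINT (\<xi>1, \<xi>2)|lborel.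
        cis (x \<bullet> (\<xi>1 + \<xi>2)) * \<sigma> (x, \<xi>1, \<xi>2) * fourier f1 \<xi>1 * fourier f2 \<xi>2)"

text \<open>Powers of extended nonnegative reals, only meaningful for exponents \<open>a > 0\<close>.\<close>

definition ennpowr :: "ennreal \<Rightarrow> real \<Rightarrow> ennreal" where
  "ennpowr t a = (if t = \<infinity> then \<infinity> else ennreal (enn2real t powr a))"

definition Lp_norm :: "ennreal \<Rightarrow> ('a::euclidean_space \<Rightarrow> complex) \<Rightarrow> ennreal" where
  "Lp_norm p f =
     (if p = \<infinity> then esssup lborel (\<lambda>x. ennreal (cmod (f x)))
      else ennpowr (\<integral>\<^sup>+ x. ennreal (cmod (f x) powr enn2real p) \<partial>lborel) (1 / enn2real p))"

definition besov_cutoff :: "('a::euclidean_space \<Rightarrow> complex) \<Rightarrow> bool" where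
  "besov_cutoff \<psi>0 \<longleftrightarrow> \<psi>0 \<in> schwartz \<and> closure {\<xi>. \<psi>0 \<xi> \<noteq> 0} \<subseteq> cball 0 2 \<and>
     (\<forall>\<xi>\<in>cball 0 1. \<psi>0 \<xi> = 1)"

definition dyadic_piece :: "('a::euclidean_space \<Rightarrow> complex) \<Rightarrow> nat \<Rightarrow> 'a \<Rightarrow> complex" where
  "dyadic_piece \<psi>0 l =
     (if l = 0 then \<psi>0
      else let \<psi> = (\<lambda>\<xi>. \<psi>0 \<xi> - \<psi>0 (2 *\<^sub>R \<xi>)) in (\<lambda>\<xi>. \<psi> ((1 / 2 ^ l) *\<^sub>R \<xi>)))"

text \<open>
  The multiplier operators are given by integrals, so this is the Besov quasi-norm for
  Schwartz functions; it is only used for these.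
\<close>

definition besov_norm ::
  "('a::euclidean_space \<Rightarrow> complex) \<Rightarrow> real \<Rightarrow> ennreal \<Rightarrow> ennreal \<Rightarrow> ('a \<Rightarrow> complex) \<Rightarrow> ennreal" where
  "besov_norm \<psi>0 s p q f =
     (if q = \<infinity>
      then (SUP l. ennreal (2 powr (real l * s)) * Lp_norm p (multiplier_op (dyadic_piece \<psi>0 l) f))
      else ennpowr
        (\<Sum>l. ennreal (2 powr (real l * s * enn2real q)) *
              ennpowr (Lp_norm p (multiplier_op (dyadic_piece \<psi>0 l) f)) (enn2real q))
        (1 / enn2real q))"

end

theory Submission
  imports Defs "HOL-Probability.Probability"
begin

text \<open>
  All three conditions are forced by modulated bumps and symbols depending on the frequencies only:
  \<open>(1 + |\<xi>\<^sub>1|\<^sup>2 + |\<xi>\<^sub>2|\<^sup>2) powr (- n / 4)\<close> for \<open>BS\<close>, and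
  \<open>(1 + |\<xi>\<^sub>1|\<^sup>2) powr (m\<^sub>1 / 2) * (1 + |\<xi>\<^sub>2|\<^sup>2) powr (m\<^sub>2 / 2)\<close> for \<open>BS2\<close>.
  Let the Fourier transforms of \<open>f\<^sub>1, f\<^sub>2\<close> be fixed bumps moved to \<open>2\<^sup>j u\<^sub>1\<close> and \<open>2\<^sup>j u\<^sub>2\<close>, where
  \<open>|u\<^sub>1|, |u\<^sub>2|, |u\<^sub>1 + u\<^sub>2|\<close> are \<open>0\<close> or \<open>1\<close>.  The norms of \<open>f\<^sub>i\<close> are then at most of size \<open>2\<^sup>j\<close> to the
  power \<open>s\<^sub>i |u\<^sub>i|\<close> for every integrability exponent \<open>\<ge> 2\<close>, while on the bumps the symbol is asymptotic to a multiple of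
  \<open>2\<^sup>j\<close> to its order.  So \<open>T(f\<^sub>1, f\<^sub>2)\<close>, divided by that power, converges pointwise in modulus to a fixed
  nonzero function, and Fatou's lemma bounds its norm from below; it lives at frequency
  \<open>2\<^sup>j (u\<^sub>1 + u\<^sub>2)\<close>.  Letting \<open>j\<close> tend to infinity, \<open>(u\<^sub>1, u\<^sub>2) = (0, e)\<close> and \<open>(e, 0)\<close> give the
  bounds on the minima, and \<open>(e, - e)\<close> gives \<open>s \<ge> - n / 2\<close>.
\<close>

subsection \<open>Gaussians and Fourier inversion\<close>

text \<open>The upper bounds use only the size and the support of Fourier transforms: for exponents
  at least 2 the sup bound and Plancherel suffice, so one constant serves every dyadic block and
  every position of the bump. The output is measured in an exponent that may be as small as 1, but
  only from below, and this is what Fatou gives without any control of tails. A bump that stays at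
  the origin meets a weight that does not become constant in the limit. In the product case the bump
  is divided by that weight beforehand. The limit is then always a multiple of the same tensor
  square, whose transform on the diagonal is the square of a nonzero function. The Besov quasi-norm
  is built from Fourier integrals, so a dyadic piece of T(f1, f2) can be computed only once this
  output is known to be integrable and its Fourier transform is identified. Fourier inversion and a
  shear in the two frequencies provide this.\<close>

lemma borel_measurable_cis [measurable]:
  "g \<in> borel_measurable M \<Longrightarrow> (\<lambda>x. cis (g x)) \<in> borel_measurable M"
  unfolding cis_conv_exp by measurable

lemma borel_measurable_cnj [measurable]:
  "g \<in> borel_measurable M \<Longrightarrow> (\<lambda>x. cnj (g x)) \<in> borel_measurable M"
  using borel_measurable_continuous_onI[OF continuous_on_cnj[OF continuous_on_id]] measurable_compose
      by blast

section \<open>Changes of variables and integrals of product functions\<close>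

lemma lborel_integral_affine:
  fixes f :: "'a::euclidean_space \<Rightarrow> 'b::{banach, second_countable_topology}"
  assumes "c \<noteq> 0" and [measurable]: "f \<in> borel_measurable borel"
  shows "(LINT x|lborel. f x) = \<bar>c\<bar> ^ DIM('a) *\<^sub>R (LINT x|lborel. f (t + c *\<^sub>R x))"
  by (subst lborel_affine[OF assms(1), of t])
     (simp add: integral_density integral_distr)

lemma lborel_integrable_affine:
  fixes f :: "'a::euclidean_space \<Rightarrow> 'b::{banach, second_countable_topology}"
  assumes "c \<noteq> 0" and int: "integrable lborel f"
  shows "integrable lborel (\<lambda>x. f (t + c *\<^sub>R x))"
proof -
  have m[measurable]: "f \<in> borel_measurable borel" using int by auto
  have "integrable (density (distr lborel borel (\<lambda>x. t + c *\<^sub>R x)) (\<lambda>_. ennreal (\<bar>c\<bar>^DIM('a)))) f"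
    using int by (subst (asm) lborel_affine[OF assms(1), of t])
  then have "integrable lborel (\<lambda>x. \<bar>c\<bar>^DIM('a) *\<^sub>R f (t + c *\<^sub>R x))"
    by (simp add: integrable_density integrable_distr_eq)
  then have "integrable lborel (\<lambda>x. inverse (\<bar>c\<bar>^DIM('a)) *\<^sub>R (\<bar>c\<bar>^DIM('a) *\<^sub>R f (t + c *\<^sub>R x)))"
    by (rule integrable_scaleR_right)
  then show ?thesis using assms(1) by simp
qed

text \<open>Lebesgue measure is the image of the product measure over \<open>Basis\<close>, so
  Fubini applies in product form. This serves the Gaussian and, later, the majorant of rapidly
  decreasing functions.\<close>

lemma
  fixes f :: "'a::euclidean_space \<Rightarrow> real \<Rightarrow> complex"
  assumes "\<And>b. b \<in> Basis \<Longrightarrow> integrable lborel (f b)"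
  shows integrable_lborel_prod: "integrable lborel (\<lambda>x::'a. \<Prod>b\<in>Basis. f b (x \<bullet> b))"
    and integral_lborel_prod: "(LINT x|lborel. (\<Prod>b\<in>Basis. f b (x \<bullet> b))) = (\<Prod>b\<in>Basis. LINT t|lborel. f
        b t)"
proof -
  interpret product_sigma_finite "\<lambda>_::'a. lborel :: real measure" by standard
  have m[measurable]: "f b \<in> borel_measurable borel" if "b \<in> Basis" for b
    using assms[OF that] by auto
  have *: "(\<Prod>b\<in>Basis. f b ((\<Sum>i\<in>Basis. g i *\<^sub>R i) \<bullet> b)) = (\<Prod>b\<in>Basis. f b (g b))" for g
    by (intro prod.cong) auto
  have "integrable (\<Pi>\<^sub>M b\<in>Basis. lborel) (\<lambda>x. \<Prod>b\<in>Basis. f b (x b))"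
    by (rule product_integrable_prod) (use assms in auto)
  then show "integrable lborel (\<lambda>x::'a. \<Prod>b\<in>Basis. f b (x \<bullet> b))"
    by (subst lborel_eq, subst integrable_distr_eq) (simp_all add: *)
  show "(LINT x|lborel. (\<Prod>b\<in>Basis. f b (x \<bullet> b))) = (\<Prod>b\<in>Basis. LINT t|lborel. f b t)"
    by (subst lborel_eq, subst integral_distr) (simp_all add: * product_integral_prod assms)
qed

text \<open>The standard normal density on \<open>'a\<close>; with this normalisation its mass is 1
  and its transform carries no constant.\<close>

definition gauss :: "'a::euclidean_space \<Rightarrow> real" where
  "gauss x = (1 / sqrt (2 * pi)) ^ DIM('a) * exp (- (norm x)\<^sup>2 / 2)"

lemma gauss_eq_prod: "gauss (x::'a::euclidean_space) = (\<Prod>b\<in>Basis. std_normal_density (x \<bullet> b))"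
proof -
  have "(norm x)\<^sup>2 = (\<Sum>b\<in>Basis. (x \<bullet> b)\<^sup>2)"
    unfolding power2_norm_eq_inner by (subst euclidean_inner) (simp add: power2_eq_square)
  then have "exp (- (norm x)\<^sup>2 / 2) = (\<Prod>b\<in>Basis. exp (- (x \<bullet> b)\<^sup>2 / 2))"
    by (simp add: exp_sum[symmetric] sum_negf sum_divide_distrib)
  then show ?thesis
    by (simp add: gauss_def std_normal_density_def prod.distrib prod_dividef power_divide)
qed

lemma gauss_measurable [measurable]: "gauss \<in> borel_measurable borel"
  unfolding gauss_def[abs_def] by measurable

lemma gauss_nonneg: "0 \<le> gauss x"
  by (simp add: gauss_def)

text \<open>The Gaussian and the character both split over the coordinates, which leaves in each of
  them the characteristic function of the standard normal distribution.\<close>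

lemma
  fixes \<xi> :: "'a::euclidean_space"
  shows integrable_cis_gauss: "integrable lborel (\<lambda>x. cis (x \<bullet> \<xi>) * of_real (gauss x))"
    and integral_cis_gauss: "(LINT x|lborel. cis (x \<bullet> \<xi>) * of_real (gauss x))
        = of_real (exp (- (norm \<xi>)\<^sup>2 / 2))"
proof -
  define f :: "'a \<Rightarrow> real \<Rightarrow> complex" where
    "f b t = cis (t * (\<xi> \<bullet> b)) * of_real (std_normal_density t)" for b t
  have i: "integrable lborel (f b)" for b
  proof (rule Bochner_Integration.integrable_bound[where f="std_normal_density"])
    show "integrable lborel std_normal_density"
      using integral_std_normal_moment_even[of 0] integrable_std_normal_moment[of 0] by simp
  qed (auto simp: f_def[abs_def] norm_mult)
  have v: "(LINT t|lborel. f b t) = of_real (exp (- (\<xi> \<bullet> b)\<^sup>2 / 2))" for b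
  proof -
    have "(LINT t|lborel. f b t) = char std_normal_distribution (\<xi> \<bullet> b)"
      unfolding char_def
      by (subst integral_density)
         (auto simp: f_def scaleR_conv_of_real cis_conv_exp mult_ac intro!:
             Bochner_Integration.integral_cong)
    then show ?thesis by (simp add: char_std_normal_distribution)
  qed
  have e: "cis (x \<bullet> \<xi>) * of_real (gauss x) = (\<Prod>b\<in>Basis. f b (x \<bullet> b))" for x
  proof -
    have "cis (x \<bullet> \<xi>) = (\<Prod>b\<in>Basis. cis ((x \<bullet> b) * (\<xi> \<bullet> b)))"
      by (subst euclidean_inner) (simp add: cis_conv_exp exp_sum sum_distrib_left)
    then show ?thesis
      by (simp add: f_def prod.distrib gauss_eq_prod)
  qed
  show "integrable lborel (\<lambda>x. cis (x \<bullet> \<xi>) * of_real (gauss x))"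
    unfolding e by (rule integrable_lborel_prod) (rule i)
  have "(norm \<xi>)\<^sup>2 = (\<Sum>b\<in>Basis. (\<xi> \<bullet> b)\<^sup>2)"
    unfolding power2_norm_eq_inner by (subst euclidean_inner) (simp add: power2_eq_square)
  then have "exp (- (norm \<xi>)\<^sup>2 / 2) = (\<Prod>b\<in>Basis. exp (- (\<xi> \<bullet> b)\<^sup>2 / 2))"
    by (simp add: exp_sum[symmetric] sum_negf sum_divide_distrib)
  then show "(LINT x|lborel. cis (x \<bullet> \<xi>) * of_real (gauss x)) = of_real (exp (- (norm \<xi>)\<^sup>2 / 2))"
    unfolding e by (subst integral_lborel_prod) (simp_all add: i v)
qed

lemma integrable_gauss: "integrable lborel (gauss :: 'a::euclidean_space \<Rightarrow> real)"
  and integral_gauss: "(LINT x|lborel. gauss (x::'a)) = 1"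
proof -
  have "integrable lborel (\<lambda>x::'a. complex_of_real (gauss x))"
    using integrable_cis_gauss[of "0::'a"] by simp
  then show "integrable lborel (gauss :: 'a \<Rightarrow> real)"
    by (simp only: complex_of_real_integrable_eq)
  have "complex_of_real (LINT x|lborel. gauss (x::'a)) = 1"
    using integral_cis_gauss[of "0::'a"] by simp
  then show "(LINT x|lborel. gauss (x::'a)) = 1"
    using of_real_eq_1_iff by blast
qed

lemma integrable_cis_mult:
  fixes f :: "'a::euclidean_space \<Rightarrow> complex"
  assumes "integrable lborel f" and [measurable]: "g \<in> borel_measurable borel"
  shows "integrable lborel (\<lambda>x. cis (g x) * f x)"
proof (rule Bochner_Integration.integrable_bound[OF assms(1)])
  have [measurable]: "f \<in> borel_measurable borel" using assms(1) by auto
  show "(\<lambda>x. cis (g x) * f x) \<in> borel_measurable lborel"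
    by measurable
qed (auto simp: norm_mult)

lemma norm_inv_fourier_le:
  fixes f :: "'a::euclidean_space \<Rightarrow> complex"
  assumes "integrable lborel f"
  shows "cmod (inv_fourier f x) \<le> 1 / (2 * pi) ^ DIM('a) * (LINT \<xi>|lborel. cmod (f \<xi>))"
proof -
  have "cmod (LINT \<xi>|lborel. cis (x \<bullet> \<xi>) * f \<xi>) \<le> (LINT \<xi>|lborel. cmod (cis (x \<bullet> \<xi>) * f \<xi>))"
    by (rule integral_norm_bound)
  then show ?thesis
    by (simp add: inv_fourier_def norm_mult norm_divide norm_power divide_right_mono)
qed

lemma inv_fourier_measurable [measurable]:
  fixes f :: "'a::euclidean_space \<Rightarrow> complex"
  assumes [measurable]: "f \<in> borel_measurable borel"
  shows "inv_fourier f \<in> borel_measurable borel"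
  unfolding inv_fourier_def[abs_def] by measurable

text \<open>The kernel that the regularising factor of the inversion theorem produces: a Gaussian of
  width \<epsilon> and total mass (2 pi)^n, to be used with a difference of frequencies in place of
  \<zeta>.\<close>

lemma integral_cis_gauss_scaled:
  fixes \<zeta> :: "'a::euclidean_space"
  assumes "\<epsilon> > 0"
  shows "(LINT x|lborel. cis (x \<bullet> \<zeta>) * of_real (exp (- (norm (\<epsilon> *\<^sub>R x))\<^sup>2 / 2)))
    = of_real ((2 * pi) ^ DIM('a) / \<epsilon> ^ DIM('a) * gauss ((1 / \<epsilon>) *\<^sub>R \<zeta>))"
proof -
  \<comment> \<open>Replacing the exponential by \<open>gauss\<close> costs a factor 1 /
    \<open>c\<close> before the transform and another one after it; together they are (2
    pi)^n.\<close>
  define c where "c = (1 / sqrt (2 * pi)) ^ DIM('a)"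
  have c: "c > 0" by (simp add: c_def)
  have c2: "c * c = 1 / (2 * pi) ^ DIM('a)"
  proof -
    have "(1 / sqrt (2 * pi)) * (1 / sqrt (2 * pi)) = 1 / (2 * pi)"
      by (simp del: real_sqrt_mult add: real_sqrt_mult[symmetric])
    then show ?thesis unfolding c_def power_mult_distrib[symmetric] by (simp add: power_one_over)
  qed
  have e: "exp (- (norm x)\<^sup>2 / 2) = gauss x / c" for x :: 'a
    using c by (simp add: gauss_def c_def)
  have "(LINT x|lborel. cis (x \<bullet> \<zeta>) * of_real (exp (- (norm (\<epsilon> *\<^sub>R x))\<^sup>2 / 2)))
    = \<bar>1 / \<epsilon>\<bar> ^ DIM('a) *\<^sub>R (LINT x|lborel. cis ((0 + (1 / \<epsilon>) *\<^sub>R x) \<bullet> \<zeta>) *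
         of_real (exp (- (norm (\<epsilon> *\<^sub>R (0 + (1 / \<epsilon>) *\<^sub>R x)))\<^sup>2 / 2)))"
    using assms by (intro lborel_integral_affine) auto
  also have "(LINT x|lborel. cis ((0 + (1 / \<epsilon>) *\<^sub>R x) \<bullet> \<zeta>) *
         of_real (exp (- (norm (\<epsilon> *\<^sub>R (0 + (1 / \<epsilon>) *\<^sub>R x)))\<^sup>2 / 2)))
     = (LINT x|lborel. (cis (x \<bullet> ((1 / \<epsilon>) *\<^sub>R \<zeta>)) * of_real (gauss x)) / of_real c)"
    using assms unfolding e by (intro Bochner_Integration.integral_cong) auto
  also have "\<bar>1 / \<epsilon>\<bar> ^ DIM('a) *\<^sub>R (LINT x|lborel. (cis (x \<bullet> ((1 / \<epsilon>) *\<^sub>R \<zeta>)) * of_real (gauss x)) /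
      of_real c)
     = of_real ((1 / \<epsilon>) ^ DIM('a) * (exp (- (norm ((1 / \<epsilon>) *\<^sub>R \<zeta>))\<^sup>2 / 2) / c))"
    unfolding integral_divide_zero integral_cis_gauss using assms by (simp add: scaleR_conv_of_real)
  also have "(1 / \<epsilon>) ^ DIM('a) * (exp (- (norm ((1 / \<epsilon>) *\<^sub>R \<zeta>))\<^sup>2 / 2) / c)
     = (2 * pi) ^ DIM('a) / \<epsilon> ^ DIM('a) * gauss ((1 / \<epsilon>) *\<^sub>R \<zeta>)"
  proof -
    have "(2 * pi) ^ DIM('a) = 1 / (c * c)" using c2 by simp
    then show ?thesis unfolding e using c assms by (simp only:) (simp add: power_one_over divide_simps)
  qed
  finally show ?thesis .
qed

text \<open>Gaussian summation: inserting the factor \<open>exp (- |\<epsilon> x|\<^sup>2 / 2)\<close> makes Fubini applicable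
  and turns the inner integral into a Gaussian approximate identity.\<close>

theorem fourier_inv_fourier:
  fixes F :: "'a::euclidean_space \<Rightarrow> complex"
  assumes int: "integrable lborel F" and cont: "continuous_on UNIV F"
    and bdd: "\<And>x. cmod (F x) \<le> M" and intG: "integrable lborel (inv_fourier F)"
  shows "fourier (inv_fourier F) = F"
proof
  fix \<xi> :: 'a
  let ?G = "inv_fourier F" and ?n = "DIM('a)"
  define E :: "nat \<Rightarrow> 'a \<Rightarrow> real" where "E j x = exp (- (norm (inverse (Suc j) *\<^sub>R x))\<^sup>2 / 2)" for j x
  have [measurable]: "F \<in> borel_measurable borel" using int by auto
  have [measurable]: "E j \<in> borel_measurable borel" for j unfolding E_def[abs_def] by measurable
  have E0: "0 \<le> E j x" "E j x \<le> 1" for j x by (auto simp: E_def)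
  have lim0: "(\<lambda>j. inverse (real (Suc j))) \<longlonglongrightarrow> 0" by (rule LIMSEQ_inverse_real_of_nat)
  have E1: "(\<lambda>j. E j x) \<longlonglongrightarrow> 1" for x
  proof -
    have "(\<lambda>j. exp (- (norm (inverse (Suc j) *\<^sub>R x))\<^sup>2 / 2)) \<longlonglongrightarrow> exp (- (norm (0 *\<^sub>R x))\<^sup>2 / 2)"
      by (intro tendsto_intros lim0)  auto
    then show ?thesis by (simp add: E_def)
  qed
  have L: "(\<lambda>j. LINT x|lborel. cis (- (x \<bullet> \<xi>)) * ?G x * of_real (E j x)) \<longlonglongrightarrow> (LINT x|lborel. cis (- (x \<bullet>
      \<xi>)) * ?G x)"
  proof (rule integral_dominated_convergence[where w="\<lambda>x. cmod (?G x)"])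
    show "AE x in lborel. (\<lambda>j. cis (- (x \<bullet> \<xi>)) * ?G x * of_real (E j x)) \<longlonglongrightarrow> cis (- (x \<bullet> \<xi>)) * ?G x"
    proof (rule AE_I2)
      fix x
      have "(\<lambda>j. cis (- (x \<bullet> \<xi>)) * ?G x * of_real (E j x)) \<longlonglongrightarrow> cis (- (x \<bullet> \<xi>)) * ?G x * of_real 1"
        by (intro tendsto_intros E1)
      then show "(\<lambda>j. cis (- (x \<bullet> \<xi>)) * ?G x * of_real (E j x)) \<longlonglongrightarrow> cis (- (x \<bullet> \<xi>)) * ?G x" by simp
    qed
  qed (use intG E0 in \<open>auto simp: norm_mult intro!: mult_left_le\<close>)
  have R: "(LINT x|lborel. cis (- (x \<bullet> \<xi>)) * ?G x * of_real (E j x))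
      = (LINT y|lborel. F (\<xi> + inverse (Suc j) *\<^sub>R y) * of_real (gauss y))" for j
  proof -
    define \<epsilon> where "\<epsilon> = inverse (real (Suc j))"
    have \<epsilon>: "\<epsilon> > 0" by (simp add: \<epsilon>_def)
    let ?k = "complex_of_real (1 / (2 * pi) ^ ?n)"
    define h where "h x \<eta> = F \<eta> * (cis (x \<bullet> (\<eta> - \<xi>)) * of_real (E j x))" for x \<eta>
    have intE: "integrable lborel (E j)"
    proof -
      have "integrable lborel (\<lambda>x::'a. gauss (0 + \<epsilon> *\<^sub>R x) / (1 / sqrt (2 * pi)) ^ ?n)"
        using \<epsilon> by (intro integrable_divide_zero lborel_integrable_affine integrable_gauss) auto
      then show ?thesis by (simp add: E_def[abs_def] gauss_def \<epsilon>_def)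
    qed
    have inth: "integrable (lborel \<Otimes>\<^sub>M lborel) (\<lambda>(x, \<eta>). h x \<eta>)"
    proof (rule lborel_pair.Fubini_integrable)
      show "integrable lborel (\<lambda>x. LINT \<eta>|lborel. norm (case (x, \<eta>) of (x, \<eta>) \<Rightarrow> h x \<eta>))"
        using E0 intE by (simp add: h_def norm_mult)
      show "AE x in lborel. integrable lborel (\<lambda>\<eta>. case (x, \<eta>) of (x, \<eta>) \<Rightarrow> h x \<eta>)"
      proof (rule AE_I2)
        fix x
        have "integrable lborel (\<lambda>\<eta>. cis (x \<bullet> (\<eta> - \<xi>)) * F \<eta> * of_real (E j x))"
          by (intro integrable_mult_left integrable_cis_mult int) auto
        then show "integrable lborel (\<lambda>\<eta>. case (x, \<eta>) of (x, \<eta>) \<Rightarrow> h x \<eta>)"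
          by (simp add: h_def mult_ac)
      qed
    qed (simp add: h_def[abs_def])
    have "(LINT x|lborel. cis (- (x \<bullet> \<xi>)) * ?G x * of_real (E j x))
        = (LINT x|lborel. ?k * (LINT \<eta>|lborel. h x \<eta>))"
    proof (rule Bochner_Integration.integral_cong)
      fix x
      have "(LINT \<eta>|lborel. h x \<eta>) = (LINT \<eta>|lborel. (cis (x \<bullet> \<eta>) * F \<eta>) * (cis (- (x \<bullet> \<xi>))
          * of_real (E j x)))"
      proof (rule Bochner_Integration.integral_cong)
        fix \<eta>
        have "cis (x \<bullet> (\<eta> - \<xi>)) = cis (x \<bullet> \<eta>) * cis (- (x \<bullet> \<xi>))"
          by (simp add: cis_mult inner_diff_right)
        then show "h x \<eta> = (cis (x \<bullet> \<eta>) * F \<eta>) * (cis (- (x \<bullet> \<xi>)) * of_real (E j x))"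
          by (simp add: h_def)
      qed simp
      also have "\<dots> = (LINT \<eta>|lborel. cis (x \<bullet> \<eta>) * F \<eta>) * (cis (- (x \<bullet> \<xi>)) * of_real (E j x))"
        by (rule integral_mult_left_zero)
      finally show "cis (- (x \<bullet> \<xi>)) * ?G x * of_real (E j x) = ?k * (LINT \<eta>|lborel. h x \<eta>)"
        by (simp add: inv_fourier_def mult_ac)
    qed simp
    also have "\<dots> = ?k * (LINT \<eta>|lborel. LINT x|lborel. h x \<eta>)"
      using lborel_pair.Fubini_integral[OF inth] by simp
    also have "\<dots> = ?k * (LINT \<eta>|lborel. F \<eta> * of_real ((2 * pi) ^ ?n / \<epsilon> ^ ?n * gauss ((1 / \<epsilon>) *\<^sub>R (\<eta>
        - \<xi>))))"
      using \<epsilon> by (simp only: h_def E_def \<epsilon>_def[symmetric] integral_mult_right_zero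
          integral_cis_gauss_scaled)
    also have "\<dots> = ?k * (\<bar>\<epsilon>\<bar> ^ ?n *\<^sub>R (LINT y|lborel. F (\<xi> + \<epsilon> *\<^sub>R y) * of_real ((2 * pi) ^ ?n / \<epsilon> ^
        ?n * gauss ((1 / \<epsilon>) *\<^sub>R (\<xi> + \<epsilon> *\<^sub>R y - \<xi>)))))"
      using \<epsilon> by (subst lborel_integral_affine[where c=\<epsilon> and t=\<xi>]) auto
    also have "\<dots> = ?k * (\<epsilon> ^ ?n *\<^sub>R (LINT y|lborel. (F (\<xi> + \<epsilon> *\<^sub>R y) * of_real (gauss y))
        * of_real ((2 * pi) ^ ?n / \<epsilon> ^ ?n)))"
      using \<epsilon> by (simp add: mult_ac)
    also have "\<dots> = (LINT y|lborel. F (\<xi> + \<epsilon> *\<^sub>R y) * of_real (gauss y))"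
      using \<epsilon> by (subst integral_mult_left_zero) (simp add: scaleR_conv_of_real field_simps)
    finally show ?thesis by (simp add: \<epsilon>_def)
  qed
  \<comment> \<open>Continuity of \<open>F\<close> gives the pointwise limit, boundedness gives the
    majorant, and the unit mass of \<open>gauss\<close> makes the limit equal to
    \<open>F \<xi>\<close>.\<close>
  have "(\<lambda>j. LINT y|lborel. F (\<xi> + inverse (Suc j) *\<^sub>R y) * of_real (gauss y)) \<longlonglongrightarrow> (LINT y|lborel. F \<xi>
      * of_real (gauss (y::'a)))"
  proof (rule integral_dominated_convergence[where w="\<lambda>y. M * gauss y"])
    show "AE y in lborel. (\<lambda>j. F (\<xi> + inverse (Suc j) *\<^sub>R y) * of_real (gauss y))
        \<longlonglongrightarrow> F \<xi> * of_real (gauss y)"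
    proof (rule AE_I2)
      fix y
      have "(\<lambda>j. \<xi> + inverse (Suc j) *\<^sub>R y) \<longlonglongrightarrow> \<xi> + 0 *\<^sub>R y" by (intro tendsto_intros lim0)
      then have "(\<lambda>j. F (\<xi> + inverse (Suc j) *\<^sub>R y)) \<longlonglongrightarrow> F \<xi>"
        using continuous_on_tendsto_compose[OF cont, of _ \<xi>] by simp
      then show "(\<lambda>j. F (\<xi> + inverse (Suc j) *\<^sub>R y) * of_real (gauss y)) \<longlonglongrightarrow> F \<xi> * of_real (gauss y)"
        by (intro tendsto_intros)
    qed
    show "integrable lborel (\<lambda>y::'a. M * gauss y)"
        by (rule integrable_mult_right) (rule integrable_gauss)
    show "AE y in lborel. norm (F (\<xi> + inverse (Suc j) *\<^sub>R y) * of_real (gauss y)) \<le> M * gauss y" for j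
      by (auto simp: norm_mult gauss_nonneg intro!: mult_right_mono bdd)
  qed auto
  also have "(LINT y|lborel. F \<xi> * of_real (gauss (y::'a))) = F \<xi>"
    by (simp add: integral_gauss)
  finally show "fourier ?G \<xi> = F \<xi>"
    using L LIMSEQ_unique unfolding R fourier_def by blast
qed

text \<open>Plancherel, deduced from inversion: one factor of the squared modulus is written as a
  conjugated integral, Fubini exchanges the order, and the inner integral becomes
  \<open>fourier (inv_fourier F)\<close>, which is \<open>F\<close>.\<close>

lemma nn_integral_inv_fourier_square:
  fixes F :: "'a::euclidean_space \<Rightarrow> complex"
  assumes int: "integrable lborel F" and cont: "continuous_on UNIV F"
    and bdd: "\<And>x. cmod (F x) \<le> M" and intG: "integrable lborel (inv_fourier F)"
  shows "(\<integral>\<^sup>+x. ennreal ((cmod (inv_fourier F x))\<^sup>2) \<partial>lborel)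
     = ennreal (1 / (2 * pi) ^ DIM('a) * (LINT \<xi>|lborel. (cmod (F \<xi>))\<^sup>2))"
proof -
  let ?G = "inv_fourier F" and ?n = "DIM('a)"
  let ?k = "complex_of_real (1 / (2 * pi) ^ ?n)"
  have [measurable]: "F \<in> borel_measurable borel" using int by auto
  define h where "h x \<xi> = ?G x * (cis (- (x \<bullet> \<xi>)) * cnj (F \<xi>))" for x \<xi>
  have inth: "integrable (lborel \<Otimes>\<^sub>M lborel) (\<lambda>(x, \<eta>). h x \<eta>)"
  proof (rule lborel_pair.Fubini_integrable)
    show "integrable lborel (\<lambda>x. LINT \<eta>|lborel. norm (case (x, \<eta>) of (x, \<eta>) \<Rightarrow> h x \<eta>))"
      using intG by (simp add: h_def norm_mult)
    show "AE x in lborel. integrable lborel (\<lambda>\<eta>. case (x, \<eta>) of (x, \<eta>) \<Rightarrow> h x \<eta>)"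
      using int by (auto simp: h_def intro!: integrable_mult_right integrable_cis_mult)
  qed (simp add: h_def[abs_def])
  have bG: "cmod (?G x) \<le> 1 / (2 * pi) ^ ?n * (LINT \<xi>|lborel. cmod (F \<xi>))" for x
    by (rule norm_inv_fourier_le[OF int])
  \<comment> \<open>A bounded integrable function is square integrable. This turns the identity of
    Bochner integrals below into one for the nonnegative integral.\<close>
  have i2: "integrable lborel (\<lambda>x. (cmod (?G x))\<^sup>2)"
  proof (rule Bochner_Integration.integrable_bound)
    show "integrable lborel (\<lambda>x. (1 / (2 * pi) ^ ?n * (LINT \<xi>|lborel. cmod (F \<xi>))) * cmod (?G x))"
      using intG by simp
    show "AE x in lborel. norm ((cmod (?G x))\<^sup>2) \<le> norm ((1 / (2 * pi) ^ ?n * (LINT \<xi>|lborel. cmod (F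
        \<xi>))) * cmod (?G x))"
      unfolding power2_eq_square norm_mult[of "1 / (2 * pi) ^ ?n * (LINT \<xi>|lborel. cmod (F \<xi>))"]
          norm_mult[of "cmod _"]
      by (intro AE_I2 mult_mono) (use bG abs_ge_self order_trans in \<open>auto simp del:
          times_divide_eq_left\<close>)
  qed simp
  have "complex_of_real (LINT x|lborel. (cmod (?G x))\<^sup>2) = (LINT x|lborel. ?G x * cnj (?G x))"
    unfolding complex_norm_square[symmetric] integral_complex_of_real[symmetric] by simp
  also have "\<dots> = (LINT x|lborel. ?k * (LINT \<xi>|lborel. h x \<xi>))"
  proof (rule Bochner_Integration.integral_cong)
    fix x
    have "cnj (LINT \<xi>|lborel. cis (x \<bullet> \<xi>) * F \<xi>) = (LINT \<xi>|lborel. cnj (cis (x \<bullet> \<xi>) * F \<xi>))"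
      by (rule Bochner_Integration.integral_cnj[symmetric])
    then show "?G x * cnj (?G x) = ?k * (LINT \<xi>|lborel. h x \<xi>)"
      by (simp add: h_def inv_fourier_def cis_cnj)
  qed simp
  also have "\<dots> = ?k * (LINT \<xi>|lborel. LINT x|lborel. h x \<xi>)"
    using lborel_pair.Fubini_integral[OF inth] by simp
  also have "\<dots> = ?k * (LINT \<xi>|lborel. fourier ?G \<xi> * cnj (F \<xi>))"
    by (simp add: fourier_def h_def mult_ac flip: integral_mult_right_zero)
  also have "\<dots> = of_real (1 / (2 * pi) ^ DIM('a) * (LINT \<xi>|lborel. (cmod (F \<xi>))\<^sup>2))"
    unfolding fourier_inv_fourier[OF assms] complex_norm_square[symmetric]
      integral_complex_of_real[symmetric] of_real_mult by simp
  finally have "(LINT x|lborel. (cmod (?G x))\<^sup>2) = 1 / (2 * pi) ^ DIM('a) * (LINT \<xi>|lborel. (cmod (F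
      \<xi>))\<^sup>2)"
    using of_real_eq_iff by blast
  then show ?thesis using nn_integral_eq_integral[OF i2] by simp
qed

subsection \<open>Smooth functions and symbol classes\<close>

definition dir_deriv :: "'a::euclidean_space \<Rightarrow> ('a \<Rightarrow> complex) \<Rightarrow> 'a \<Rightarrow> complex" where
  "dir_deriv v f = (\<lambda>x. frechet_derivative f (at x) v)"

lemma dir_derivI: "(\<And>x. (f has_derivative D x) (at x)) \<Longrightarrow> dir_deriv v f = (\<lambda>x. D x v)"
  unfolding dir_deriv_def using frechet_derivative_at by metis

lemma iter_pderiv_append: "iter_pderiv (us @ vs) f = iter_pderiv us (iter_pderiv vs f)"
  by (induction us) auto

text \<open>The last direction of the list is differentiated first. Peeling it off shows that
  derivatives inherit smoothness and bounds, whereas the recursion of \<open>iter_pderiv\<close>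
  peels off the outermost direction.\<close>

lemma iter_pderiv_snoc: "iter_pderiv (us @ [v]) f = iter_pderiv us (dir_deriv v f)"
  by (simp add: iter_pderiv_append dir_deriv_def)

text \<open>Replaces inductions over lists of directions: a function is smooth, and its derivatives
  are of a known form, as soon as it lies in one family with this property.\<close>

definition deriv_closed :: "('a::euclidean_space \<Rightarrow> complex) set \<Rightarrow> bool" where
  "deriv_closed S \<longleftrightarrow> (\<forall>f\<in>S. (\<forall>x. f differentiable (at x)) \<and> (\<forall>v\<in>Basis. dir_deriv v f \<in> S))"

lemma deriv_closed_iter_pderiv:
  assumes "deriv_closed S" "f \<in> S" "vs \<in> lists Basis"
  shows "iter_pderiv vs f \<in> S"
  using assms(3)
proof (induction vs)
  case (Cons v vs)
  then have "dir_deriv v (iter_pderiv vs f) \<in> S" using assms(1) by (auto simp: deriv_closed_def)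
  then show ?case by (simp add: dir_deriv_def)
qed (use assms(2) in simp)

lemma deriv_closed_smooth: "deriv_closed S \<Longrightarrow> f \<in> S \<Longrightarrow> smooth_fun f"
  unfolding smooth_fun_def using deriv_closed_iter_pderiv[of S f] deriv_closed_def by blast

lemma smooth_fun_has_derivative:
  "smooth_fun f \<Longrightarrow> (f has_derivative frechet_derivative f (at x)) (at x)"
  unfolding smooth_fun_def frechet_derivative_works[symmetric] by (metis iter_pderiv.simps(1) lists.Nil)

lemma smooth_fun_continuous_on: "smooth_fun f \<Longrightarrow> continuous_on A f"
  by (meson continuous_at_imp_continuous_on has_derivative_continuous smooth_fun_has_derivative)

lemma deriv_closed_smooth_fun: "deriv_closed {f. smooth_fun f}"
  unfolding deriv_closed_def
proof (safe)
  fix f :: "'a \<Rightarrow> complex" and x assume "smooth_fun f"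
  then show "f differentiable (at x)" using smooth_fun_has_derivative differentiable_def by blast
next
  fix f :: "'a \<Rightarrow> complex" and v :: 'a assume f: "smooth_fun f" and v: "v \<in> Basis"
  have "iter_pderiv us (dir_deriv v f) differentiable (at x)" if "us \<in> lists Basis" for us x
    using f that v unfolding smooth_fun_def iter_pderiv_snoc[symmetric] by auto
  then show "smooth_fun (dir_deriv v f)" by (auto simp: smooth_fun_def)
qed

text \<open>The class of type (0, 0) with weight \<open>w\<close>, on an arbitrary Euclidean space.
  The directions may come in any order, so on triples it covers the block order used in
  \<open>symbols_bounded_by\<close>.\<close>

definition symbols_of_order :: "('a::euclidean_space \<Rightarrow> real) \<Rightarrow> ('a \<Rightarrow> complex) set" where
  "symbols_of_order w = {f. smooth_fun f \<and>
     (\<forall>vs\<in>lists Basis. \<exists>C. \<forall>x. cmod (iter_pderiv vs f x) \<le> C * w x)}"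

lemma deriv_closed_symbols_of_order: "deriv_closed (symbols_of_order w)"
  unfolding deriv_closed_def
proof (intro ballI conjI allI)
  fix f :: "'a \<Rightarrow> complex" and x assume "f \<in> symbols_of_order w"
  then show "f differentiable (at x)"
    using smooth_fun_has_derivative differentiable_def by (auto simp: symbols_of_order_def) blast
next
  fix f :: "'a \<Rightarrow> complex" and v :: 'a assume f: "f \<in> symbols_of_order w" and v: "v \<in> Basis"
  have "\<exists>C. \<forall>x. cmod (iter_pderiv us (dir_deriv v f) x) \<le> C * w x" if "us \<in> lists Basis" for us
    using f that v unfolding symbols_of_order_def iter_pderiv_snoc[symmetric] by auto
  moreover have "smooth_fun (dir_deriv v f)"
    using deriv_closed_smooth_fun f v by (auto simp: deriv_closed_def symbols_of_order_def)
  ultimately show "dir_deriv v f \<in> symbols_of_order w" by (auto simp: symbols_of_order_def)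
qed

lemma symbols_of_order_bound:
  assumes "f \<in> symbols_of_order w" shows "\<exists>C. \<forall>x. cmod (f x) \<le> C * w x"
  using assms unfolding symbols_of_order_def by (force dest: bspec[of _ _ "[]"])

lemma symbols_of_order_smooth: "f \<in> symbols_of_order w \<Longrightarrow> smooth_fun f"
  by (simp add: symbols_of_order_def)

text \<open>The Leibniz and chain rules turn a generator into a finite sum of generators, so a
  family becomes closed under derivatives only through its span. Adding one scaled generator at a
  time keeps the inductions short.\<close>

inductive_set fspan :: "('a \<Rightarrow> complex) set \<Rightarrow> ('a \<Rightarrow> complex) set" for S where
  zero: "(\<lambda>_. 0) \<in> fspan S"
| add_scaled: "f \<in> S \<Longrightarrow> g \<in> fspan S \<Longrightarrow> (\<lambda>x. c * f x + g x) \<in> fspan S"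

lemma fspan_base: "f \<in> S \<Longrightarrow> f \<in> fspan S"
  using fspan.add_scaled[OF _ fspan.zero, of f S 1] by simp

lemma fspan_add: "f \<in> fspan S \<Longrightarrow> g \<in> fspan S \<Longrightarrow> (\<lambda>x. f x + g x) \<in> fspan S"
proof (induction rule: fspan.induct)
  case (add_scaled f h c)
  then show ?case using fspan.add_scaled[of f S "\<lambda>x. h x + g x" c] by (simp add: add.assoc)
qed simp

lemma fspan_scale: "f \<in> fspan S \<Longrightarrow> (\<lambda>x. c * f x) \<in> fspan S"
proof (induction rule: fspan.induct)
  case (add_scaled f h d)
  then show ?case using fspan.add_scaled[of f S "\<lambda>x. c * h x" "c * d"] by (simp add: algebra_simps)
qed (use fspan.zero in simp)

lemma fspan_sum: "finite I \<Longrightarrow> (\<And>i. i \<in> I \<Longrightarrow> f i \<in> fspan S) \<Longrightarrow> (\<lambda>x. \<Sum>i\<in>I. f i x) \<in> fspan S"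
  by (induction I rule: finite_induct) (auto intro: fspan.zero fspan_add)

lemma fspan_mono: "S \<subseteq> T \<Longrightarrow> fspan S \<subseteq> fspan T"
proof
  fix f assume "S \<subseteq> T" "f \<in> fspan S"
  from this(2,1) show "f \<in> fspan T"
    by (induction rule: fspan.induct) (auto intro: fspan.intros)
qed

text \<open>Differentiation is linear, so closure of the span can be read off from the
  generators.\<close>

lemma deriv_closed_fspanI:
  fixes S :: "('a::euclidean_space \<Rightarrow> complex) set"
  assumes "\<And>f. f \<in> S \<Longrightarrow> \<exists>D. \<forall>x. (f has_derivative D x) (at x) \<and> (\<forall>v\<in>Basis. (\<lambda>x. D x v) \<in> fspan S)"
  shows "deriv_closed (fspan S)"
proof -
  have *: "\<exists>D. \<forall>x. (f has_derivative D x) (at x) \<and> (\<forall>v\<in>Basis. (\<lambda>x. D x v) \<in> fspan S)" if "f \<in> fspan S"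
      for f
    using that
  proof (induction rule: fspan.induct)
    case zero
    show ?case by (rule exI[of _ "\<lambda>x v. 0"]) (simp add: fspan.zero)
  next
    case (add_scaled f g c)
    from assms[OF add_scaled(1)] obtain D where
      D: "\<And>x. (f has_derivative D x) (at x)" "\<And>v. v\<in>Basis \<Longrightarrow> (\<lambda>x. D x v) \<in> fspan S" by auto
    from add_scaled(3) obtain D' where
      D': "\<And>x. (g has_derivative D' x) (at x)" "\<And>v. v\<in>Basis \<Longrightarrow> (\<lambda>x. D' x v) \<in> fspan S" by auto
    show ?case
      by (rule exI[of _ "\<lambda>x v. c * D x v + D' x v"])
         (auto intro!: derivative_eq_intros D D' fspan_add fspan_scale)
  qed
  show ?thesis
    unfolding deriv_closed_def
  proof (intro ballI conjI allI)
    fix f x assume "f \<in> fspan S"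
    then show "f differentiable (at x)"
      using * unfolding differentiable_def by blast
  next
    fix f and v :: 'a assume "f \<in> fspan S" "v \<in> Basis"
    then obtain D where D: "\<And>x. (f has_derivative D x) (at x)" "(\<lambda>x. D x v) \<in> fspan S" using * by blast
    show "dir_deriv v f \<in> fspan S" using D(2) unfolding dir_derivI[of f D v, OF D(1)] .
  qed
qed

text \<open>Every iterated derivative is a finite combination of generators, so a bound by
  \<open>w\<close> on the generators controls all orders at once.\<close>

lemma symbols_of_orderI:
  fixes S :: "('a::euclidean_space \<Rightarrow> complex) set"
  assumes "deriv_closed (fspan S)" and b: "\<And>f. f \<in> S \<Longrightarrow> \<exists>C. \<forall>x. cmod (f x) \<le> C * w x"
  shows "fspan S \<subseteq> symbols_of_order w"
proof -
  have "\<exists>C. \<forall>x. cmod (f x) \<le> C * w x" if "f \<in> fspan S" for f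
    using that
  proof (induction rule: fspan.induct)
    case zero
    show ?case by (rule exI[of _ 0]) simp
  next
    case (add_scaled f g c)
    from b[OF add_scaled(1)] obtain C where C: "\<And>x. cmod (f x) \<le> C * w x" by auto
    from add_scaled(3) obtain C' where C': "\<And>x. cmod (g x) \<le> C' * w x" by auto
    have "cmod (c * f x + g x) \<le> (cmod c * C + C') * w x" for x
    proof -
      have "cmod (c * f x + g x) \<le> cmod c * cmod (f x) + cmod (g x)"
        using norm_triangle_ineq[of "c * f x" "g x"] by (simp add: norm_mult)
      also have "\<dots> \<le> cmod c * (C * w x) + C' * w x"
        by (intro add_mono mult_left_mono C C') auto
      finally show ?thesis by (simp add: algebra_simps)
    qed
    then show ?case by blast
  qed
  then show ?thesis
    using deriv_closed_iter_pderiv[OF assms(1)] deriv_closed_smooth[OF assms(1)]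
    unfolding symbols_of_order_def by blast
qed

text \<open>Leibniz rule: each of the two summands is again a product of a member of
  \<open>A\<close> and a member of \<open>B\<close>.\<close>

lemma deriv_closed_mult:
  assumes A: "deriv_closed A" and B: "deriv_closed B"
  shows "deriv_closed (fspan {\<lambda>x. f x * g x | f g. f \<in> A \<and> g \<in> B})" (is "deriv_closed (fspan ?S)")
proof (rule deriv_closed_fspanI)
  fix h assume "h \<in> ?S"
  then obtain f g where h: "h = (\<lambda>x. f x * g x)" and f: "f \<in> A" and g: "g \<in> B" by auto
  have f': "(f has_derivative frechet_derivative f (at x)) (at x)" for x
    using A f frechet_derivative_works unfolding deriv_closed_def by blast
  have g': "(g has_derivative frechet_derivative g (at x)) (at x)" for x
    using B g frechet_derivative_works unfolding deriv_closed_def by blast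
  have "(\<lambda>x. f x * frechet_derivative g (at x) v + frechet_derivative f (at x) v * g x) \<in> fspan ?S"
    if "v \<in> Basis" for v
  proof (rule fspan_add)
    have "dir_deriv v f \<in> A" "dir_deriv v g \<in> B" using that A B f g by (auto simp: deriv_closed_def)
    then show "(\<lambda>x. f x * frechet_derivative g (at x) v) \<in> fspan ?S"
      "(\<lambda>x. frechet_derivative f (at x) v * g x) \<in> fspan ?S"
      using f g unfolding dir_deriv_def by (auto intro!: fspan_base)
  qed
  then show "\<exists>D. \<forall>x. (h has_derivative D x) (at x) \<and> (\<forall>v\<in>Basis. (\<lambda>x. D x v) \<in> fspan ?S)"
    unfolding h
    by (intro exI[of _ "\<lambda>x v. f x * frechet_derivative g (at x) v + frechet_derivative f (at x) v
        * g x"])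
       (auto intro!: has_derivative_mult f' g')
qed

lemma smooth_fun_mult:
  assumes "smooth_fun f" "smooth_fun g" shows "smooth_fun (\<lambda>x. f x * g x)"
  by (rule deriv_closed_smooth[OF deriv_closed_mult[OF deriv_closed_smooth_fun deriv_closed_smooth_fun]])
     (rule fspan_base, use assms in auto)

lemma symbols_of_order_mult:
  assumes "f \<in> symbols_of_order w" "g \<in> symbols_of_order w'"
  shows "(\<lambda>x. f x * g x) \<in> symbols_of_order (\<lambda>x. w x * w' x)"
proof -
  let ?S = "{\<lambda>x. f x * g x | f g. f \<in> symbols_of_order w \<and> g \<in> symbols_of_order w'}"
  have "fspan ?S \<subseteq> symbols_of_order (\<lambda>x. w x * w' x)"
  proof (rule symbols_of_orderI)
    show "deriv_closed (fspan ?S)"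
      by (intro deriv_closed_mult deriv_closed_symbols_of_order)
    fix h assume "h \<in> ?S"
    then obtain f g where h: "h = (\<lambda>x. f x * g x)"
      and f: "f \<in> symbols_of_order w" and g: "g \<in> symbols_of_order w'" by auto
    obtain C where C: "\<And>x. cmod (f x) \<le> C * w x" using symbols_of_order_bound[OF f] by auto
    obtain C' where C': "\<And>x. cmod (g x) \<le> C' * w' x" using symbols_of_order_bound[OF g] by auto
    have "cmod (h x) \<le> (C * C') * (w x * w' x)" for x
    proof -
      have "cmod (h x) = cmod (f x) * cmod (g x)" by (simp add: h norm_mult)
      also have "\<dots> \<le> (C * w x) * (C' * w' x)"
        by (rule mult_mono[OF C C']) (use order_trans[OF norm_ge_zero C[of x]] in auto)
      finally show ?thesis by (simp add: mult_ac)
    qed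
    then show "\<exists>C. \<forall>x. cmod (h x) \<le> C * (w x * w' x)" by blast
  qed
  moreover have "(\<lambda>x. f x * g x) \<in> fspan ?S" by (rule fspan_base) (use assms in auto)
  ultimately show ?thesis by (rule subsetD)
qed

text \<open>Chain rule: the derivative in the direction \<open>L v\<close> is expanded in partial
  derivatives along \<open>Basis\<close>, with coefficients that do not depend on the point.\<close>

lemma deriv_closed_affine:
  fixes L :: "'a::euclidean_space \<Rightarrow> 'b::euclidean_space"
  assumes A: "deriv_closed A" and L: "bounded_linear L"
  shows "deriv_closed (fspan {\<lambda>x. f (L x + a) | f. f \<in> A})" (is "deriv_closed (fspan ?S)")
proof (rule deriv_closed_fspanI)
  fix h assume "h \<in> ?S"
  then obtain f where h: "h = (\<lambda>x. f (L x + a))" and f: "f \<in> A" by auto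
  have f': "(f has_derivative frechet_derivative f (at y)) (at y)" for y
    using A f frechet_derivative_works unfolding deriv_closed_def by blast
  have lin: "linear (frechet_derivative f (at y))" for y
    using f' has_derivative_linear by blast
  have "(\<lambda>x. frechet_derivative f (at (L x + a)) (L v)) \<in> fspan ?S" for v
  proof -
    have "frechet_derivative f (at y) (L v) = (\<Sum>b\<in>Basis. of_real (L v \<bullet> b) * dir_deriv b f y)" for y
    proof -
      have "frechet_derivative f (at y) (L v) = frechet_derivative f (at y) (\<Sum>b\<in>Basis. (L v \<bullet> b) *\<^sub>R b)"
        by (simp add: euclidean_representation)
      also have "\<dots> = (\<Sum>b\<in>Basis. (L v \<bullet> b) *\<^sub>R frechet_derivative f (at y) b)"
        by (simp add: linear_sum[OF lin] linear_scale[OF lin])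
      finally show ?thesis by (simp add: dir_deriv_def scaleR_conv_of_real)
    qed
    moreover have "(\<lambda>x. \<Sum>b\<in>Basis. of_real (L v \<bullet> b) * dir_deriv b f (L x + a)) \<in> fspan ?S"
    proof (intro fspan_sum fspan_scale fspan_base)
      show "(\<lambda>x. dir_deriv b f (L x + a)) \<in> ?S" if "b \<in> Basis" for b
        using A f that by (auto simp: deriv_closed_def)
    qed auto
    ultimately show ?thesis by simp
  qed
  moreover have "(h has_derivative (\<lambda>v. frechet_derivative f (at (L x + a)) (L v))) (at x)" for x
  proof -
    have "((\<lambda>x. L x + a) has_derivative L) (at x)"
      using bounded_linear_imp_has_derivative[OF L] by (auto intro!: derivative_eq_intros)
    from has_derivative_compose[OF this f'] show ?thesis by (simp add: h)
  qed
  ultimately show "\<exists>D. \<forall>x. (h has_derivative D x) (at x) \<and> (\<forall>v\<in>Basis. (\<lambda>x. D x v) \<in> fspan ?S)"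
    by (intro exI[of _ "\<lambda>x v. frechet_derivative f (at (L x + a)) (L v)"]) auto
qed

lemma smooth_fun_affine:
  fixes L :: "'a::euclidean_space \<Rightarrow> 'b::euclidean_space"
  assumes "smooth_fun f" "bounded_linear L" shows "smooth_fun (\<lambda>x. f (L x + a))"
  by (rule deriv_closed_smooth[OF deriv_closed_affine[OF deriv_closed_smooth_fun assms(2)]])
     (rule fspan_base, use assms in auto)

lemma symbols_of_order_linear:
  fixes L :: "'a::euclidean_space \<Rightarrow> 'b::euclidean_space"
  assumes "f \<in> symbols_of_order w" and L: "bounded_linear L"
  shows "(\<lambda>x. f (L x)) \<in> symbols_of_order (\<lambda>x. w (L x))"
proof -
  let ?S = "{\<lambda>x. f (L x + 0) | f. f \<in> symbols_of_order w}"
  have "fspan ?S \<subseteq> symbols_of_order (\<lambda>x. w (L x))"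
  proof (rule symbols_of_orderI)
    show "deriv_closed (fspan ?S)"
      by (intro deriv_closed_affine deriv_closed_symbols_of_order L)
    fix h assume "h \<in> ?S"
    then obtain f where "h = (\<lambda>x. f (L x))" "f \<in> symbols_of_order w" by auto
    then show "\<exists>C. \<forall>x. cmod (h x) \<le> C * w (L x)"
      using symbols_of_order_bound[of f w] by auto
  qed
  moreover have "(\<lambda>x. f (L x)) \<in> fspan ?S" by (rule fspan_base) (use assms in auto)
  ultimately show ?thesis by (rule subsetD)
qed

section \<open>Elementary smooth functions\<close>

lemma smooth_fun_const: "smooth_fun (\<lambda>_. c)"
proof -
  have "deriv_closed (fspan {\<lambda>_. c})"
    by (rule deriv_closed_fspanI) (auto intro!: exI[of _ "\<lambda>x v. 0"] fspan.zero)
  then show ?thesis by (rule deriv_closed_smooth) (simp add: fspan_base)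
qed

lemma smooth_fun_diff:
  fixes f g :: "'a::euclidean_space \<Rightarrow> complex"
  assumes "smooth_fun f" "smooth_fun g" shows "smooth_fun (\<lambda>x. f x - g x)"
proof -
  have "deriv_closed (fspan {f :: 'a \<Rightarrow> complex. smooth_fun f})"
  proof (rule deriv_closed_fspanI)
    fix f :: "'a \<Rightarrow> complex" assume f: "f \<in> {f. smooth_fun f}"
    have "(\<lambda>x. frechet_derivative f (at x) v) \<in> fspan {f. smooth_fun f}" if "v \<in> Basis" for v
      using deriv_closed_smooth_fun f that unfolding deriv_closed_def dir_deriv_def
          by (intro fspan_base) auto
    then show "\<exists>D. \<forall>x. (f has_derivative D x) (at x) \<and> (\<forall>v\<in>Basis. (\<lambda>x. D x v) \<in> fspan {f. smooth_fun f})"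
      using f smooth_fun_has_derivative by (intro exI[of _ "\<lambda>x. frechet_derivative f (at x)"]) auto
  qed
  moreover have "(\<lambda>x. f x + (- 1) * g x) \<in> fspan {f. smooth_fun f}"
    by (intro fspan_add fspan_scale fspan_base) (use assms in auto)
  ultimately have "smooth_fun (\<lambda>x. f x + (- 1) * g x)" by (rule deriv_closed_smooth)
  then show ?thesis by simp
qed

lemma smooth_fun_inner: "smooth_fun (\<lambda>x. of_real (x \<bullet> u))"
proof -
  have "deriv_closed (fspan {\<lambda>x. of_real (x \<bullet> u), \<lambda>_. 1})"
    (is "deriv_closed (fspan ?S)")
  proof (rule deriv_closed_fspanI)
    have *: "(\<lambda>_. complex_of_real (v \<bullet> u)) \<in> fspan ?S" for v
      using fspan_scale[OF fspan_base[of "\<lambda>_. 1" ?S], of "of_real (v \<bullet> u)"] by simp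
    fix f assume "f \<in> ?S"
    then consider "f = (\<lambda>x. of_real (x \<bullet> u))" | "f = (\<lambda>_. 1)" by blast
    then show "\<exists>D. \<forall>x. (f has_derivative D x) (at x) \<and> (\<forall>v\<in>Basis. (\<lambda>x. D x v) \<in> fspan ?S)"
    proof cases
      case 1
      then show ?thesis
        by (intro exI[of _ "\<lambda>x v. of_real (v \<bullet> u)"]) (auto intro!: derivative_eq_intros *)
    next
      case 2
      then show ?thesis
        by (intro exI[of _ "\<lambda>x v. 0"]) (auto intro!: derivative_eq_intros fspan.zero)
    qed
  qed
  then show ?thesis by (rule deriv_closed_smooth) (auto intro: fspan_base)
qed

section \<open>Powers of the Japanese bracket: comparable with (1 + |z|)^m but smooth at the
  origin\<close>

definition bessel :: "real \<Rightarrow> 'a::euclidean_space \<Rightarrow> real" where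
  "bessel m z = (1 + (norm z)\<^sup>2) powr (m / 2)"

text \<open>Derivatives of \<open>bessel m\<close> stay in the span of these functions, whose order
  \<open>length vs + 2 b\<close> never increases.\<close>

definition bessel_mono :: "'a::euclidean_space list \<Rightarrow> real \<Rightarrow> 'a \<Rightarrow> complex" where
  "bessel_mono vs b z = of_real (prod_list (map (\<lambda>v. z \<bullet> v) vs) * (1 + (norm z)\<^sup>2) powr b)"

text \<open>Order at most \<open>m\<close>, not equal to \<open>m\<close>: a derivative lowers the
  order by one and has to stay in the family.\<close>

definition bessel_monos :: "real \<Rightarrow> ('a::euclidean_space \<Rightarrow> complex) set" where
  "bessel_monos m = {bessel_mono vs b | vs b. real (length vs) + 2 * b \<le> m}"

lemma bessel_monos_mono: "m \<le> m' \<Longrightarrow> bessel_monos m \<subseteq> bessel_monos m'"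
  unfolding bessel_monos_def by fastforce

lemma fspan_bessel_monos_inner:
  "f \<in> fspan (bessel_monos m) \<Longrightarrow> (\<lambda>z. of_real (z \<bullet> u) * f z) \<in> fspan (bessel_monos (m + 1))"
proof (induction rule: fspan.induct)
  case zero
  then show ?case by (simp add: fspan.zero)
next
  case (add_scaled f g c)
  then obtain vs b where f: "f = bessel_mono vs b" "real (length vs) + 2 * b \<le> m"
      by (auto simp: bessel_monos_def)
  have "bessel_mono (u # vs) b \<in> bessel_monos (m + 1)"
    using f(2) unfolding bessel_monos_def by fastforce
  from fspan.add_scaled[OF this add_scaled(3), of c] show ?case
    by (simp add: f bessel_mono_def algebra_simps)
qed

text \<open>Without linear factors the derivative trades a power \<open>b\<close> for one linear
  factor and the power \<open>b - 1\<close>, so the order falls by one. A linear factor in front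
  raises every order by one, so the induction hypothesis is applied at \<open>m - 1\<close> and
  multiplied back by \<open>fspan_bessel_monos_inner\<close>.\<close>

lemma bessel_mono_has_derivative:
  "real (length vs) + 2 * b \<le> m \<Longrightarrow> \<exists>D. \<forall>z. (bessel_mono vs b has_derivative D z) (at z) \<and>
      (\<forall>v. (\<lambda>z. D z v) \<in> fspan (bessel_monos (m - 1)))"
proof (induction vs arbitrary: m)
  case Nil
  have "(bessel_mono [] b has_derivative (\<lambda>v. of_real (2 * b) * bessel_mono [v] (b - 1) z)) (at z)"
      for z :: 'a
  proof -
    have p: "1 + (norm z)\<^sup>2 > 0" by (simp add: add_pos_nonneg)
    have "((\<lambda>z. (1 + z \<bullet> z) powr b) has_derivative (\<lambda>v. (1 + z \<bullet> z) powr b * (0 * ln (1 + z \<bullet> z)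
        + (z \<bullet> v + v \<bullet> z) * b / (1 + z \<bullet> z)))) (at z)"
      by (rule derivative_eq_intros refl | use p in \<open>simp add: power2_norm_eq_inner\<close>)+
    moreover have "(1 + z \<bullet> z) powr b * (0 * ln (1 + z \<bullet> z) + (z \<bullet> v + v \<bullet> z) * b / (1 + z \<bullet> z))
       = 2 * b * ((z \<bullet> v) * (1 + z \<bullet> z) powr (b - 1))" for v
      using p by (simp add: power2_norm_eq_inner powr_diff inner_commute field_simps)
    ultimately have "((\<lambda>z. (1 + z \<bullet> z) powr b) has_derivative (\<lambda>v. 2 * b * ((z \<bullet> v) * (1 + z \<bullet> z) powr
        (b - 1)))) (at z)"
      by simp
    from has_derivative_of_real[OF this, where 'a=complex] show ?thesis
      by (simp add: bessel_mono_def[abs_def] power2_norm_eq_inner)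
  qed
  moreover have "bessel_mono [v] (b - 1) \<in> bessel_monos (m - 1)" for v :: 'a
    using Nil unfolding bessel_monos_def by fastforce
  ultimately show ?case
    by (intro exI[of _ "\<lambda>z v. of_real (2 * b) * bessel_mono [v] (b - 1) z"]) (auto intro: fspan_scale
        fspan_base)
next
  case (Cons u vs)
  then have o: "real (length vs) + 2 * b \<le> m - 1" by simp
  from Cons.IH[OF this] obtain D where D: "\<And>z. (bessel_mono vs b has_derivative D z) (at z)"
      "\<And>v. (\<lambda>z. D z v) \<in> fspan (bessel_monos (m - 1 - 1))" by blast
  have e: "bessel_mono (u # vs) b = (\<lambda>z. of_real (z \<bullet> u) * bessel_mono vs b z)"
    by (auto simp: bessel_mono_def)
  have "(bessel_mono (u # vs) b has_derivative (\<lambda>v. of_real (z \<bullet> u) * D z v + of_real (v \<bullet> u)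
      * bessel_mono vs b z)) (at z)" for z
    unfolding e by (auto intro!: derivative_eq_intros D(1))
  moreover have "(\<lambda>z. of_real (z \<bullet> u) * D z v + of_real (v \<bullet> u) * bessel_mono vs b z) \<in> fspan
      (bessel_monos (m - 1))" for v
    using fspan_bessel_monos_inner[OF D(2), of u v] o
    by (intro fspan_add fspan_scale fspan_base[of "bessel_mono vs b"]) (auto simp: bessel_monos_def)
  ultimately show ?case
    by (intro exI[of _ "\<lambda>z v. of_real (z \<bullet> u) * D z v + of_real (v \<bullet> u) * bessel_mono vs b z"]) blast
qed

lemma bessel_in_symbols_of_order: "(\<lambda>z. of_real (bessel m z)) \<in> symbols_of_order (bessel m ::
    'a::euclidean_space \<Rightarrow> real)"
proof -
  let ?S = "bessel_monos m :: ('a \<Rightarrow> complex) set"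
  have "fspan ?S \<subseteq> symbols_of_order (bessel m)"
  proof (rule symbols_of_orderI)
    show "deriv_closed (fspan ?S)"
    proof (rule deriv_closed_fspanI)
      fix f assume "f \<in> ?S"
      then obtain vs b where f: "f = bessel_mono vs b" "real (length vs) + 2 * b \<le> m"
          by (auto simp: bessel_monos_def)
      have "fspan (bessel_monos (m - 1)) \<subseteq> fspan ?S" by (intro fspan_mono bessel_monos_mono) simp
      with bessel_mono_has_derivative[OF f(2)]
      show "\<exists>D. \<forall>x. (f has_derivative D x) (at x) \<and> (\<forall>v\<in>Basis. (\<lambda>x. D x v) \<in> fspan ?S)"
        unfolding f by (meson subsetD)
    qed
    fix f assume "f \<in> ?S"
    then obtain vs b where f: "f = bessel_mono vs b" "real (length vs) + 2 * b \<le> m"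
        by (auto simp: bessel_monos_def)
    \<comment> \<open>By Cauchy-Schwarz each linear factor is at most the norm of its vector times
      the bracket of \<open>z\<close>, so the product costs one bracket per factor.\<close>
    have p: "\<bar>prod_list (map (\<lambda>v. z \<bullet> v) vs)\<bar> \<le> prod_list (map norm vs) * (1 + (norm z)\<^sup>2) powr (real
        (length vs) / 2)" for z :: 'a
    proof (induction vs)
      case (Cons u vs)
      have 1: "\<bar>z \<bullet> u\<bar> \<le> norm u * (1 + (norm z)\<^sup>2) powr (1 / 2)"
      proof -
        have "norm z \<le> (1 + (norm z)\<^sup>2) powr (1 / 2)"
          by (simp add: powr_half_sqrt real_le_rsqrt add_nonneg_nonneg)
        then show ?thesis using Cauchy_Schwarz_ineq2[of z u]
          by (metis mult.commute mult_left_mono norm_ge_zero order_trans)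
      qed
      have "\<bar>z \<bullet> u\<bar> * \<bar>prod_list (map (\<lambda>v. z \<bullet> v) vs)\<bar> \<le> (norm u * (1 + (norm z)\<^sup>2) powr (1 / 2))
          * (prod_list (map norm vs) * (1 + (norm z)\<^sup>2) powr (real (length vs) / 2))"
        by (rule mult_mono[OF 1 Cons]) auto
      then show ?case by (simp add: abs_mult powr_add add_divide_distrib mult_ac)
    qed (use add_pos_nonneg[of 1 "(norm z)\<^sup>2"] in simp)
    have "cmod (f z) \<le> prod_list (map norm vs) * bessel m z" for z
    proof -
      have "cmod (f z) = \<bar>prod_list (map (\<lambda>v. z \<bullet> v) vs)\<bar> * (1 + (norm z)\<^sup>2) powr b"
        by (simp add: f bessel_mono_def norm_mult)
      also have "\<dots> \<le> prod_list (map norm vs) * (1 + (norm z)\<^sup>2) powr (real (length vs) / 2) * (1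
          + (norm z)\<^sup>2) powr b"
        by (intro mult_right_mono p) auto
      also have "\<dots> = prod_list (map norm vs) * (1 + (norm z)\<^sup>2) powr (real (length vs) / 2 + b)"
        by (simp add: powr_add)
      also have "\<dots> \<le> prod_list (map norm vs) * bessel m z"
        unfolding bessel_def using f(2)
        by (intro mult_left_mono powr_mono prod_list_nonneg) (auto simp: field_simps)
      finally show ?thesis .
    qed
    then show "\<exists>C. \<forall>z. cmod (f z) \<le> C * bessel m z" by blast
  qed
  moreover have "(\<lambda>z. of_real (bessel m z)) = bessel_mono [] (m / 2)"
    by (auto simp: bessel_def bessel_mono_def)
  then have "(\<lambda>z. of_real (bessel m z)) \<in> ?S" unfolding bessel_monos_def by fastforce
  ultimately show ?thesis by (meson fspan_base subsetD)
qed

lemma bessel_smooth: "smooth_fun (\<lambda>z. of_real (bessel m z))"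
  using bessel_in_symbols_of_order symbols_of_order_smooth by blast

text \<open>The three blocks of directions together form one list of basis vectors of the product
  space, so the bound for arbitrary lists applies to them. The constant \<open>K\<close> lets a
  smooth weight stand in for the prescribed one.\<close>

lemma symbols_bounded_byI:
  fixes \<sigma> :: "'a::euclidean_space \<times> 'a \<times> 'a \<Rightarrow> complex"
  assumes \<sigma>: "\<sigma> \<in> symbols_of_order w" and w: "\<And>x \<xi>1 \<xi>2. 0 \<le> w (x, \<xi>1, \<xi>2)"
    "\<And>x \<xi>1 \<xi>2. w (x, \<xi>1, \<xi>2) \<le> K * w' \<xi>1 \<xi>2"
  shows "\<sigma> \<in> symbols_bounded_by w'"
  unfolding symbols_bounded_by_def
proof (intro CollectI conjI ballI)
  show "smooth_fun \<sigma>" using \<sigma> by (rule symbols_of_order_smooth)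
  fix \<alpha> \<beta>1 \<beta>2 :: "'a list" assume "\<alpha> \<in> lists Basis" "\<beta>1 \<in> lists Basis" "\<beta>2 \<in> lists Basis"
  then have "map (\<lambda>v. (v, 0, 0)) \<alpha> @ map (\<lambda>v. (0, v, 0)) \<beta>1 @ map (\<lambda>v. (0, 0, v)) \<beta>2 \<in> lists Basis"
    (is "?vs \<in> _")
    by (auto simp: Basis_prod_def image_iff zero_prod_def)
  then obtain C where C: "\<And>z. cmod (iter_pderiv ?vs \<sigma> z) \<le> C * w z"
    using \<sigma> unfolding symbols_of_order_def by blast
  \<comment> \<open>\<open>C\<close> may be negative, so its absolute value is taken before the
    weight is enlarged.\<close>
  have "cmod (iter_pderiv ?vs \<sigma> (x, \<xi>1, \<xi>2)) \<le> (\<bar>C\<bar> * K) * w' \<xi>1 \<xi>2" for x \<xi>1 \<xi>2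
  proof -
    have "cmod (iter_pderiv ?vs \<sigma> (x, \<xi>1, \<xi>2)) \<le> \<bar>C\<bar> * w (x, \<xi>1, \<xi>2)"
      using C[of "(x, \<xi>1, \<xi>2)"] w(1)[of x \<xi>1 \<xi>2] by (meson abs_ge_self mult_right_mono order_trans)
    also have "\<dots> \<le> \<bar>C\<bar> * (K * w' \<xi>1 \<xi>2)" by (intro mult_left_mono w(2)) auto
    finally show ?thesis by (simp add: mult_ac)
  qed
  then show "\<exists>C. \<forall>x \<xi>1 \<xi>2. cmod (iter_pderiv ?vs \<sigma> (x, \<xi>1, \<xi>2)) \<le> C * w' \<xi>1 \<xi>2" by blast
qed

text \<open>Allows weights to be compared for orders of either sign: for \<open>r \<ge> 0\<close>
  one uses \<open>x \<le> y\<close>, for \<open>r < 0\<close> one uses \<open>y / k \<le> x\<close>,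
  and the absolute value in the constant covers both.\<close>

lemma powr_le_const_powr:
  fixes x y k r :: real
  assumes "0 < x" "x \<le> y" "y \<le> k * x"
  shows "x powr r \<le> k powr \<bar>r\<bar> * y powr r"
proof -
  have k: "k \<ge> 1" using assms by (metis dual_order.trans mult_le_cancel_right1 not_less_iff_gr_or_eq)
  show ?thesis
  proof (cases "r \<ge> 0")
    case True
    have "x powr r \<le> y powr r" using assms True by (intro powr_mono2) auto
    also have "\<dots> \<le> k powr \<bar>r\<bar> * y powr r" using k
        by (simp add: ge_one_powr_ge_zero mult_le_cancel_right1)
    finally show ?thesis .
  next
    case False
    have "x powr r \<le> (y / k) powr r" using assms False k by (intro powr_mono2') (auto simp: field_simps)
    also have "\<dots> = k powr \<bar>r\<bar> * y powr r" using assms False k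
        by (simp add: powr_divide powr_minus field_simps)
    finally show ?thesis .
  qed
qed

lemma powr_realpow_2: "0 < x \<Longrightarrow> x powr 2 = (x::real)\<^sup>2"
  using powr_realpow[of x 2] by simp

lemma bessel_le: "bessel m z \<le> 2 powr \<bar>m / 2\<bar> * (1 + norm z) powr m"
proof -
  have "(1 + norm z)\<^sup>2 \<le> 2 * (1 + (norm z)\<^sup>2)" "1 + (norm z)\<^sup>2 \<le> (1 + norm z)\<^sup>2"
    using sum_squares_bound[of 1 "norm z"] by (auto simp: power2_eq_square algebra_simps)
  then have "bessel m z \<le> 2 powr \<bar>m / 2\<bar> * ((1 + norm z)\<^sup>2) powr (m / 2)"
    unfolding bessel_def by (intro powr_le_const_powr) (auto simp: add_pos_nonneg)
  also have "((1 + norm z)\<^sup>2) powr (m / 2) = (1 + norm z) powr m"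
    by (subst powr_realpow_2[symmetric]) (simp_all add: powr_powr add_pos_nonneg del: powr_numeral)
  finally show ?thesis .
qed

text \<open>The square of a sum of three terms is at most three times the sum of their squares; this
  is the origin of the base 3, as two terms give the base 2 in \<open>bessel_le\<close>.\<close>

lemma bessel_pair_le: "bessel m (a, b) \<le> 3 powr \<bar>m / 2\<bar> * (1 + norm a + norm b) powr m"
proof -
  have n: "(norm (a, b))\<^sup>2 = (norm a)\<^sup>2 + (norm b)\<^sup>2" by (simp add: norm_Pair)
  have "(1 + norm a + norm b)\<^sup>2 \<le> 3 * (1 + (norm (a, b))\<^sup>2)" "1 + (norm (a, b))\<^sup>2 \<le> (1 + norm a
      + norm b)\<^sup>2"
    using sum_squares_bound[of 1 "norm a"] sum_squares_bound[of 1 "norm b"] sum_squares_bound[of "norm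
        a" "norm b"]
    unfolding n by (auto simp: power2_eq_square algebra_simps)
  then have "bessel m (a, b) \<le> 3 powr \<bar>m / 2\<bar> * ((1 + norm a + norm b)\<^sup>2) powr (m / 2)"
    unfolding bessel_def by (intro powr_le_const_powr) (auto simp: add_pos_nonneg)
  also have "((1 + norm a + norm b)\<^sup>2) powr (m / 2) = (1 + norm a + norm b) powr m"
    by (subst powr_realpow_2[symmetric]) (simp_all add: powr_powr add_pos_nonneg del: powr_numeral)
  finally show ?thesis .
qed

lemma bessel_in_BS:
  "(\<lambda>z::'a::euclidean_space \<times> 'a \<times> 'a. of_real (bessel m (snd z))) \<in> BS m"
  unfolding BS_def
proof (rule symbols_bounded_byI)
  show "(\<lambda>z. of_real (bessel m (snd z))) \<in> symbols_of_order (\<lambda>z. bessel m (snd z))"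
    by (rule symbols_of_order_linear[OF bessel_in_symbols_of_order bounded_linear_snd])
  show "bessel m (snd (x, \<xi>1, \<xi>2)) \<le> 3 powr \<bar>m / 2\<bar> * (1 + norm \<xi>1 + norm \<xi>2) powr m" for x \<xi>1 \<xi>2 :: 'a
    using bessel_pair_le[of m \<xi>1 \<xi>2] by simp
qed (simp add: bessel_def)

lemma bessel_in_BS2:
  "(\<lambda>z. of_real (bessel m1 (fst (snd z))) * of_real (bessel m2 (snd (snd z)))) \<in> BS2 m1 m2"
  unfolding BS2_def
proof (rule symbols_bounded_byI)
  show "(\<lambda>z. of_real (bessel m1 (fst (snd z))) * of_real (bessel m2 (snd (snd z))))
     \<in> symbols_of_order (\<lambda>z. bessel m1 (fst (snd z)) * bessel m2 (snd (snd z)))"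
    by (intro symbols_of_order_mult
        symbols_of_order_linear[OF bessel_in_symbols_of_order, of "\<lambda>z. fst (snd z)"]
        symbols_of_order_linear[OF bessel_in_symbols_of_order, of "\<lambda>z. snd (snd z)"]
        bounded_linear_compose[OF bounded_linear_fst bounded_linear_snd]
        bounded_linear_compose[OF bounded_linear_snd bounded_linear_snd])
  show "0 \<le> bessel m1 (fst (snd (x, \<xi>1, \<xi>2))) * bessel m2 (snd (snd (x, \<xi>1, \<xi>2)))" for x \<xi>1 \<xi>2
    by (simp add: bessel_def)
  show "bessel m1 (fst (snd (x, \<xi>1, \<xi>2))) * bessel m2 (snd (snd (x, \<xi>1, \<xi>2)))
    \<le> (2 powr \<bar>m1 / 2\<bar> * 2 powr \<bar>m2 / 2\<bar>) * ((1 + norm \<xi>1) powr m1 * (1 + norm \<xi>2) powr m2)" for x \<xi>1 \<xi>2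
    using mult_mono[OF bessel_le[of m1 \<xi>1] bessel_le[of m2 \<xi>2]] by (simp add: bessel_def mult_ac)
qed

subsection \<open>Inverse Fourier transforms of test functions\<close>

text \<open>The space of test functions. Compact support is kept as a radius, the form in which the
  bounds and the dominating functions use it.\<close>

definition smooth_cc :: "('a::euclidean_space \<Rightarrow> complex) set" where
  "smooth_cc = {F. smooth_fun F \<and> (\<exists>R. \<forall>x. R < norm x \<longrightarrow> F x = 0)}"

lemma smooth_ccI: "smooth_fun F \<Longrightarrow> (\<And>x. R < norm x \<Longrightarrow> F x = 0) \<Longrightarrow> F \<in> smooth_cc"
  by (auto simp: smooth_cc_def)

lemma smooth_cc_mult: "F \<in> smooth_cc \<Longrightarrow> smooth_fun g \<Longrightarrow> (\<lambda>x. g x * F x) \<in> smooth_cc"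
  by (fastforce simp: smooth_cc_def intro: smooth_fun_mult)

lemma deriv_closed_smooth_cc: "deriv_closed smooth_cc"
  unfolding deriv_closed_def
proof (intro ballI conjI allI)
  fix F :: "'a \<Rightarrow> complex" and x assume "F \<in> smooth_cc"
  then show "F differentiable (at x)"
    using smooth_fun_has_derivative differentiable_def by (auto simp: smooth_cc_def) blast
next
  fix F :: "'a \<Rightarrow> complex" and v :: 'a assume F: "F \<in> smooth_cc" and v: "v \<in> Basis"
  then obtain R where R: "\<And>x. R < norm x \<Longrightarrow> F x = 0" by (auto simp: smooth_cc_def)
  have "dir_deriv v F x = 0" if "R < norm x" for x
  proof -
    have "(F has_derivative (\<lambda>_. 0)) (at x)"
    proof (rule has_derivative_transform_within_open[where f="\<lambda>_. 0" and s="{x. R < norm x}"])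
      show "open {x::'a. R < norm x}" by (intro open_Collect_less continuous_intros)
    qed (use that R in auto)
    then have "(\<lambda>_. 0) = frechet_derivative F (at x)" by (rule frechet_derivative_at)
    then show ?thesis unfolding dir_deriv_def by metis
  qed
  moreover have "smooth_fun (dir_deriv v F)"
    using deriv_closed_smooth_fun F v by (auto simp: deriv_closed_def smooth_cc_def)
  ultimately show "dir_deriv v F \<in> smooth_cc" using smooth_ccI by blast
qed

lemma smooth_cc_continuous: "F \<in> smooth_cc \<Longrightarrow> continuous_on A F"
  by (auto simp: smooth_cc_def intro: smooth_fun_continuous_on)

lemma smooth_cc_measurable: "F \<in> smooth_cc \<Longrightarrow> F \<in> borel_measurable borel"
  by (intro borel_measurable_continuous_onI smooth_cc_continuous)

lemma smooth_cc_bounded: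
  assumes "F \<in> smooth_cc" obtains M where "0 \<le> M" "\<And>x. cmod (F x) \<le> M"
proof -
  obtain R where R: "\<And>x. R < norm x \<Longrightarrow> F x = 0" using assms by (auto simp: smooth_cc_def)
  have "bounded (F ` cball 0 R)"
    by (intro compact_imp_bounded compact_continuous_image smooth_cc_continuous assms) auto
  then obtain B where B: "\<And>x. x \<in> cball 0 R \<Longrightarrow> cmod (F x) \<le> B" unfolding bounded_iff by blast
  have "cmod (F x) \<le> max 0 B" for x
    using B[of x] R[of x] by (cases "norm x \<le> R") (auto simp: le_max_iff_disj)
  then show ?thesis using that[of "max 0 B"] by auto
qed

section \<open>Integrability, decay and derivatives of inverse transforms\<close>

lemma integrable_indicator_cball: "integrable lborel (indicator (cball a R) :: 'a::euclidean_space \<Rightarrow>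
    real)"
  by (rule integrable_real_indicator) (use emeasure_lborel_cball_finite[of a R] in auto)

lemma integrable_bounded_support:
  fixes f :: "'a::euclidean_space \<Rightarrow> complex"
  assumes [measurable]: "f \<in> borel_measurable borel"
    and "\<And>x. cmod (f x) \<le> M" "\<And>x. R < norm x \<Longrightarrow> f x = 0"
  shows "integrable lborel f"
proof (rule Bochner_Integration.integrable_bound)
  show "integrable lborel (\<lambda>x. M * indicator (cball 0 R) x :: real)"
    by (intro integrable_mult_right integrable_indicator_cball)
  have "norm (f x) \<le> norm (M * indicator (cball 0 R) x :: real)" for x
    using assms(2)[of x] assms(3)[of x] by (cases "norm x \<le> R") (auto simp: indicator_def)
  then show "AE x in lborel. norm (f x) \<le> norm (M * indicator (cball 0 R) x :: real)" by simp
qed simp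

lemma smooth_cc_integrable: "F \<in> smooth_cc \<Longrightarrow> integrable lborel F"
proof -
  assume F: "F \<in> smooth_cc"
  then obtain R where R: "\<And>x. R < norm x \<Longrightarrow> F x = 0" by (auto simp: smooth_cc_def)
  obtain M where "\<And>x. cmod (F x) \<le> M" using smooth_cc_bounded[OF F] by blast
  then show ?thesis using integrable_bounded_support[OF smooth_cc_measurable[OF F]] R by blast
qed

text \<open>The directional derivative along a sequence of steps, since dominated convergence is
  applied to sequences.\<close>

lemma has_derivative_difference_quotient_sequentially:
  fixes F :: "'a::real_normed_vector \<Rightarrow> complex"
  assumes "(F has_derivative D) (at x)"
  shows "(\<lambda>j. (F (x + inverse (real (Suc j)) *\<^sub>R v) - F x) / of_real (inverse (real (Suc j)))) \<longlonglongrightarrow> D v"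
proof -
  have lin: "linear D" using assms has_derivative_linear by blast
  have 1: "((\<lambda>t. x + t *\<^sub>R v) has_derivative (\<lambda>t. t *\<^sub>R v)) (at (0::real))"
    by (auto intro!: derivative_eq_intros)
  have "((\<lambda>t. F (x + t *\<^sub>R v)) has_derivative (\<lambda>t. D (t *\<^sub>R v))) (at (0::real))"
    using has_derivative_compose[OF 1, of F D] assms by simp
  then have l: "((\<lambda>t. norm (F (x + t *\<^sub>R v) - F x - D (t *\<^sub>R v)) / norm t) \<longlongrightarrow> 0) (at (0::real))"
    by (simp add: has_derivative_at)
  have h: "filterlim (\<lambda>j. inverse (real (Suc j))) (at 0) sequentially"
    unfolding filterlim_at by (use LIMSEQ_inverse_real_of_nat in auto)
  have "(\<lambda>j. norm ((F (x + inverse (real (Suc j)) *\<^sub>R v) - F x) / of_real (inverse (real (Suc j)))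
      - D v)) \<longlonglongrightarrow> 0"
    using filterlim_compose[OF l h]
  proof (rule Lim_transform_eventually, intro always_eventually allI)
    fix j
    have "(t::real) > 0 \<Longrightarrow> norm (a - t *\<^sub>R b) / norm t = norm (a / of_real t - b)" for t
        and a b :: complex
    proof -
      assume t: "t > 0"
      then have "a / of_real t - b = (a - t *\<^sub>R b) / of_real t"
          by (simp add: scaleR_conv_of_real field_simps)
      then show ?thesis using t by (simp add: norm_divide)
    qed
    from this[of "inverse (real (Suc j))"] show "norm (F (x + inverse (real (Suc j)) *\<^sub>R v) - F x
        - D (inverse (real (Suc j)) *\<^sub>R v)) / norm (inverse (real (Suc j))) = norm ((F (x
        + inverse (real (Suc j)) *\<^sub>R v) - F x) / of_real (inverse (real (Suc j))) - D v)"
      by (simp add: linear_scale[OF lin])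
  qed
  then show ?thesis using LIM_zero_cancel tendsto_norm_zero_iff by blast
qed

text \<open>Mean value inequality along a line. It supplies the dominating constant for the
  difference quotients under the integral.\<close>

lemma smooth_cc_difference_bound:
  assumes F: "F \<in> smooth_cc" and v: "v \<in> Basis"
  obtains B where "\<And>x t. cmod (F (x + t *\<^sub>R v) - F x) \<le> B * \<bar>t\<bar>"
proof -
  have "dir_deriv v F \<in> smooth_cc" using deriv_closed_smooth_cc F v by (auto simp: deriv_closed_def)
  then obtain B where B: "0 \<le> B" "\<And>x. cmod (dir_deriv v F x) \<le> B" using smooth_cc_bounded by blast
  have F': "(F has_derivative frechet_derivative F (at x)) (at x)" for x
    using F smooth_fun_has_derivative by (auto simp: smooth_cc_def)
  have "cmod (F (x + t *\<^sub>R v) - F x) \<le> B * \<bar>t\<bar>" for x t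
  proof -
    have d: "((\<lambda>t. F (x + t *\<^sub>R v)) has_derivative (\<lambda>h. h *\<^sub>R dir_deriv v F (x + s *\<^sub>R v))) (at s
        within UNIV)" for s
    proof -
      have 1: "((\<lambda>t. x + t *\<^sub>R v) has_derivative (\<lambda>t. t *\<^sub>R v)) (at s)"
        by (auto intro!: derivative_eq_intros)
      have "linear (frechet_derivative F (at y))" for y using F' has_derivative_linear by blast
      then show ?thesis
        using has_derivative_compose[OF 1 F'] by (simp add: dir_deriv_def linear_scale)
    qed
    have "norm (F (x + t *\<^sub>R v) - F (x + 0 *\<^sub>R v)) \<le> B * norm (t - 0)"
    proof (rule differentiable_bound[OF _ d])
      show "onorm (\<lambda>h::real. h *\<^sub>R dir_deriv v F (x + s *\<^sub>R v)) \<le> B" for s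
        by (rule onorm_bound) (use B in \<open>auto simp: mult.commute[of B] intro!: mult_left_mono\<close>)
    qed auto
    then show ?thesis by simp
  qed
  then show ?thesis using that by blast
qed

text \<open>Integration by parts in the form of translation invariance: shifting \<open>F\<close> by
  \<open>h v\<close> multiplies its transform by \<open>cis (- h (x \<bullet> v))\<close>. The
  difference quotients under the integral therefore have two limits, one with the derivative of
  \<open>F\<close> and one with the factor \<open>- \<i> (x \<bullet> v)\<close>.\<close>

lemma inner_mult_inv_fourier:
  assumes F: "F \<in> smooth_cc" and v: "v \<in> Basis"
  shows "of_real (x \<bullet> v) * inv_fourier F x = \<i> * inv_fourier (dir_deriv v F) x"
proof -
  define h where "h j = inverse (real (Suc j))" for j
  have h: "h j > 0" "h j \<le> 1" for j by (auto simp: h_def field_simps)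
  have [measurable]: "F \<in> borel_measurable borel" using F by (rule smooth_cc_measurable)
  have [measurable]: "dir_deriv v F \<in> borel_measurable borel"
    using deriv_closed_smooth_cc F v by (intro smooth_cc_measurable) (auto simp: deriv_closed_def)
  have intF: "integrable lborel F" using F by (rule smooth_cc_integrable)
  let ?I = "LINT \<xi>|lborel. cis (x \<bullet> \<xi>) * F \<xi>"
  obtain R where R: "\<And>x. R < norm x \<Longrightarrow> F x = 0" using F by (auto simp: smooth_cc_def)
  obtain B where B: "\<And>x t. cmod (F (x + t *\<^sub>R v) - F x) \<le> B * \<bar>t\<bar>"
    using smooth_cc_difference_bound[OF F v] by blast
  have F': "(F has_derivative frechet_derivative F (at \<xi>)) (at \<xi>)" for \<xi>
    using F smooth_fun_has_derivative by (auto simp: smooth_cc_def)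
  have "(\<lambda>j. LINT \<xi>|lborel. cis (x \<bullet> \<xi>) * ((F (\<xi> + h j *\<^sub>R v) - F \<xi>) / of_real (h j)))
      \<longlonglongrightarrow> (LINT \<xi>|lborel. cis (x \<bullet> \<xi>) * dir_deriv v F \<xi>)"
  \<comment> \<open>The steps are at most 1 and \<open>v\<close> is a unit vector, so all difference
    quotients vanish outside the ball of radius \<open>R + 1\<close>.\<close>
  proof (rule integral_dominated_convergence[where w="\<lambda>\<xi>. B * indicator (cball 0 (R + 1)) \<xi>"])
    show "integrable lborel (\<lambda>\<xi>::'a. B * indicator (cball 0 (R + 1)) \<xi> :: real)"
      by (intro integrable_mult_right integrable_indicator_cball)
    show "AE \<xi> in lborel. (\<lambda>j. cis (x \<bullet> \<xi>) * ((F (\<xi> + h j *\<^sub>R v) - F \<xi>) / of_real (h j)))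
        \<longlonglongrightarrow> cis (x \<bullet> \<xi>) * dir_deriv v F \<xi>"
      unfolding h_def dir_deriv_def
      by (intro AE_I2 tendsto_mult tendsto_const has_derivative_difference_quotient_sequentially F')
    fix j
    have "norm (cis (x \<bullet> \<xi>) * ((F (\<xi> + h j *\<^sub>R v) - F \<xi>) / of_real (h j))) \<le> B * indicator (cball 0 (R
        + 1)) \<xi>" for \<xi>
    proof (cases "norm \<xi> \<le> R + 1")
      case True
      have "cmod (F (\<xi> + h j *\<^sub>R v) - F \<xi>) / h j \<le> B"
        using B[of \<xi> "h j"] h(1)[of j] by (simp add: divide_le_eq)
      then show ?thesis using True h(1)[of j] by (simp add: norm_mult norm_divide)
    next
      case False
      have "norm (h j *\<^sub>R v) \<le> 1" using h[of j] v by simp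
      then have "norm (\<xi> + h j *\<^sub>R v) > R" using norm_triangle_ineq2[of \<xi> "- (h j *\<^sub>R v)"] False by simp
      then show ?thesis using R False by simp
    qed
    then show "AE \<xi> in lborel. norm (cis (x \<bullet> \<xi>) * ((F (\<xi> + h j *\<^sub>R v) - F \<xi>) / of_real (h j)))
        \<le> B * indicator (cball 0 (R + 1)) \<xi>" by simp
  qed auto
  moreover have "(LINT \<xi>|lborel. cis (x \<bullet> \<xi>) * ((F (\<xi> + h j *\<^sub>R v) - F \<xi>) / of_real (h j)))
      = (cis (- (h j * (x \<bullet> v))) - 1) / of_real (h j) * ?I" for j
  proof -
    have i2: "integrable lborel (\<lambda>\<xi>. F (\<xi> + h j *\<^sub>R v))"
      using lborel_integrable_affine[OF _ intF, of 1 "h j *\<^sub>R v"] by (simp add: add.commute)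
    have "(LINT \<xi>|lborel. cis (x \<bullet> \<xi>) * F (\<xi> + h j *\<^sub>R v))
       = (LINT \<xi>|lborel. cis (x \<bullet> (- (h j *\<^sub>R v) + 1 *\<^sub>R \<xi>)) * F (- (h j *\<^sub>R v) + 1 *\<^sub>R \<xi> + h j *\<^sub>R v))"
      by (subst lborel_integral_affine[where c=1 and t="- (h j *\<^sub>R v)"]) auto
    also have "\<dots> = (LINT \<xi>|lborel. cis (- (h j * (x \<bullet> v))) * (cis (x \<bullet> \<xi>) * F \<xi>))"
      by (intro Bochner_Integration.integral_cong) (simp_all add: mult.assoc[symmetric] cis_mult
          inner_diff_right)
    finally have 1: "(LINT \<xi>|lborel. cis (x \<bullet> \<xi>) * F (\<xi> + h j *\<^sub>R v)) = cis (- (h j * (x \<bullet> v))) * ?I"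
        by simp
    have "(LINT \<xi>|lborel. cis (x \<bullet> \<xi>) * ((F (\<xi> + h j *\<^sub>R v) - F \<xi>) / of_real (h j)))
       = (LINT \<xi>|lborel. (cis (x \<bullet> \<xi>) * F (\<xi> + h j *\<^sub>R v) - cis (x \<bullet> \<xi>) * F \<xi>) / of_real (h j))"
      by (simp add: algebra_simps)
    also have "\<dots> = (cis (- (h j * (x \<bullet> v))) * ?I - ?I) / of_real (h j)"
      by (subst integral_divide_zero, subst Bochner_Integration.integral_diff) (auto simp: 1 intro!:
          integrable_cis_mult intF i2)
    finally show ?thesis by (simp add: algebra_simps)
  qed
  moreover have "(\<lambda>j. (cis (- (h j * (x \<bullet> v))) - 1) / of_real (h j) * ?I) \<longlonglongrightarrow> (- \<i> * of_real (x \<bullet> v)) * ?I"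
  proof (rule tendsto_mult[OF _ tendsto_const])
    have d: "((\<lambda>t::real. cis (- (t * (x \<bullet> v)))) has_derivative (\<lambda>t. t *\<^sub>R (- \<i> * of_real (x \<bullet> v))))
        (at 0)"
    proof -
      define c where "c = - \<i> * of_real (x \<bullet> v)"
      have 1: "((\<lambda>t::real. t *\<^sub>R c) has_derivative (\<lambda>t. t *\<^sub>R c)) (at 0)"
        by (auto intro!: derivative_eq_intros)
      have 2: "(exp has_derivative (\<lambda>h. exp (0 *\<^sub>R c) * h)) (at (0 *\<^sub>R c))"
        using DERIV_exp[of "0 *\<^sub>R c"] unfolding has_field_derivative_def .
      have "cis (- (t * (x \<bullet> v))) = exp (t *\<^sub>R c)" for t
        by (simp add: cis_conv_exp c_def scaleR_conv_of_real mult_ac)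
      then show ?thesis using has_derivative_compose[OF 1 2] by (simp add: c_def)
    qed
    show "(\<lambda>j. (cis (- (h j * (x \<bullet> v))) - 1) / of_real (h j)) \<longlonglongrightarrow> - \<i> * of_real (x \<bullet> v)"
      using has_derivative_difference_quotient_sequentially[OF d, of 1] by (simp add: h_def)
  qed
  ultimately have "(LINT \<xi>|lborel. cis (x \<bullet> \<xi>) * dir_deriv v F \<xi>) = (- \<i> * of_real (x \<bullet> v)) * ?I"
    by (simp only: LIMSEQ_unique)
  then show ?thesis by (simp add: inv_fourier_def mult_ac)
qed

text \<open>One factor |x| is at most the sum of the coordinates in absolute value, and each
  coordinate is traded for a derivative of the test function, which is again a test
  function.\<close>

lemma inv_fourier_decay:
  assumes "F \<in> smooth_cc"
  shows "\<exists>C. \<forall>x. norm x ^ k * cmod (inv_fourier F x) \<le> C"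
  using assms
proof (induction k arbitrary: F)
  case 0
  then show ?case using norm_inv_fourier_le[OF smooth_cc_integrable] by fastforce
next
  case (Suc k)
  have "\<exists>C. \<forall>x. norm x ^ k * cmod (inv_fourier (dir_deriv v F) x) \<le> C" if "v \<in> Basis" for v
    using Suc that deriv_closed_smooth_cc unfolding deriv_closed_def by blast
  then obtain C where C: "\<And>v x. v \<in> Basis \<Longrightarrow> norm x ^ k * cmod (inv_fourier (dir_deriv v F) x) \<le> C v"
      by metis
  have "norm x ^ Suc k * cmod (inv_fourier F x) \<le> (\<Sum>v\<in>Basis. C v)" for x
  proof -
    have "norm x ^ Suc k * cmod (inv_fourier F x) \<le> (\<Sum>v\<in>Basis. \<bar>x \<bullet> v\<bar>) * (norm x ^ k
        * cmod (inv_fourier F x))"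
      using norm_le_l1[of x] by (simp add: mult.assoc mult_right_mono)
    also have "\<dots> = (\<Sum>v\<in>Basis. norm x ^ k * cmod (of_real (x \<bullet> v) * inv_fourier F x))"
      unfolding sum_distrib_right by (intro sum.cong) (auto simp: norm_mult)
    also have "\<dots> \<le> (\<Sum>v\<in>Basis. C v)"
      by (intro sum_mono) (simp add: inner_mult_inv_fourier[OF Suc.prems] norm_mult C)
    finally show ?thesis .
  qed
  then show ?case by blast
qed

lemma integrable_inverse_1_plus_square_lborel: "integrable lborel (\<lambda>t::real. 1 / (1 + t\<^sup>2))"
  using integrable_inverse_1_plus_square by (simp add: set_integrable_def einterval_def
      inverse_eq_divide)

text \<open>The majorant is a product of the functions \<open>1 / (1 + t\<^sup>2)\<close> of the
  single coordinates. Only the decay rates 0 and twice the dimension enter the comparison.\<close>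

lemma integrable_rapid_decay:
  fixes G :: "'a::euclidean_space \<Rightarrow> complex"
  assumes [measurable]: "G \<in> borel_measurable borel"
    and decay: "\<And>k::nat. \<exists>C. \<forall>x. norm x ^ k * cmod (G x) \<le> C"
  shows "integrable lborel G"
proof -
  let ?n = "DIM('a)"
  obtain C0 where C0: "\<And>x. norm x ^ 0 * cmod (G x) \<le> C0" using decay by blast
  obtain C1 where C1: "\<And>x. norm x ^ (2 * ?n) * cmod (G x) \<le> C1" using decay by blast
  define W :: "'a \<Rightarrow> complex" where "W x = (\<Prod>b\<in>Basis. complex_of_real (1 / (1 + (x \<bullet> b)\<^sup>2)))" for x
  have "integrable lborel (\<lambda>t. complex_of_real (1 / (1 + t\<^sup>2)))"
    using integrable_inverse_1_plus_square_lborel integrable_of_real by blast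
  then have "integrable lborel W"
    unfolding W_def by (intro integrable_lborel_prod)
  then have "integrable lborel (\<lambda>x. of_real (2 ^ ?n * (C0 + C1)) * W x)" by (rule integrable_mult_right)
  then show ?thesis
  proof (rule Bochner_Integration.integrable_bound)
    have "cmod (G x) \<le> cmod (of_real (2 ^ ?n * (C0 + C1)) * W x)" for x
    proof -
      let ?P = "\<Prod>b\<in>Basis. 1 + (x \<bullet> b)\<^sup>2"
      have P: "?P > 0" by (intro prod_pos) (auto simp: add_pos_nonneg)
      have W: "cmod (W x) = 1 / ?P"
        using P unfolding W_def of_real_prod[symmetric] norm_of_real by (simp add: prod_dividef)
      \<comment> \<open>Each factor is at most 1 + |x|^2, and the n-th power of this is at most 2^n
        (1 + |x|^(2n)): for |x| at most 1 the constant term is enough, beyond that the top power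
        is.\<close>
      have "?P \<le> (\<Prod>b\<in>(Basis::'a set). 1 + (norm x)\<^sup>2)"
        by (intro prod_mono) (auto simp: add_nonneg_nonneg power2_norm_eq_inner intro: power_mono[OF
            Basis_le_norm, of _ x 2, unfolded power2_abs power2_norm_eq_inner])
      also have "\<dots> = (1 + (norm x)\<^sup>2) ^ ?n" by simp
      also have "\<dots> \<le> 2 ^ ?n * (1 + norm x ^ (2 * ?n))"
      proof (cases "norm x \<le> 1")
        case True
        then have "(1 + (norm x)\<^sup>2) ^ ?n \<le> 2 ^ ?n" by (intro power_mono) (auto simp: power_le_one)
        also have "\<dots> \<le> 2 ^ ?n * (1 + norm x ^ (2 * ?n))" by simp
        finally show ?thesis .
      next
        case False
        then have "(1 + (norm x)\<^sup>2) ^ ?n \<le> (2 * (norm x)\<^sup>2) ^ ?n"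
          by (intro power_mono) (auto simp: one_le_power)
        also have "\<dots> \<le> 2 ^ ?n * (1 + norm x ^ (2 * ?n))" by (simp add: power_mult_distrib power_mult)
        finally show ?thesis .
      qed
      finally have "?P * cmod (G x) \<le> 2 ^ ?n * (1 + norm x ^ (2 * ?n)) * cmod (G x)"
        by (rule mult_right_mono) auto
      also have "\<dots> = 2 ^ ?n * (norm x ^ 0 * cmod (G x) + norm x ^ (2 * ?n) * cmod (G x))"
        by (simp add: algebra_simps)
      also have "\<dots> \<le> 2 ^ ?n * (C0 + C1)" by (intro mult_left_mono add_mono C0 C1) auto
      finally have 1: "?P * cmod (G x) \<le> 2 ^ ?n * (C0 + C1)" .
      then have "cmod (G x) \<le> 2 ^ ?n * (C0 + C1) / ?P" using P by (simp add: field_simps)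
      also have "\<dots> \<le> \<bar>2 ^ ?n * (C0 + C1)\<bar> / ?P" using P by (intro divide_right_mono) auto
      finally show ?thesis using W by (simp add: norm_mult del: of_real_mult of_real_add)
    qed
    then show "AE x in lborel. norm (G x) \<le> norm (of_real (2 ^ ?n * (C0 + C1)) * W x)" by simp
  qed simp
qed

text \<open>Differentiation under the integral with an explicit remainder: the error of the
  first-order expansion of the exponential is quadratic in \<open>(y - x) \<bullet> \<xi>\<close>.
  The compact support of \<open>F\<close> gives it a finite second moment, so the total error is
  \<open>O(|y - x|\<^sup>2)\<close> and the full derivative exists.\<close>

lemma inv_fourier_has_derivative:
  assumes F: "F \<in> smooth_cc"
  shows "(inv_fourier F has_derivative (\<lambda>h. \<Sum>b\<in>Basis. (h \<bullet> b) *\<^sub>R inv_fourier (\<lambda>\<xi>. \<i> * of_real (\<xi> \<bullet> b)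
      * F \<xi>) x)) (at x)"
    (is "(_ has_derivative ?D) _")
proof -
  let ?n = "DIM('a)"
  let ?k = "complex_of_real (1 / (2 * pi) ^ ?n)"
  have Fb: "(\<lambda>\<xi>. \<i> * of_real (\<xi> \<bullet> b) * F \<xi>) \<in> smooth_cc" for b
    by (intro smooth_cc_mult F smooth_fun_mult smooth_fun_const smooth_fun_inner)
  have intF: "integrable lborel F" using F by (rule smooth_cc_integrable)
  \<comment> \<open>The second moment is a sum over coordinates of products of \<open>F\<close> with
    smooth functions, each again a test function.\<close>
  have "(\<lambda>\<xi>. of_real (\<xi> \<bullet> \<xi>) * F \<xi>) = (\<lambda>\<xi>. \<Sum>b\<in>Basis. of_real (\<xi> \<bullet> b) * (of_real (\<xi> \<bullet> b) * F \<xi>))"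
    by (subst euclidean_inner) (simp add: sum_distrib_right mult.assoc)
  moreover have "integrable lborel (\<lambda>\<xi>. of_real (\<xi> \<bullet> b) * (of_real (\<xi> \<bullet> b) * F \<xi>))" for b
    by (intro smooth_cc_integrable smooth_cc_mult F smooth_fun_inner)
  ultimately have "integrable lborel (\<lambda>\<xi>. of_real (\<xi> \<bullet> \<xi>) * F \<xi>)" by simp
  then have int2: "integrable lborel (\<lambda>\<xi>. (norm \<xi>)\<^sup>2 * cmod (F \<xi>))"
    using integrable_norm by (fastforce simp: norm_mult power2_norm_eq_inner)
  define K where "K = 1 / (2 * pi) ^ ?n * (LINT \<xi>|lborel. (norm \<xi>)\<^sup>2 * cmod (F \<xi>))"
  have bound: "cmod (inv_fourier F y - inv_fourier F x - ?D (y - x)) \<le> K * norm (y - x) * norm (y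
      - x)" for y
  proof -
    let ?h = "y - x"
    define E where "E \<xi> = cis (x \<bullet> \<xi>) * F \<xi> * (cis (?h \<bullet> \<xi>) - 1 - \<i> * of_real (?h \<bullet> \<xi>))" for \<xi>
    have i1: "integrable lborel (\<lambda>\<xi>. cis (z \<bullet> \<xi>) * F \<xi>)" for z by (intro integrable_cis_mult intF) auto
    have i2: "integrable lborel (\<lambda>\<xi>. cis (x \<bullet> \<xi>) * (\<i> * of_real (\<xi> \<bullet> b) * F \<xi>))" for b
      by (intro integrable_cis_mult smooth_cc_integrable Fb) auto
    have e: "E \<xi> = cis (y \<bullet> \<xi>) * F \<xi> - cis (x \<bullet> \<xi>) * F \<xi> - (\<Sum>b\<in>Basis. of_real (?h \<bullet> b) * (cis (x \<bullet> \<xi>)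
        * (\<i> * of_real (\<xi> \<bullet> b) * F \<xi>)))" for \<xi>
    proof -
      have 1: "cis (y \<bullet> \<xi>) = cis (x \<bullet> \<xi>) * cis (?h \<bullet> \<xi>)" by (simp add: cis_mult inner_diff_left)
      have 2: "complex_of_real (?h \<bullet> \<xi>) = (\<Sum>b\<in>Basis. of_real (?h \<bullet> b) * of_real (\<xi> \<bullet> b))"
        by (subst euclidean_inner) simp
      show ?thesis unfolding E_def 1 2 by (simp add: algebra_simps sum_distrib_left sum_distrib_right)
    qed
    have intE: "integrable lborel E" unfolding e[abs_def]
      by (intro Bochner_Integration.integrable_diff Bochner_Integration.integrable_sum
          integrable_mult_right i1 i2)
    have "inv_fourier F y - inv_fourier F x - ?D ?h = ?k * (LINT \<xi>|lborel. E \<xi>)"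
    proof -
      have "(LINT \<xi>|lborel. E \<xi>) = (LINT \<xi>|lborel. cis (y \<bullet> \<xi>) * F \<xi>) - (LINT \<xi>|lborel. cis (x \<bullet> \<xi>)
          * F \<xi>)
          - (\<Sum>b\<in>Basis. of_real (?h \<bullet> b) * (LINT \<xi>|lborel. cis (x \<bullet> \<xi>) * (\<i> * of_real (\<xi> \<bullet> b) * F \<xi>)))"
        unfolding e[abs_def]
        by (subst Bochner_Integration.integral_diff Bochner_Integration.integral_sum
            integral_mult_right_zero;
            (intro Bochner_Integration.integrable_diff Bochner_Integration.integrable_sum
                integrable_mult_right i1 i2)?)+ simp
      then show ?thesis
        by (simp only:) (simp add: inv_fourier_def right_diff_distrib sum_distrib_left
            scaleR_conv_of_real mult_ac del: of_real_diff inner_diff_left)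
    qed
    then have "cmod (inv_fourier F y - inv_fourier F x - ?D ?h) = 1 / (2 * pi) ^ ?n * cmod (LINT
        \<xi>|lborel. E \<xi>)"
      by (simp add: norm_mult norm_divide norm_power)
    also have "\<dots> \<le> 1 / (2 * pi) ^ ?n * (LINT \<xi>|lborel. (norm ?h)\<^sup>2 * ((norm \<xi>)\<^sup>2 * cmod (F \<xi>)))"
    proof (intro mult_left_mono order_trans[OF integral_norm_bound] integral_mono)
      show "integrable lborel (\<lambda>\<xi>. cmod (E \<xi>))" using intE by simp
      show "integrable lborel (\<lambda>\<xi>. (norm ?h)\<^sup>2 * ((norm \<xi>)\<^sup>2 * cmod (F \<xi>)))" using int2 by simp
      fix \<xi>
      have "cmod (cis (?h \<bullet> \<xi>) - 1 - \<i> * of_real (?h \<bullet> \<xi>)) \<le> \<bar>?h \<bullet> \<xi>\<bar> ^ 2 / 2"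
        using iexp_approx1[of "?h \<bullet> \<xi>" 1] by (simp add: cis_conv_exp diff_diff_eq power2_eq_square)
      also have "\<dots> \<le> \<bar>?h \<bullet> \<xi>\<bar> ^ 2" by simp
      also have "\<dots> \<le> (norm ?h * norm \<xi>) ^ 2" by (intro power_mono Cauchy_Schwarz_ineq2) auto
      finally have "cmod (cis (?h \<bullet> \<xi>) - 1 - \<i> * of_real (?h \<bullet> \<xi>)) * cmod (F \<xi>)
          \<le> (norm ?h * norm \<xi>) ^ 2 * cmod (F \<xi>)"
        by (rule mult_right_mono) auto
      then show "cmod (E \<xi>) \<le> (norm ?h)\<^sup>2 * ((norm \<xi>)\<^sup>2 * cmod (F \<xi>))"
        by (simp add: E_def norm_mult power_mult_distrib mult_ac)
    qed simp
    finally show ?thesis unfolding integral_mult_right_zero by (simp add: K_def power2_eq_square mult_ac)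
  qed
  show ?thesis
    unfolding has_derivative_at2
  proof (intro conjI)
    show "bounded_linear ?D"
      by (intro bounded_linear_sum bounded_linear_scaleR_left[THEN bounded_linear_compose]
          bounded_linear_inner_left)
    show "((\<lambda>y. (1 / norm (y - x)) *\<^sub>R (inv_fourier F y - (inv_fourier F x + ?D (y - x)))) \<longlongrightarrow> 0) (at x)"
    proof (rule Lim_null_comparison)
      have "((\<lambda>y. K * norm (y - x)) \<longlongrightarrow> K * norm (x - x)) (at x)" by (intro tendsto_intros)
      then show "((\<lambda>y. K * norm (y - x)) \<longlongrightarrow> 0) (at x)" by simp
      show "\<forall>\<^sub>F y in at x. norm ((1 / norm (y - x)) *\<^sub>R (inv_fourier F y - (inv_fourier F x + ?D (y
          - x)))) \<le> K * norm (y - x)"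
        unfolding eventually_at_filter
      proof (intro always_eventually allI impI)
        fix y assume "y \<noteq> x"
        then have "norm (y - x) > 0" by simp
        then show "norm ((1 / norm (y - x)) *\<^sub>R (inv_fourier F y - (inv_fourier F x + ?D (y - x))))
            \<le> K * norm (y - x)"
          using bound[of y] by (simp add: diff_diff_eq[symmetric] divide_le_eq)
      qed
    qed
  qed
qed

lemma deriv_closed_inv_fourier_smooth_cc: "deriv_closed (inv_fourier ` smooth_cc)"
  unfolding deriv_closed_def
proof (intro ballI conjI allI)
  fix f :: "'a \<Rightarrow> complex" and x assume "f \<in> inv_fourier ` smooth_cc"
  then show "f differentiable (at x)" using inv_fourier_has_derivative by (auto simp: differentiable_def)
next
  fix f :: "'a \<Rightarrow> complex" and v :: 'a assume "f \<in> inv_fourier ` smooth_cc" and v: "v \<in> Basis"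
  then obtain F where F: "F \<in> smooth_cc" "f = inv_fourier F" by auto
  have "dir_deriv v f = (\<lambda>x. \<Sum>b\<in>Basis. (v \<bullet> b) *\<^sub>R inv_fourier (\<lambda>\<xi>. \<i> * of_real (\<xi> \<bullet> b) * F \<xi>) x)"
    unfolding F(2) by (rule dir_derivI[OF inv_fourier_has_derivative[OF F(1)]])
  also have "\<dots> = inv_fourier (\<lambda>\<xi>. \<i> * of_real (\<xi> \<bullet> v) * F \<xi>)"
    using v by (intro ext) (simp add: inner_Basis if_distrib[of "\<lambda>c. c *\<^sub>R _"] sum.delta cong: if_cong)
  finally show "dir_deriv v f \<in> inv_fourier ` smooth_cc"
    by (auto intro!: imageI smooth_cc_mult F smooth_fun_mult smooth_fun_const smooth_fun_inner)
qed

text \<open>Each derivative of an inverse transform is the inverse transform of another test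
  function, so the decay of all derivatives follows from the decay of the functions
  themselves.\<close>

lemma inv_fourier_schwartz:
  assumes F: "F \<in> smooth_cc" shows "inv_fourier F \<in> schwartz"
  unfolding schwartz_def
proof (intro CollectI conjI allI ballI)
  show "smooth_fun (inv_fourier F)"
    using deriv_closed_smooth[OF deriv_closed_inv_fourier_smooth_cc] F by blast
  fix k :: nat and vs :: "'a list" assume "vs \<in> lists Basis"
  then have "iter_pderiv vs (inv_fourier F) \<in> inv_fourier ` smooth_cc"
    using deriv_closed_iter_pderiv[OF deriv_closed_inv_fourier_smooth_cc] F by blast
  then show "\<exists>C. \<forall>x. norm x ^ k * cmod (iter_pderiv vs (inv_fourier F) x) \<le> C"
    using inv_fourier_decay by auto
qed

lemma inv_fourier_integrable: "F \<in> smooth_cc \<Longrightarrow> integrable lborel (inv_fourier F)"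
  by (intro integrable_rapid_decay inv_fourier_measurable smooth_cc_measurable inv_fourier_decay)

lemma fourier_inv_fourier_smooth_cc:
  assumes "F \<in> smooth_cc" shows "fourier (inv_fourier F) = F"
  using smooth_cc_bounded[OF assms]
  by (metis assms fourier_inv_fourier inv_fourier_integrable smooth_cc_continuous smooth_cc_integrable)

subsection \<open>Dyadic pieces of the bilinear operator\<close>

lemma integral_lborel_pair:
  fixes g :: "'a::euclidean_space \<times> 'b::euclidean_space \<Rightarrow> complex"
  assumes "integrable lborel g"
  shows "(LINT z|lborel. g z) = (LINT x|lborel. LINT y|lborel. g (x, y))"
    and "(LINT z|lborel. g z) = (LINT y|lborel. LINT x|lborel. g (x, y))"
proof -
  have i: "integrable (lborel \<Otimes>\<^sub>M lborel) g" using assms by (simp add: lborel_prod)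
  then have "integrable (lborel \<Otimes>\<^sub>M lborel) (\<lambda>(x, y). g (x, y))" by simp
  note f = lborel_pair.Fubini_integral[OF this] lborel_pair.integral_fst[OF this]
  show "(LINT z|lborel. g z) = (LINT x|lborel. LINT y|lborel. g (x, y))"
    "(LINT z|lborel. g z) = (LINT y|lborel. LINT x|lborel. g (x, y))"
    using f by (simp_all add: lborel_prod)
qed

text \<open>Makes the sum of the two frequencies an integration variable, so that a multiplier
  acting on the output frequency can leave the inner integral.\<close>

lemma integral_pair_shear:
  fixes g :: "'a::euclidean_space \<times> 'a \<Rightarrow> complex"
  assumes [measurable]: "g \<in> borel_measurable borel"
    and M: "\<And>z. cmod (g z) \<le> M" and R: "\<And>z. R < norm z \<Longrightarrow> g z = 0"
  shows "(LINT z|lborel. g z) = (LINT \<zeta>|lborel. LINT \<xi>|lborel. g (\<xi>, \<zeta> - \<xi>))"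
proof -
  have [measurable]: "(\<lambda>z. (fst z, snd z - fst z)) \<in> borel_measurable (borel :: ('a \<times> 'a) measure)"
    by (intro borel_measurable_continuous_onI continuous_intros)
  have "integrable lborel (\<lambda>z. g (fst z, snd z - fst z))"
  \<comment> \<open>The triangle inequality bounds |z| by 2 |fst z| + |snd z - fst z|, hence by
    three times the norm of the sheared pair.\<close>
  proof (rule integrable_bounded_support[where R="3 * R"])
    fix z :: "'a \<times> 'a" assume z: "3 * R < norm z"
    have "norm z \<le> norm (fst z) + norm (snd z)" using norm_Pair_le[of "fst z" "snd z"] by simp
    also have "norm (snd z) \<le> norm (snd z - fst z) + norm (fst z)"
      using norm_triangle_ineq[of "snd z - fst z" "fst z"] by simp
    finally have "norm z \<le> 3 * norm (fst z, snd z - fst z)"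
      using norm_fst_le[of "fst z" "snd z - fst z"] norm_snd_le[of "snd z - fst z" "fst z"] by simp
    then show "g (fst z, snd z - fst z) = 0" using z by (intro R) simp
  qed (use M in auto)
  note f = integral_lborel_pair[OF this]
  have "(LINT z|lborel. g z) = (LINT x|lborel. LINT y|lborel. g (x, y))"
    by (rule integral_lborel_pair) (rule integrable_bounded_support[OF assms])
  also have "\<dots> = (LINT x|lborel. LINT y|lborel. g (x, y - x))"
  proof (rule Bochner_Integration.integral_cong)
    fix x
    have "(LINT y|lborel. g (x, y)) = \<bar>1\<bar> ^ DIM('a) *\<^sub>R (LINT y|lborel. g (x, - x + 1 *\<^sub>R y))"
      by (rule lborel_integral_affine) auto
    then show "(LINT y|lborel. g (x, y)) = (LINT y|lborel. g (x, y - x))" by simp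
  qed simp
  also have "\<dots> = (LINT \<zeta>|lborel. LINT \<xi>|lborel. g (\<xi>, \<zeta> - \<xi>))" using f by simp
  finally show ?thesis .
qed

text \<open>\<open>T\<close> is the inverse transform of the function \<open>F\<close> obtained by
  integrating \<open>h\<close> over pairs of frequencies with a given sum. Inversion shows that
  \<open>F\<close> is the Fourier transform of \<open>T\<close>, after which \<open>m\<close>
  multiplies \<open>F\<close> and the integral over the sum is unfolded again.\<close>

lemma multiplier_op_diagonal:
  fixes h :: "'a::euclidean_space \<times> 'a \<Rightarrow> complex"
  assumes h: "h \<in> smooth_cc" and m: "m \<in> smooth_cc"
  defines "T \<equiv> (\<lambda>x. complex_of_real (1 / (2 * pi) ^ (2 * DIM('a))) *
      (LINT z|lborel. cis (x \<bullet> (fst z + snd z)) * h z))"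
  shows "multiplier_op m T x = complex_of_real (1 / (2 * pi) ^ (2 * DIM('a))) *
      (LINT z|lborel. cis (x \<bullet> (fst z + snd z)) * (m (fst z + snd z) * h z))"
proof -
  let ?n = "DIM('a)"
  let ?k = "complex_of_real (1 / (2 * pi) ^ ?n)"
  have k2: "complex_of_real (1 / (2 * pi) ^ (2 * ?n)) = ?k * ?k"
  proof -
    have "(2 * pi) ^ (2 * ?n) = (2 * pi) ^ ?n * (2 * pi) ^ ?n" by (simp only: mult_2[of ?n] power_add)
    then show ?thesis by (simp only: of_real_mult[symmetric]) simp
  qed
  have [measurable]: "h \<in> borel_measurable borel" "m \<in> borel_measurable borel"
    using h m smooth_cc_measurable by auto
  obtain R where R: "\<And>z. R < norm z \<Longrightarrow> h z = 0" using h by (auto simp: smooth_cc_def)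
  obtain M where M: "0 \<le> M" "\<And>z. cmod (h z) \<le> M" using smooth_cc_bounded[OF h] by blast
  obtain M' where M': "0 \<le> M'" "\<And>z. cmod (m z) \<le> M'" using smooth_cc_bounded[OF m] by blast
  define F where "F \<zeta> = ?k * (LINT \<xi>|lborel. h (\<xi>, \<zeta> - \<xi>))" for \<zeta>
  \<comment> \<open>Used twice: with \<open>w = 1\<close> it identifies \<open>T\<close>, with
    \<open>w = m\<close> it rewrites the result as an integral over pairs.\<close>
  have fold: "?k * ?k * (LINT z|lborel. cis (x \<bullet> (fst z + snd z)) * (w (fst z + snd z) * h z))
      = inv_fourier (\<lambda>\<zeta>. w \<zeta> * F \<zeta>) x"
    if [measurable]: "w \<in> borel_measurable borel" and w: "\<And>z. cmod (w z) \<le> W" "0 \<le> W" for w W x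
  proof -
    have "(LINT z|lborel. cis (x \<bullet> (fst z + snd z)) * (w (fst z + snd z) * h z)) =
      (LINT \<zeta>|lborel. LINT \<xi>|lborel. cis (x \<bullet> (fst (\<xi>, \<zeta> - \<xi>) + snd (\<xi>, \<zeta> - \<xi>))) * (w (fst (\<xi>, \<zeta> - \<xi>)
          + snd (\<xi>, \<zeta> - \<xi>)) * h (\<xi>, \<zeta> - \<xi>)))"
    proof (rule integral_pair_shear)
      show "(\<lambda>z. cis (x \<bullet> (fst z + snd z)) * (w (fst z + snd z) * h z)) \<in> borel_measurable borel"
        unfolding borel_prod[symmetric] by (measurable, simp add: borel_prod)
      show "cmod (cis (x \<bullet> (fst z + snd z)) * (w (fst z + snd z) * h z)) \<le> W * M" for z
        unfolding norm_mult norm_cis mult_1 by (intro mult_mono w M norm_ge_zero)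
      show "R < norm z \<Longrightarrow> cis (x \<bullet> (fst z + snd z)) * (w (fst z + snd z) * h z) = 0" for z
        using R by simp
    qed
    also have "\<dots> = (LINT \<zeta>|lborel. cis (x \<bullet> \<zeta>) * (w \<zeta> * (LINT \<xi>|lborel. h (\<xi>, \<zeta> - \<xi>))))"
      by simp
    also have "?k * \<dots> = (LINT \<zeta>|lborel. cis (x \<bullet> \<zeta>) * (w \<zeta> * F \<zeta>))"
      unfolding integral_mult_right_zero[symmetric] F_def by (intro Bochner_Integration.integral_cong)
          (simp_all add: mult_ac)
    finally show ?thesis unfolding inv_fourier_def by (simp only: mult.assoc)
  qed
  have T: "T = inv_fourier F"
  proof
    fix x
    have "?k * ?k * (LINT z|lborel. cis (x \<bullet> (fst z + snd z)) * (1 * h z)) = inv_fourier (\<lambda>\<zeta>. 1 * F \<zeta>) x"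
      by (rule fold[of "\<lambda>_. 1" 1]) auto
    then show "T x = inv_fourier F x" by (simp only: T_def k2 mult_1)
  qed
  have sup: "norm \<xi> > R \<Longrightarrow> h (\<xi>, \<eta>) = 0" for \<xi> \<eta>
    using R[of "(\<xi>, \<eta>)"] norm_fst_le[of \<xi> \<eta>] by simp
  have hb: "cmod (h (\<xi>, \<zeta> - \<xi>)) \<le> M * indicator (cball 0 R) \<xi>" for \<xi> \<zeta>
    using M sup[of \<xi>] by (cases "norm \<xi> \<le> R") auto
  have mh: "(\<lambda>\<xi>. h (\<xi>, \<zeta> - \<xi>)) \<in> borel_measurable lborel" for \<zeta>
  proof -
    have "continuous_on UNIV (\<lambda>\<xi>. h (\<xi>, \<zeta> - \<xi>))"
      by (rule continuous_on_compose2[OF smooth_cc_continuous[OF h, of UNIV]]) (auto intro!: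
          continuous_intros)
    then show ?thesis by (simp add: borel_measurable_continuous_onI)
  qed
  \<comment> \<open>The inversion theorem asks for a continuous, bounded and integrable function;
    these three properties of \<open>F\<close> are collected here.\<close>
  have cF: "continuous_on UNIV F"
    unfolding continuous_on_sequentially F_def comp_def
  proof (intro allI impI ballI, elim conjE)
    fix y and a :: 'a assume y: "y \<longlonglongrightarrow> a"
    show "(\<lambda>j. ?k * (LINT \<xi>|lborel. h (\<xi>, y j - \<xi>))) \<longlonglongrightarrow> ?k * (LINT \<xi>|lborel. h (\<xi>, a - \<xi>))"
    proof (intro tendsto_mult tendsto_const integral_dominated_convergence[where w="\<lambda>\<xi>. M * indicator
        (cball 0 R) \<xi>"] mh)
      show "integrable lborel (\<lambda>\<xi>::'a. M * indicator (cball 0 R) \<xi> :: real)"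
        by (intro integrable_mult_right integrable_indicator_cball)
      show "AE \<xi> in lborel. (\<lambda>j. h (\<xi>, y j - \<xi>)) \<longlonglongrightarrow> h (\<xi>, a - \<xi>)"
        by (intro AE_I2 continuous_on_tendsto_compose[OF smooth_cc_continuous[OF h, of UNIV]]
            tendsto_intros y) auto
    qed (use hb in auto)
  qed
  have bF: "cmod (F \<zeta>) \<le> cmod ?k * (LINT \<xi>|lborel. M * indicator (cball (0::'a) R) \<xi>)" for \<zeta>
    unfolding F_def norm_mult
  proof (intro mult_left_mono order_trans[OF integral_norm_bound] integral_mono)
    show i: "integrable lborel (\<lambda>\<xi>::'a. M * indicator (cball 0 R) \<xi> :: real)"
      by (intro integrable_mult_right integrable_indicator_cball)
    have "integrable lborel (\<lambda>\<xi>. h (\<xi>, \<zeta> - \<xi>))"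
      by (rule Bochner_Integration.integrable_bound[OF i mh]) (intro AE_I2 order_trans[OF hb
          abs_ge_self[THEN order_trans]], auto)
    then show "integrable lborel (\<lambda>\<xi>. cmod (h (\<xi>, \<zeta> - \<xi>)))" by simp
  qed (use hb in auto)
  have sF: "F \<zeta> = 0" if "norm \<zeta> > 2 * R" for \<zeta>
  proof -
    have "h (\<xi>, \<zeta> - \<xi>) = 0" for \<xi>
    proof (cases "norm \<xi> > R")
      case False
      then have "norm (\<zeta> - \<xi>) > R" using norm_triangle_ineq2[of \<zeta> \<xi>] that by simp
      then show ?thesis using R[of "(\<xi>, \<zeta> - \<xi>)"] norm_snd_le[of "\<zeta> - \<xi>" \<xi>] by simp
    qed (use sup in auto)
    then show ?thesis by (simp add: F_def)
  qed
  have mF: "F \<in> borel_measurable borel" using cF by (rule borel_measurable_continuous_onI)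
  have iF: "integrable lborel F"
    by (rule integrable_bounded_support[OF mF bF sF])
  have "integrable lborel T"
  proof (rule integrable_rapid_decay)
    show "T \<in> borel_measurable borel" unfolding T by (rule inv_fourier_measurable[OF mF])
    fix k :: nat
    \<comment> \<open>\<open>T\<close> is the restriction to the diagonal of an inverse transform in
      twice the dimension, and a pair (x, x) is at least as long as x. The decay of that transform
      passes to \<open>T\<close>.\<close>
    have Th: "T x = inv_fourier h (x, x)" for x
      by (simp add: T_def inv_fourier_def inner_prod_def inner_add_right mult_2[of "DIM('a)"])
    obtain C where C: "\<And>z. norm z ^ k * cmod (inv_fourier h z) \<le> C" using inv_fourier_decay[OF h]
        by blast
    have "norm x ^ k * cmod (T x) \<le> C" for x
    proof -
      have "norm x ^ k * cmod (T x) \<le> norm (x, x) ^ k * cmod (inv_fourier h (x, x))"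
        unfolding Th by (intro mult_right_mono power_mono norm_fst_le) auto
      then show ?thesis using C order_trans by blast
    qed
    then show "\<exists>C. \<forall>x. norm x ^ k * cmod (T x) \<le> C" by blast
  qed
  then have "fourier T = F" unfolding T by (intro fourier_inv_fourier[OF iF cF bF])
  then have "multiplier_op m T x = inv_fourier (\<lambda>\<zeta>. m \<zeta> * F \<zeta>) x" by (simp add: multiplier_op_def)
  also have "\<dots> = ?k * ?k * (LINT z|lborel. cis (x \<bullet> (fst z + snd z)) * (m (fst z + snd z) * h z))"
    using fold[of m M'] M' by simp
  finally show ?thesis by (simp only: k2)
qed

section \<open>Modulated inputs of the bilinear operator\<close>

lemma smooth_cc_translate: "(\<theta> :: 'a::euclidean_space \<Rightarrow> complex) \<in> smooth_cc
    \<Longrightarrow> (\<lambda>\<xi>. \<theta> (\<xi> - a)) \<in> smooth_cc"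
proof -
  assume "\<theta> \<in> smooth_cc"
  then obtain R where s: "smooth_fun \<theta>" and R: "\<And>x. R < norm x \<Longrightarrow> \<theta> x = 0" by (auto simp: smooth_cc_def)
  show ?thesis
  proof (rule smooth_ccI)
    show "smooth_fun (\<lambda>\<xi>. \<theta> (\<xi> - a))" using smooth_fun_affine[OF s bounded_linear_ident, of "- a"]
        by simp
    fix x :: 'a assume "R + norm a < norm x"
    then show "\<theta> (x - a) = 0" using norm_triangle_ineq2[of x a] by (intro R) simp
  qed
qed

lemma smooth_cc_tensor:
  assumes "\<theta>1 \<in> smooth_cc" "\<theta>2 \<in> smooth_cc"
  shows "(\<lambda>z. \<theta>1 (fst z) * \<theta>2 (snd z)) \<in> smooth_cc"
proof -
  obtain R1 where 1: "smooth_fun \<theta>1" "\<And>x. R1 < norm x \<Longrightarrow> \<theta>1 x = 0" using assms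
      by (auto simp: smooth_cc_def)
  obtain R2 where 2: "smooth_fun \<theta>2" "\<And>x. R2 < norm x \<Longrightarrow> \<theta>2 x = 0" using assms
      by (auto simp: smooth_cc_def)
  show ?thesis
  proof (rule smooth_ccI)
    show "smooth_fun (\<lambda>z. \<theta>1 (fst z) * \<theta>2 (snd z))"
      using smooth_fun_affine[OF 1(1) bounded_linear_fst, of 0] smooth_fun_affine[OF 2(1)
          bounded_linear_snd, of 0]
      by (intro smooth_fun_mult) simp_all
    fix z :: "'a \<times> 'b" assume "R1 + R2 < norm z"
    then have "R1 < norm (fst z) \<or> R2 < norm (snd z)" using norm_Pair_le[of "fst z" "snd z"] by auto
    then show "\<theta>1 (fst z) * \<theta>2 (snd z) = 0" using 1 2 by auto
  qed
qed

text \<open>Translating the pair of frequencies by (a, b) moves the bumps back to the origin. What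
  moves instead are the arguments of the symbol and of the multiplier, and a factor of modulus one
  comes out.\<close>

lemma multiplier_op_bilinear_op:
  fixes \<theta>1 \<theta>2 m :: "'a::euclidean_space \<Rightarrow> complex"
  assumes \<theta>: "\<theta>1 \<in> smooth_cc" "\<theta>2 \<in> smooth_cc" and m: "m \<in> smooth_cc" and \<tau>: "smooth_fun \<tau>"
  shows "multiplier_op m (bilinear_op (\<lambda>z. \<tau> (snd z)) (inv_fourier (\<lambda>\<xi>. \<theta>1 (\<xi> - a))) (inv_fourier (\<lambda>\<xi>.
      \<theta>2 (\<xi> - b)))) x
    = complex_of_real (1 / (2 * pi) ^ (2 * DIM('a))) * (cis (x \<bullet> (a + b)) *
      (LINT z|lborel. cis (x \<bullet> (fst z + snd z)) * (m (fst z + snd z + (a + b)) * \<tau> (fst z + a, snd z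
          + b) * (\<theta>1 (fst z) * \<theta>2 (snd z)))))"
proof -
  define h where "h z = \<tau> z * (\<theta>1 (fst z - a) * \<theta>2 (snd z - b))" for z
  have \<theta>': "(\<lambda>\<xi>. \<theta>1 (\<xi> - a)) \<in> smooth_cc" "(\<lambda>\<xi>. \<theta>2 (\<xi> - b)) \<in> smooth_cc" using \<theta> smooth_cc_translate
      by auto
  have h: "h \<in> smooth_cc" unfolding h_def
    by (rule smooth_cc_mult[OF smooth_cc_tensor[OF \<theta>'] \<tau>])
  have [measurable]: "h \<in> borel_measurable borel" "m \<in> borel_measurable borel"
    using h m smooth_cc_measurable by auto
  have "bilinear_op (\<lambda>z. \<tau> (snd z)) (inv_fourier (\<lambda>\<xi>. \<theta>1 (\<xi> - a))) (inv_fourier (\<lambda>\<xi>. \<theta>2 (\<xi> - b)))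
    = (\<lambda>x. complex_of_real (1 / (2 * pi) ^ (2 * DIM('a))) * (LINT z|lborel. cis (x \<bullet> (fst z + snd z))
        * h z))"
    unfolding bilinear_op_def h_def
    by (simp add: fourier_inv_fourier_smooth_cc[OF \<theta>'(1)] fourier_inv_fourier_smooth_cc[OF \<theta>'(2)]
        case_prod_unfold mult.assoc)
  then have "multiplier_op m (bilinear_op (\<lambda>z. \<tau> (snd z)) (inv_fourier (\<lambda>\<xi>. \<theta>1 (\<xi> - a))) (inv_fourier
      (\<lambda>\<xi>. \<theta>2 (\<xi> - b)))) x
    = complex_of_real (1 / (2 * pi) ^ (2 * DIM('a))) *
      (LINT z|lborel. cis (x \<bullet> (fst z + snd z)) * (m (fst z + snd z) * h z))"
    using multiplier_op_diagonal[OF h m] by simp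
  also have "(LINT z|lborel. cis (x \<bullet> (fst z + snd z)) * (m (fst z + snd z) * h z))
    = \<bar>1\<bar> ^ DIM('a \<times> 'a) *\<^sub>R (LINT z|lborel. cis (x \<bullet> (fst ((a, b) + 1 *\<^sub>R z) + snd ((a, b) + 1 *\<^sub>R z)))
        * (m (fst ((a, b) + 1 *\<^sub>R z) + snd ((a, b) + 1 *\<^sub>R z)) * h ((a, b) + 1 *\<^sub>R z)))"
  proof (rule lborel_integral_affine)
    show "(\<lambda>z. cis (x \<bullet> (fst z + snd z)) * (m (fst z + snd z) * h z)) \<in> borel_measurable borel"
      unfolding borel_prod[symmetric] by (measurable, simp add: borel_prod)
  qed simp
  also have "\<dots> = (LINT z|lborel. cis (x \<bullet> (a + b)) * (cis (x \<bullet> (fst z + snd z)) * (m (fst z + snd z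
      + (a + b)) * \<tau> (fst z + a, snd z + b) * (\<theta>1 (fst z) * \<theta>2 (snd z)))))"
    unfolding mult.assoc[symmetric, of "cis (x \<bullet> (a + b))"] cis_mult inner_add_right[symmetric]
    by (simp only: abs_one power_one scaleR_one, intro Bochner_Integration.integral_cong)
       (simp_all add: h_def add_ac mult.assoc plus_prod_def)
  finally show ?thesis by simp
qed

subsection \<open>Besov norms of modulated bumps\<close>

lemma ennpowr_ennreal: "0 \<le> x \<Longrightarrow> ennpowr (ennreal x) a = ennreal (x powr a)"
  by (simp add: ennpowr_def)

lemma ennpowr_mono:
  assumes "x \<le> y" "0 \<le> a" shows "ennpowr x a \<le> ennpowr y a"
proof (cases y)
  case (real r)
  then obtain t where "x = ennreal t" "0 \<le> t" using assms by (cases x) (auto simp: top_unique)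
  with real assms show ?thesis by (auto simp: ennpowr_ennreal ennreal_le_iff intro!: ennreal_leI
      powr_mono2)
qed (simp add: ennpowr_def)

lemma ennpowr_scaled_inverse:
  assumes "0 < a" "0 < u"
  shows "ennpowr (ennreal (u powr a) * ennpowr x a) (1 / a) = ennreal u * x"
proof (cases x)
  case (real r)
  have "(u powr a * r powr a) powr (1 / a) = u * r"
    using assms real by (simp add: powr_mult powr_powr)
  then show ?thesis using real assms by (simp add: ennpowr_ennreal ennreal_mult[symmetric])
next
  case top
  then show ?thesis using assms by (simp add: ennpowr_def ennreal_mult_top)
qed

text \<open>A supremum or a series dominates each of its terms. The lower bound for the output uses
  just the block that contains its frequency.\<close>

lemma besov_norm_ge:
  assumes "0 < q"
  shows "ennreal (2 powr (real l * s)) * Lp_norm p (multiplier_op (dyadic_piece \<psi>0 l) f)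
      \<le> besov_norm \<psi>0 s p q f"
proof (cases "q = \<infinity>")
  case True
  then show ?thesis unfolding besov_norm_def
    using SUP_upper[of l UNIV "\<lambda>l. ennreal (2 powr (real l * s)) * Lp_norm p (multiplier_op
        (dyadic_piece \<psi>0 l) f)"] by simp
next
  case False
  define r where "r = enn2real q"
  have r: "r > 0" using assms False by (simp add: r_def enn2real_positive_iff top.not_eq_extremum)
  define X where "X k = Lp_norm p (multiplier_op (dyadic_piece \<psi>0 k) f)" for k
  have "ennreal (2 powr (real l * s)) * X l = ennpowr (ennreal ((2 powr (real l * s)) powr r)
      * ennpowr (X l) r) (1 / r)"
    using r by (intro ennpowr_scaled_inverse[symmetric]) auto
  also have "\<dots> = ennpowr (ennreal (2 powr (real l * s * r)) * ennpowr (X l) r) (1 / r)"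
    by (simp add: powr_powr)
  also have "\<dots> \<le> ennpowr (\<Sum>k. ennreal (2 powr (real k * s * r)) * ennpowr (X k) r) (1 / r)"
    using r sum_le_suminf[of "\<lambda>k. ennreal (2 powr (real k * s * r)) * ennpowr (X k) r" "{l}"]
    by (intro ennpowr_mono) auto
  finally show ?thesis using False unfolding besov_norm_def X_def r_def by simp
qed

text \<open>At most five blocks contribute, those with \<open>l\<close> within 2 of
  \<open>j\<close>, and on them \<open>l s\<close> differs from \<open>j s\<close> by at most 2
  |s|.\<close>

lemma besov_norm_le:
  assumes q: "0 < q" and K: "0 \<le> K"
    and b: "\<And>l. Lp_norm p (multiplier_op (dyadic_piece \<psi>0 l) f) \<le> ennreal K"
    and z: "\<And>l. \<not> (j \<le> l + 2 \<and> l \<le> j + 2) \<Longrightarrow> Lp_norm p (multiplier_op (dyadic_piece \<psi>0 l) f) = 0"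
  shows "besov_norm \<psi>0 s p q f \<le> ennreal (5 powr (1 / enn2real q) * (2 powr (2 * \<bar>s\<bar>) * K)
      * 2 powr (real j * s))"
proof -
  define X where "X k = Lp_norm p (multiplier_op (dyadic_piece \<psi>0 k) f)" for k
  define U where "U = 2 powr (2 * \<bar>s\<bar>) * K * 2 powr (real j * s)"
  have U: "U \<ge> 0" using K by (simp add: U_def)
  have pw: "2 powr (real l * s) * K \<le> U" if "j \<le> l + 2" "l \<le> j + 2" for l
  proof -
    have "\<bar>real l - real j\<bar> \<le> 2" using that by linarith
    then have "\<bar>(real l - real j) * s\<bar> \<le> 2 * \<bar>s\<bar>" by (simp add: abs_mult mult_right_mono)
    then have "real l * s \<le> 2 * \<bar>s\<bar> + real j * s" by (simp add: left_diff_distrib abs_le_iff)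
    then have "2 powr (real l * s) \<le> 2 powr (2 * \<bar>s\<bar>) * 2 powr (real j * s)"
      by (simp add: powr_add[symmetric])
    then have "2 powr (real l * s) * K \<le> 2 powr (2 * \<bar>s\<bar>) * 2 powr (real j * s) * K"
      using K by (rule mult_right_mono)
    then show ?thesis by (simp add: U_def mult_ac)
  qed
  show ?thesis
  proof (cases "q = \<infinity>")
    case True
    have "ennreal (2 powr (real l * s)) * X l \<le> ennreal U" for l
    proof (cases "j \<le> l + 2 \<and> l \<le> j + 2")
      case True
      have "ennreal (2 powr (real l * s)) * X l \<le> ennreal (2 powr (real l * s)) * ennreal K"
        unfolding X_def by (intro mult_left_mono b) simp
      also have "\<dots> = ennreal (2 powr (real l * s) * K)" using K by (simp add: ennreal_mult)
      also have "\<dots> \<le> ennreal U" using pw True by (intro ennreal_leI) auto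
      finally show ?thesis .
    next
      case False
      then show ?thesis using z[of l] by (simp add: X_def)
    qed
    then have "(SUP l. ennreal (2 powr (real l * s)) * X l) \<le> ennreal U" by (rule SUP_least)
    \<comment> \<open>For infinite \<open>q\<close> both \<open>enn2real q\<close> and its
      reciprocal are 0, so the factor with base 5 is 1.\<close>
    then show ?thesis using True unfolding besov_norm_def X_def U_def by simp
  next
    case False
    define r where "r = enn2real q"
    have r: "r > 0" using q False by (simp add: r_def enn2real_positive_iff top.not_eq_extremum)
    have t: "ennreal (2 powr (real l * s * r)) * ennpowr (X l) r \<le> (if l \<in> {j - 2..j + 2} then ennreal
        (U powr r) else 0)" for l
    proof (cases "j \<le> l + 2 \<and> l \<le> j + 2")
      case True
      have "ennreal (2 powr (real l * s * r)) * ennpowr (X l) r \<le> ennreal (2 powr (real l * s * r))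
          * ennpowr (ennreal K) r"
        unfolding X_def using r by (intro mult_left_mono ennpowr_mono b) simp_all
      also have "\<dots> = ennreal ((2 powr (real l * s) * K) powr r)"
        using K by (simp add: ennreal_mult ennpowr_ennreal powr_mult powr_powr)
      also have "\<dots> \<le> ennreal (U powr r)" using pw True K r by (intro ennreal_leI powr_mono2) auto
      finally show ?thesis using True by auto
    next
      case False
      then have "X l = 0" using z[of l] by (simp add: X_def)
      then show ?thesis by (simp add: ennpowr_def)
    qed
    have "(\<Sum>k. ennreal (2 powr (real k * s * r)) * ennpowr (X k) r) \<le> (\<Sum>k. if k \<in> {j - 2..j
        + 2} then ennreal (U powr r) else 0)"
      by (intro suminf_le t) auto
    also have "\<dots> = (\<Sum>k\<in>{j - 2..j + 2}. ennreal (U powr r))"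
      by (subst suminf_finite[of "{j - 2..j + 2}"]) auto
    also have "\<dots> = of_nat (card {j - 2..j + 2}) * ennreal (U powr r)" by simp
    \<comment> \<open>Natural subtraction is truncated for \<open>j < 2\<close>, which only shortens
      the interval.\<close>
    also have "\<dots> \<le> of_nat 5 * ennreal (U powr r)" by (intro mult_right_mono of_nat_mono) auto
    also have "\<dots> = ennreal (5 * U powr r)" by (simp add: ennreal_mult)
    finally have "ennpowr (\<Sum>k. ennreal (2 powr (real k * s * r)) * ennpowr (X k) r) (1 / r)
        \<le> ennpowr (ennreal (5 * U powr r)) (1 / r)"
      using r by (intro ennpowr_mono) auto
    also have "\<dots> = ennreal (5 powr (1 / r) * U)" using U r by (simp add: ennpowr_ennreal powr_mult
        powr_powr)
    finally show ?thesis using False unfolding besov_norm_def X_def r_def U_def by (simp add: mult.assoc)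
  qed
qed

lemma Lp_norm_zero: "0 < p \<Longrightarrow> Lp_norm p (\<lambda>x. 0) = 0"
proof (cases "p = \<infinity>")
  case True
  have "esssup lborel (\<lambda>x::'a. ennreal 0) \<le> 0" by (rule esssup_I) auto
  then show ?thesis using True by (simp add: Lp_norm_def)
qed (simp add: Lp_norm_def ennpowr_def)

lemma two_le_enn2real: "2 \<le> p \<Longrightarrow> p \<noteq> \<infinity> \<Longrightarrow> 2 \<le> enn2real p"
  by (cases p) auto

text \<open>For \<open>p \<ge> 2\<close> the bound interpolates between the trivial \<open>L\<^sup>\<infinity>\<close> bound and Plancherel.\<close>

lemma Lp_norm_inv_fourier_le:
  assumes p: "2 \<le> p" and M: "0 \<le> M"
  obtains K where "0 \<le> K"
    "\<And>F a. F \<in> smooth_cc \<Longrightarrow> (\<And>x. cmod (F x) \<le> M) \<Longrightarrow> (\<And>x. R < norm (x - a) \<Longrightarrow> F x = 0)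
        \<Longrightarrow> Lp_norm p (inv_fourier (F :: 'a::euclidean_space \<Rightarrow> complex)) \<le> ennreal K"
proof -
  let ?k = "1 / (2 * pi) ^ DIM('a)"
  define V where "V = measure lborel (cball (0::'a) R)"
  define A where "A = ?k * (M * V)"
  define B where "B = ?k * (M\<^sup>2 * V)"
  have V: "V \<ge> 0" by (simp add: V_def)
  have A: "A \<ge> 0" and B: "B \<ge> 0" using M V by (simp_all add: A_def B_def)
  \<comment> \<open>The constant must not depend on the centre \<open>a\<close>: volumes of balls
    are translation invariant.\<close>
  have vol: "(LINT x|lborel. c * indicator (cball a R) x) = c * V" for c and a :: 'a
  proof -
    have "measure lborel (cball a R) = V"
    proof -
      have "(LINT x|lborel. indicator (cball a R) x :: real) = \<bar>1\<bar> ^ DIM('a) *\<^sub>R (LINT x|lborel.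
          indicator (cball a R) (a + 1 *\<^sub>R x))"
        by (rule lborel_integral_affine) (auto intro!: borel_measurable_indicator)
      also have "(\<lambda>x. indicator (cball a R) (a + 1 *\<^sub>R x) :: real) = indicator (cball 0 R)"
        by (auto simp: indicator_def dist_norm)
      finally show ?thesis by (simp add: V_def)
    qed
    then show ?thesis by simp
  qed
  have bounds: "cmod (inv_fourier F x) \<le> A"
    "(\<integral>\<^sup>+x. ennreal ((cmod (inv_fourier F x))\<^sup>2) \<partial>lborel) \<le> ennreal B"
    if F: "F \<in> smooth_cc" and FM: "\<And>x. cmod (F x) \<le> M" and FR: "\<And>x. R < norm (x - a) \<Longrightarrow> F x = 0"
    for F :: "'a \<Rightarrow> complex" and a x
  proof -
    have [measurable]: "F \<in> borel_measurable borel" using F by (rule smooth_cc_measurable)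
    have i: "integrable lborel (\<lambda>x. c * indicator (cball a R) x :: real)" for c
      by (intro integrable_mult_right integrable_indicator_cball)
    have b1: "cmod (F x) \<le> M * indicator (cball a R) x" for x
      using FM[of x] FR[of x] by (cases "norm (x - a) \<le> R") (auto simp: dist_norm norm_minus_commute)
    have b2: "(cmod (F x))\<^sup>2 \<le> M\<^sup>2 * indicator (cball a R) x" for x
      using FM[of x] FR[of x] by (cases "norm (x - a) \<le> R") (auto simp: dist_norm norm_minus_commute
          power_mono)
    have "cmod (inv_fourier F x) \<le> ?k * (LINT \<xi>|lborel. cmod (F \<xi>))"
      by (rule norm_inv_fourier_le[OF smooth_cc_integrable[OF F]])
    also have "\<dots> \<le> ?k * (LINT \<xi>|lborel. M * indicator (cball a R) \<xi>)"
      using smooth_cc_integrable[OF F] by (intro mult_left_mono integral_mono i b1) auto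
    finally show "cmod (inv_fourier F x) \<le> A" by (simp only: vol A_def)
    have "(\<integral>\<^sup>+x. ennreal ((cmod (inv_fourier F x))\<^sup>2) \<partial>lborel) = ennreal (?k * (LINT \<xi>|lborel. (cmod
        (F \<xi>))\<^sup>2))"
      by (rule nn_integral_inv_fourier_square[OF smooth_cc_integrable[OF F] smooth_cc_continuous[OF F]
          FM inv_fourier_integrable[OF F]])
    also have "\<dots> \<le> ennreal (?k * (LINT \<xi>|lborel. M\<^sup>2 * indicator (cball a R) \<xi>))"
    proof (intro ennreal_leI mult_left_mono integral_mono i b2)
      show "integrable lborel (\<lambda>\<xi>. (cmod (F \<xi>))\<^sup>2)"
        by (rule Bochner_Integration.integrable_bound[OF i[of "M\<^sup>2"]]) (use b2 in \<open>auto intro: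
            order_trans[OF _ abs_ge_self]\<close>)
    qed auto
    finally show "(\<integral>\<^sup>+x. ennreal ((cmod (inv_fourier F x))\<^sup>2) \<partial>lborel) \<le> ennreal B"
        by (simp only: vol B_def)
  qed
  show ?thesis
  proof (cases "p = \<infinity>")
    case True
    show ?thesis
    proof (rule that[OF A])
      fix F :: "'a \<Rightarrow> complex" and a
      assume F: "F \<in> smooth_cc" "\<And>x. cmod (F x) \<le> M" "\<And>x. R < norm (x - a) \<Longrightarrow> F x = 0"
      have [measurable]: "F \<in> borel_measurable borel" using F(1) by (rule smooth_cc_measurable)
      have "esssup lborel (\<lambda>x. ennreal (cmod (inv_fourier F x))) \<le> ennreal A"
        by (rule esssup_I) (auto intro!: ennreal_leI bounds(1)[OF F])
      then show "Lp_norm p (inv_fourier F) \<le> ennreal A" using True by (simp add: Lp_norm_def)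
    qed
  next
    case False
    define r where "r = enn2real p"
    have r: "r \<ge> 2" using two_le_enn2real[OF p False] by (simp add: r_def)
    show ?thesis
    proof (rule that[of "(A powr (r - 2) * B) powr (1 / r)"])
      fix F :: "'a \<Rightarrow> complex" and a
      assume F: "F \<in> smooth_cc" "\<And>x. cmod (F x) \<le> M" "\<And>x. R < norm (x - a) \<Longrightarrow> F x = 0"
      have [measurable]: "F \<in> borel_measurable borel" using F(1) by (rule smooth_cc_measurable)
      have pt: "cmod (inv_fourier F x) powr r \<le> A powr (r - 2) * (cmod (inv_fourier F x))\<^sup>2" for x
      proof (cases "inv_fourier F x = 0")
        case False
        then have "cmod (inv_fourier F x) powr r = cmod (inv_fourier F x) powr (r - 2)
            * (cmod (inv_fourier F x))\<^sup>2"
          by (simp add: powr_diff powr_realpow_2[symmetric] del: powr_numeral)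
        also have "\<dots> \<le> A powr (r - 2) * (cmod (inv_fourier F x))\<^sup>2"
          using r by (intro mult_right_mono powr_mono2 bounds(1)[OF F]) auto
        finally show ?thesis .
      qed (use r in simp)
      have "(\<integral>\<^sup>+x. ennreal (cmod (inv_fourier F x) powr r) \<partial>lborel) \<le> (\<integral>\<^sup>+x. ennreal (A powr (r - 2))
          * ennreal ((cmod (inv_fourier F x))\<^sup>2) \<partial>lborel)"
        by (intro nn_integral_mono) (use pt in \<open>auto simp: ennreal_mult[symmetric] intro!: ennreal_leI\<close>)
      also have "\<dots> = ennreal (A powr (r - 2)) * (\<integral>\<^sup>+x. ennreal ((cmod (inv_fourier F x))\<^sup>2) \<partial>lborel)"
        by (rule nn_integral_cmult) auto
      also have "\<dots> \<le> ennreal (A powr (r - 2)) * ennreal B"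
        by (intro mult_left_mono bounds(2)[OF F]) auto
      also have "\<dots> = ennreal (A powr (r - 2) * B)" using B by (simp add: ennreal_mult)
      finally have "ennpowr (\<integral>\<^sup>+x. ennreal (cmod (inv_fourier F x) powr r) \<partial>lborel) (1 / r)
          \<le> ennpowr (ennreal (A powr (r - 2) * B)) (1 / r)"
        using r by (intro ennpowr_mono) auto
      also have "\<dots> = ennreal ((A powr (r - 2) * B) powr (1 / r))" using B by (intro ennpowr_ennreal) auto
      finally show "Lp_norm p (inv_fourier F) \<le> ennreal ((A powr (r - 2) * B) powr (1 / r))"
        using False by (simp add: Lp_norm_def r_def)
    qed simp
  qed
qed

text \<open>Ties a centre to the index of a dyadic block around it. The origin gets index 0, since
  block 0 is the whole cutoff.\<close>

definition at_frequency :: "nat \<Rightarrow> 'a::real_normed_vector \<Rightarrow> bool" where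
  "at_frequency j a \<longleftrightarrow> (j = 0 \<and> a = 0) \<or> norm a = 2 ^ j"

section \<open>Dyadic blocks near a given frequency\<close>

context
  fixes \<psi>0 :: "'a::euclidean_space \<Rightarrow> complex"
  assumes cutoff: "besov_cutoff \<psi>0"
begin

lemma cutoff_smooth: "smooth_fun \<psi>0"
  using cutoff by (simp add: besov_cutoff_def schwartz_def)

lemma cutoff_eq_1: "norm \<xi> \<le> 1 \<Longrightarrow> \<psi>0 \<xi> = 1"
  using cutoff by (simp add: besov_cutoff_def)

text \<open>The support condition gives vanishing for norms above 2; on the sphere itself it follows
  by continuity along the ray from outside. The sphere matters: the dyadic function is later
  evaluated at a unit vector \<open>e\<close>, which involves \<open>\<psi>0\<close> at
  \<open>2 e\<close>.\<close>

lemma cutoff_eq_0: assumes "2 \<le> norm \<xi>" shows "\<psi>0 \<xi> = 0"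
proof -
  have out: "\<psi>0 x = 0" if "2 < norm x" for x
    using cutoff closure_subset[of "{\<xi>. \<psi>0 \<xi> \<noteq> 0}"] that unfolding besov_cutoff_def by fastforce
  define y where "y j = (1 + inverse (real (Suc j))) *\<^sub>R \<xi>" for j
  have "y \<longlonglongrightarrow> (1 + 0) *\<^sub>R \<xi>" unfolding y_def by (intro tendsto_intros LIMSEQ_inverse_real_of_nat)
  then have "(\<lambda>j. \<psi>0 (y j)) \<longlonglongrightarrow> \<psi>0 \<xi>"
    using continuous_on_tendsto_compose[OF smooth_fun_continuous_on[OF cutoff_smooth, of UNIV], of y
        \<xi>] by simp
  moreover have "\<psi>0 (y j) = 0" for j
  proof (rule out)
    have "0 < inverse (real (Suc j)) * norm \<xi>" using assms by (intro mult_pos_pos) auto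
    then have "norm \<xi> < (1 + inverse (real (Suc j))) * norm \<xi>" by (simp add: distrib_right)
    then show "2 < norm (y j)" using assms by (simp add: y_def)
  qed
  ultimately show ?thesis using LIMSEQ_unique[OF _ tendsto_const] by simp
qed

lemma cutoff_smooth_cc: "\<psi>0 \<in> smooth_cc"
  by (rule smooth_ccI[OF cutoff_smooth, of 2]) (auto intro: cutoff_eq_0)

lemma dyadic_piece_smooth_cc: "dyadic_piece \<psi>0 l \<in> smooth_cc"
proof (cases "l = 0")
  case False
  have e: "dyadic_piece \<psi>0 l = (\<lambda>\<xi>. \<psi>0 ((1 / 2 ^ l) *\<^sub>R \<xi>) - \<psi>0 ((2 / 2 ^ l) *\<^sub>R \<xi>))"
    using False by (simp add: dyadic_piece_def Let_def)
  show ?thesis unfolding e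
  proof (rule smooth_ccI)
    show "smooth_fun (\<lambda>\<xi>. \<psi>0 ((1 / 2 ^ l) *\<^sub>R \<xi>) - \<psi>0 ((2 / 2 ^ l) *\<^sub>R \<xi>))"
      using smooth_fun_affine[OF cutoff_smooth bounded_linear_scaleR_right, of _ 0]
      by (intro smooth_fun_diff) simp_all
    fix x :: 'a assume "2 * 2 ^ l < norm x"
    moreover have "(0::real) < 2 ^ l" by simp
    ultimately have "2 * 2 ^ l < norm x" "2 ^ l < norm x" by linarith+
    then show "\<psi>0 ((1 / 2 ^ l) *\<^sub>R x) - \<psi>0 ((2 / 2 ^ l) *\<^sub>R x) = 0"
      by (subst (1 2) cutoff_eq_0) (auto simp: field_simps)
  qed
qed (simp add: dyadic_piece_def cutoff_smooth_cc)

lemma dyadic_piece_bounded: obtains M where "0 \<le> M" "\<And>l \<xi>. cmod (dyadic_piece \<psi>0 l \<xi>) \<le> M"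
proof -
  obtain M where M: "0 \<le> M" "\<And>x. cmod (\<psi>0 x) \<le> M" using smooth_cc_bounded[OF cutoff_smooth_cc] by blast
  have "cmod (\<psi>0 x - \<psi>0 y) \<le> 2 * M" for x y
    using norm_triangle_ineq4[of "\<psi>0 x" "\<psi>0 y"] M(2)[of x] M(2)[of y] by linarith
  moreover have "cmod (\<psi>0 x) \<le> 2 * M" for x using M(2)[of x] M(1) by linarith
  ultimately have "cmod (dyadic_piece \<psi>0 l \<xi>) \<le> 2 * M" for l \<xi>
    by (simp add: dyadic_piece_def Let_def)
  then show ?thesis using that[of "2 * M"] M by auto
qed

text \<open>Above the annulus both terms of the difference vanish; below it both equal 1 and cancel.
  Block 0 has no inner bound.\<close>

lemma dyadic_piece_nonzero:
  assumes "dyadic_piece \<psi>0 l \<xi> \<noteq> 0"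
  shows "norm \<xi> \<le> 2 * 2 ^ l" and "l > 0 \<Longrightarrow> 2 ^ l < 2 * norm \<xi>"
proof -
  show "norm \<xi> \<le> 2 * 2 ^ l"
  proof (rule ccontr)
    assume a: "\<not> norm \<xi> \<le> 2 * 2 ^ l"
    moreover have "(0::real) < 2 ^ l" by simp
    ultimately have "2 * 2 ^ l < norm \<xi>" "2 ^ l < norm \<xi>" by linarith+
    then have "\<psi>0 ((1 / 2 ^ l) *\<^sub>R \<xi>) = 0" "\<psi>0 ((2 / 2 ^ l) *\<^sub>R \<xi>) = 0"
      by (auto intro!: cutoff_eq_0 simp: field_simps)
    then show False using assms by (auto simp: dyadic_piece_def Let_def split: if_splits)
  qed
  assume l: "l > 0"
  show "2 ^ l < 2 * norm \<xi>"
  proof (rule ccontr)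
    assume a: "\<not> 2 ^ l < 2 * norm \<xi>"
    then have "2 * norm \<xi> \<le> 2 ^ l" "norm \<xi> \<le> 2 ^ l" using norm_ge_zero[of \<xi>] by linarith+
    then have "\<psi>0 ((1 / 2 ^ l) *\<^sub>R \<xi>) = 1" "\<psi>0 ((2 / 2 ^ l) *\<^sub>R \<xi>) = 1"
      by (auto intro!: cutoff_eq_1 simp: field_simps)
    then show False using assms l by (auto simp: dyadic_piece_def Let_def split: if_splits)
  qed
qed

text \<open>The displacement 1 / 2 is absorbed because powers of two are at least 1. Together with
  the width of the annuli this leaves a distance of at most 2 between the indices, the window of
  \<open>besov_norm_le\<close>.\<close>

lemma dyadic_piece_at_frequency:
  assumes a: "at_frequency j a" and \<xi>: "norm (\<xi> - a) \<le> 1 / 2" and nz: "dyadic_piece \<psi>0 l \<xi> \<noteq> 0"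
  shows "j \<le> l + 2 \<and> l \<le> j + 2"
proof -
  have 1: "(1::real) \<le> 2 ^ k" for k by simp
  note n = dyadic_piece_nonzero[OF nz]
  have "norm \<xi> \<le> norm a + 1 / 2" using norm_triangle_ineq[of "\<xi> - a" a] \<xi> by simp
  also have "norm a \<le> 2 ^ j" using a by (auto simp: at_frequency_def)
  finally have u: "norm \<xi> \<le> 2 ^ j + 1 / 2" by simp
  have "l \<le> j + 2"
  proof (cases "l > 0")
    case True
    then have "2 ^ l < 2 * (2 ^ j + 1 / 2 :: real)" using n(2)[OF True] u by argo
    also have "\<dots> \<le> 4 * 2 ^ j" using 1[of j] by argo
    also have "\<dots> = 2 ^ (j + 2)" by simp
    finally have "l < j + 2" by (rule power_less_imp_less_exp[rotated]) simp
    then show ?thesis by simp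
  qed simp
  moreover have "j \<le> l + 2"
  proof (cases "a = 0 \<and> j = 0")
    case False
    then have "norm a = 2 ^ j" using a by (auto simp: at_frequency_def)
    moreover have "norm a \<le> norm \<xi> + 1 / 2"
      using norm_triangle_ineq[of \<xi> "a - \<xi>"] \<xi> by (simp add: norm_minus_commute)
    ultimately have "2 ^ j \<le> 2 * 2 ^ l + (1 / 2 :: real)" using n(1) by linarith
    also have "\<dots> \<le> 4 * 2 ^ l" using 1[of l] by linarith
    also have "\<dots> = 2 ^ (l + 2)" by simp
    finally show ?thesis by (rule power_le_imp_le_exp[rotated]) simp
  qed auto
  ultimately show ?thesis by simp
qed

text \<open>All dyadic pieces share one sup bound, and multiplying by them does not enlarge the
  support of the translated bump. The transforms are thus bounded by \<open>M * M'\<close> on a ball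
  of radius 1 / 2 about \<open>a\<close>, which makes \<open>K\<close> uniform in the block,
  \<open>j\<close> and \<open>a\<close>.\<close>

lemma besov_norm_modulated_le:
  assumes p: "2 \<le> p" and q: "0 < q" and \<theta>: "\<theta> \<in> smooth_cc" and sup: "\<And>\<xi>. 1 / 2 < norm \<xi> \<Longrightarrow> \<theta> \<xi> = 0"
  obtains K where "0 \<le> K"
    "\<And>j a. at_frequency j a \<Longrightarrow> besov_norm \<psi>0 s p q (inv_fourier (\<lambda>\<xi>. \<theta> (\<xi> - a))) \<le> ennreal (K
        * 2 powr (real j * s))"
proof -
  obtain M where M: "0 \<le> M" "\<And>l \<xi>. cmod (dyadic_piece \<psi>0 l \<xi>) \<le> M" using dyadic_piece_bounded by blast
  obtain M' where M': "0 \<le> M'" "\<And>\<xi>. cmod (\<theta> \<xi>) \<le> M'" using smooth_cc_bounded[OF \<theta>] by blast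
  obtain K where K: "0 \<le> K"
    "\<And>F a. F \<in> smooth_cc \<Longrightarrow> (\<And>x. cmod (F x) \<le> M * M') \<Longrightarrow> (\<And>x. 1 / 2 < norm (x - a) \<Longrightarrow> F x = 0)
        \<Longrightarrow> Lp_norm p (inv_fourier (F :: 'a \<Rightarrow> complex)) \<le> ennreal K"
    using Lp_norm_inv_fourier_le[OF p, of "M * M'" "1 / 2"] M M' by auto
  show ?thesis
  proof (rule that[of "5 powr (1 / enn2real q) * (2 powr (2 * \<bar>s\<bar>) * K)"])
    fix j and a :: 'a assume a: "at_frequency j a"
    define F where "F l \<xi> = dyadic_piece \<psi>0 l \<xi> * \<theta> (\<xi> - a)" for l \<xi>
    have e: "multiplier_op (dyadic_piece \<psi>0 l) (inv_fourier (\<lambda>\<xi>. \<theta> (\<xi> - a))) = inv_fourier (F l)" for l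
      unfolding multiplier_op_def fourier_inv_fourier_smooth_cc[OF smooth_cc_translate[OF \<theta>]] F_def ..
    show "besov_norm \<psi>0 s p q (inv_fourier (\<lambda>\<xi>. \<theta> (\<xi> - a))) \<le> ennreal (5 powr (1 / enn2real q)
        * (2 powr (2 * \<bar>s\<bar>) * K) * 2 powr (real j * s))"
    proof (rule besov_norm_le[OF q K(1)])
      fix l
      show "Lp_norm p (multiplier_op (dyadic_piece \<psi>0 l) (inv_fourier (\<lambda>\<xi>. \<theta> (\<xi> - a)))) \<le> ennreal K"
        unfolding e
      proof (rule K(2)[where a=a])
        show "F l \<in> smooth_cc" unfolding F_def[abs_def]
          using dyadic_piece_smooth_cc[of l] by (intro smooth_cc_mult smooth_cc_translate \<theta>) (simp
              add: smooth_cc_def)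
        show "cmod (F l x) \<le> M * M'" for x unfolding F_def norm_mult
            by (intro mult_mono M M' norm_ge_zero)
      qed (simp add: F_def sup)
      assume "\<not> (j \<le> l + 2 \<and> l \<le> j + 2)"
      then have "F l \<xi> = 0" for \<xi>
        using dyadic_piece_at_frequency[OF a, of \<xi> l] sup[of "\<xi> - a"] unfolding F_def by fastforce
      then have "inv_fourier (F l) = (\<lambda>x. 0)" by (simp add: inv_fourier_def[abs_def])
      moreover have "0 < p" using p by (rule less_le_trans[rotated]) simp
      ultimately show "Lp_norm p (multiplier_op (dyadic_piece \<psi>0 l) (inv_fourier (\<lambda>\<xi>. \<theta> (\<xi> - a)))) = 0"
        unfolding e using Lp_norm_zero by simp
    qed
  qed (use K in simp)
qed

end

subsection \<open>Lower bounds and exponent conditions\<close>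

text \<open>Fatou bounds the integrals of \<open>G j\<close> from below in the limit. The conclusion
  speaks of any \<open>f\<close> with modulus \<open>A\<close> times that of \<open>G j\<close>, so
  it applies to the output with its modulation and its power of two still present.\<close>

lemma Lp_norm_liminf_pos:
  fixes G :: "nat \<Rightarrow> 'a::euclidean_space \<Rightarrow> complex"
  assumes p: "1 \<le> p" "p \<le> 2" and [measurable]: "\<And>j. G j \<in> borel_measurable borel" "g \<in>
      borel_measurable borel"
    and lim: "\<And>x. (\<lambda>j. G j x) \<longlonglongrightarrow> g x" and nz: "\<not> (AE x in lborel. g x = 0)"
  obtains c where "0 < c"
    "eventually (\<lambda>j. \<forall>A f. 0 \<le> A \<longrightarrow> (\<forall>x. cmod (f x) = A * cmod (G j x)) \<longrightarrow> ennreal (c * A)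
        \<le> Lp_norm p f) sequentially"
proof -
  define r where "r = enn2real p"
  have pinf: "p \<noteq> \<infinity>" using p(2) by (auto simp: top_unique)
  have r: "r \<ge> 1" using p pinf by (cases p) (auto simp: r_def)
  define I where "I = (\<integral>\<^sup>+x. ennreal (cmod (g x) powr r) \<partial>lborel)"
  have "I \<noteq> 0"
  proof
    assume "I = 0"
    then have "AE x in lborel. ennreal (cmod (g x) powr r) = 0" unfolding I_def
        by (subst (asm) nn_integral_0_iff_AE) auto
    then have "AE x in lborel. g x = 0" by eventually_elim (use r in auto)
    with nz show False by simp
  qed
  \<comment> \<open>\<open>I\<close> may be infinite, hence a finite positive number strictly below
    it.\<close>
  then obtain x where x: "0 < x" "x < I" using dense[of 0 I] by (auto simp: zero_less_iff_neq_zero)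
  define \<delta> where "\<delta> = enn2real x"
  have \<delta>: "0 < \<delta>" "ennreal \<delta> < I"
    using x less_trans[OF x(2), of top] by (cases x; auto simp: \<delta>_def top.not_eq_extremum[symmetric])+
  have "I = (\<integral>\<^sup>+x. liminf (\<lambda>j. ennreal (cmod (G j x) powr r)) \<partial>lborel)"
    unfolding I_def
  proof (intro nn_integral_cong)
    fix x
    have "(\<lambda>j. ennreal (cmod (G j x) powr r)) \<longlonglongrightarrow> ennreal (cmod (g x) powr r)"
      using r by (intro tendsto_ennrealI tendsto_powr2 tendsto_norm lim tendsto_const) auto
    then show "ennreal (cmod (g x) powr r) = liminf (\<lambda>j. ennreal (cmod (G j x) powr r))"
      by (intro lim_imp_Liminf[symmetric]) auto
  qed
  also have "\<dots> \<le> liminf (\<lambda>j. \<integral>\<^sup>+x. ennreal (cmod (G j x) powr r) \<partial>lborel)"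
    by (rule nn_integral_liminf) auto
  finally have "ennreal \<delta> < liminf (\<lambda>j. \<integral>\<^sup>+x. ennreal (cmod (G j x) powr r) \<partial>lborel)"
    using \<delta>(2) by (rule less_le_trans[rotated])
  then have ev: "eventually (\<lambda>j. ennreal \<delta> < (\<integral>\<^sup>+x. ennreal (cmod (G j x) powr r) \<partial>lborel)) sequentially"
    by (rule less_LiminfD)
  show ?thesis
  proof (rule that[of "\<delta> powr (1 / r)"])
    show "0 < \<delta> powr (1 / r)" using \<delta> by simp
    show "eventually (\<lambda>j. \<forall>A f. 0 \<le> A \<longrightarrow> (\<forall>x. cmod (f x) = A * cmod (G j x)) \<longrightarrow> ennreal (\<delta> powr (1 / r)
        * A) \<le> Lp_norm p f) sequentially"
      using ev
    proof (eventually_elim, intro allI impI)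
      fix j A and f :: "'a \<Rightarrow> complex"
      assume j: "ennreal \<delta> < (\<integral>\<^sup>+x. ennreal (cmod (G j x) powr r) \<partial>lborel)" and A: "0 \<le> A"
          and f: "\<forall>x. cmod (f x) = A * cmod (G j x)"
      have "ennreal (A powr r * \<delta>) = ennreal (A powr r) * ennreal \<delta>" using \<delta> by (simp add: ennreal_mult)
      also have "\<dots> \<le> ennreal (A powr r) * (\<integral>\<^sup>+x. ennreal (cmod (G j x) powr r) \<partial>lborel)"
        using j by (intro mult_left_mono) auto
      also have "\<dots> = (\<integral>\<^sup>+x. ennreal (A powr r) * ennreal (cmod (G j x) powr r) \<partial>lborel)"
        by (rule nn_integral_cmult[symmetric]) auto
      also have "\<dots> = (\<integral>\<^sup>+x. ennreal (cmod (f x) powr r) \<partial>lborel)"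
        using A f by (intro nn_integral_cong) (simp add: ennreal_mult[symmetric] powr_mult)
      finally have "ennpowr (ennreal (A powr r * \<delta>)) (1 / r) \<le> Lp_norm p f"
        using pinf r unfolding Lp_norm_def r_def[symmetric] by (auto intro!: ennpowr_mono)
      moreover have "(A powr r * \<delta>) powr (1 / r) = \<delta> powr (1 / r) * A"
        using A \<delta> r by (simp add: powr_mult powr_powr)
      ultimately show "ennreal (\<delta> powr (1 / r) * A) \<le> Lp_norm p f"
        using \<delta> by (simp add: ennpowr_ennreal)
    qed
  qed
qed

text \<open>If the transform vanished almost everywhere, inversion would give the value 0 to \<eta>
  at the origin.\<close>

lemma inv_fourier_not_AE_zero:
  assumes "\<eta> \<in> smooth_cc" "\<eta> 0 \<noteq> 0" shows "\<not> (AE x in lborel. inv_fourier \<eta> x = 0)"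
proof
  assume a: "AE x in lborel. inv_fourier \<eta> x = 0"
  have "fourier (inv_fourier \<eta>) 0 = 0" unfolding fourier_def
    by (rule integral_eq_zero_AE) (use a in \<open>eventually_elim, simp\<close>)
  then show False using fourier_inv_fourier_smooth_cc[OF assms(1)] assms(2) by simp
qed

context
  fixes \<psi>0 :: "'a::euclidean_space \<Rightarrow> complex"
  assumes cutoff: "besov_cutoff \<psi>0"
begin

text \<open>One block of the output is bounded below and the inputs above, with constants
  independent of \<open>j\<close>. The bumps \<theta>1, \<theta>2 are kept apart from \<eta>: a
  weight that survives in the limit can be built into them, while the limit remains a tensor
  square.\<close>

lemma frequency_estimate:
  fixes \<tau> :: "'a \<times> 'a \<Rightarrow> complex" and \<theta>1 \<theta>2 \<eta> :: "'a \<Rightarrow> complex"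
  assumes p: "1 \<le> p" "p \<le> 2" "2 \<le> p1" "2 \<le> p2" "2 \<le> p1'" "2 \<le> p2'"
    and q: "0 < q" "0 < q1" "0 < q2" "0 < q1'" "0 < q2'"
    and \<theta>1: "\<theta>1 \<in> smooth_cc" "\<And>\<xi>. 1 / 2 < norm \<xi> \<Longrightarrow> \<theta>1 \<xi> = 0"
    and \<theta>2: "\<theta>2 \<in> smooth_cc" "\<And>\<xi>. 1 / 2 < norm \<xi> \<Longrightarrow> \<theta>2 \<xi> = 0"
    and \<eta>: "\<eta> \<in> smooth_cc" "\<And>\<xi>. 1 / 2 < norm \<xi> \<Longrightarrow> \<eta> \<xi> = 0" "\<eta> 0 \<noteq> 0"
    and \<tau>: "smooth_fun \<tau>" and \<kappa>: "\<kappa> \<noteq> 0"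
    and freq: "\<And>j. at_frequency (\<alpha> j) (a j)" "\<And>j. at_frequency (\<beta> j) (b j)"
    and bd: "\<And>j z. norm (fst z) \<le> 1 / 2 \<Longrightarrow> norm (snd z) \<le> 1 / 2 \<Longrightarrow>
        2 powr (- (real j * \<mu>)) * cmod (\<tau> (fst z + a j, snd z + b j)) \<le> M"
    and lim: "\<And>z. norm (fst z) \<le> 1 / 2 \<Longrightarrow> norm (snd z) \<le> 1 / 2 \<Longrightarrow>
        (\<lambda>j. dyadic_piece \<psi>0 (l j) (fst z + snd z + (a j + b j)) *
             (of_real (2 powr (- (real j * \<mu>))) * \<tau> (fst z + a j, snd z + b j)) * (\<theta>1 (fst z)
                 * \<theta>2 (snd z)))
        \<longlonglongrightarrow> \<kappa> * (\<eta> (fst z) * \<eta> (snd z))"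
    and C: "0 < C" and hyp: "\<And>f1 f2. f1 \<in> schwartz \<Longrightarrow> f2 \<in> schwartz \<Longrightarrow>
        besov_norm \<psi>0 s p q (bilinear_op (\<lambda>z. \<tau> (snd z)) f1 f2)
        \<le> ennreal C * (besov_norm \<psi>0 s1 p1 q1 f1 * besov_norm \<psi>0 s2 p2 q2 f2
                      + besov_norm \<psi>0 s1' p1' q1' f1 * besov_norm \<psi>0 s2' p2' q2' f2)"
  obtains c D where "0 < c" "0 \<le> D"
    "eventually (\<lambda>j. c * (2 powr (real j * \<mu>) * 2 powr (real (l j) * s))
      \<le> D * (2 powr (real (\<alpha> j) * s1) * 2 powr (real (\<beta> j) * s2) + 2 powr (real (\<alpha> j) * s1')
          * 2 powr (real (\<beta> j) * s2'))) sequentially"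
proof -
  let ?m = "\<lambda>j. dyadic_piece \<psi>0 (l j)"
  let ?k = "complex_of_real (1 / (2 * pi) ^ (2 * DIM('a)))"
  \<comment> \<open>The normalising power is part of \<open>P\<close>, so that \<open>P\<close> has
    a limit; it is put back when the output is measured.\<close>
  define P where "P j z = ?m j (fst z + snd z + (a j + b j)) *
      (of_real (2 powr (- (real j * \<mu>))) * \<tau> (fst z + a j, snd z + b j)) * (\<theta>1 (fst z) * \<theta>2 (snd z))"
          for j z
  define G where "G j x = (LINT z|lborel. cis (x \<bullet> (fst z + snd z)) * P j z)" for j x
  define g where "g x = (LINT z|lborel. cis (x \<bullet> (fst z + snd z)) * (\<kappa> * (\<eta> (fst z) * \<eta> (snd z))))" for x
  have smP: "smooth_fun (P j)" for j
  proof -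
    have "bounded_linear (\<lambda>z::'a \<times> 'a. fst z + snd z)"
      by (intro bounded_linear_add bounded_linear_fst bounded_linear_snd)
    then have 1: "smooth_fun (\<lambda>z. ?m j (fst z + snd z + (a j + b j)))"
      using dyadic_piece_smooth_cc[OF cutoff, of "l j"] by (intro smooth_fun_affine) (auto simp:
          smooth_cc_def)
    have 2: "smooth_fun (\<lambda>z. \<tau> (fst z + a j, snd z + b j))"
      using smooth_fun_affine[OF \<tau> bounded_linear_ident, of "(a j, b j)"] by (simp add: plus_prod_def)
    have 3: "smooth_fun (\<lambda>z. \<theta>1 (fst z) * \<theta>2 (snd z))"
      using smooth_cc_tensor[OF \<theta>1(1) \<theta>2(1)] by (simp add: smooth_cc_def)
    show ?thesis unfolding P_def
      by (rule smooth_fun_mult[OF smooth_fun_mult[OF 1 smooth_fun_mult[OF smooth_fun_const 2]] 3])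
  qed
  have mP[measurable]: "P j \<in> borel_measurable borel" for j
    by (intro borel_measurable_continuous_onI smooth_fun_continuous_on smP)
  obtain M1 where M1: "0 \<le> M1" "\<And>l \<xi>. cmod (dyadic_piece \<psi>0 l \<xi>) \<le> M1"
      using dyadic_piece_bounded[OF cutoff] by blast
  obtain M2 where M2: "0 \<le> M2" "\<And>\<xi>. cmod (\<theta>1 \<xi>) \<le> M2" using smooth_cc_bounded[OF \<theta>1(1)] by blast
  obtain M3 where M3: "0 \<le> M3" "\<And>\<xi>. cmod (\<theta>2 \<xi>) \<le> M3" using smooth_cc_bounded[OF \<theta>2(1)] by blast
  have M: "0 \<le> M" using bd[of "(0, 0)" 0] by (rule order_trans[rotated]) auto
  have Pb: "cmod (P j z) \<le> M1 * M * (M2 * M3) * indicator (cball 0 1) z" for j z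
  proof (cases "norm (fst z) \<le> 1 / 2 \<and> norm (snd z) \<le> 1 / 2")
    case True
    then have "norm z \<le> 1" using norm_Pair_le[of "fst z" "snd z"] by simp
    moreover have "cmod (P j z) \<le> M1 * M * (M2 * M3)"
      unfolding P_def norm_mult using bd[of z j] True
      by (intro mult_mono M1 M2 M3 mult_nonneg_nonneg norm_ge_zero M) auto
    ultimately show ?thesis by simp
  next
    case False
    then have "P j z = 0" using \<theta>1(2) \<theta>2(2) by (auto simp: P_def not_le)
    then show ?thesis using M M1 M2 M3 by simp
  qed
  have Plim: "(\<lambda>j. P j z) \<longlonglongrightarrow> \<kappa> * (\<eta> (fst z) * \<eta> (snd z))" for z
  proof (cases "norm (fst z) \<le> 1 / 2 \<and> norm (snd z) \<le> 1 / 2")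
    case True
    then show ?thesis using lim unfolding P_def by blast
  next
    case False
    then have "P j z = 0" for j using \<theta>1(2) \<theta>2(2) by (auto simp: P_def not_le)
    moreover have "\<eta> (fst z) * \<eta> (snd z) = 0" using False \<eta>(2) by (auto simp: not_le)
    ultimately show ?thesis by (simp only: mult_zero_right tendsto_const)
  qed
  have \<eta>\<eta>: "(\<lambda>z. \<eta> (fst z) * \<eta> (snd z)) \<in> smooth_cc" by (rule smooth_cc_tensor[OF \<eta>(1) \<eta>(1)])
  have [measurable]: "(\<lambda>z. \<eta> (fst z) * \<eta> (snd z)) \<in> borel_measurable borel"
      by (rule smooth_cc_measurable[OF \<eta>\<eta>])
  have mc[measurable]: "(\<lambda>z::'a \<times> 'a. cis (x \<bullet> (fst z + snd z))) \<in> borel_measurable borel" for x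
    by (intro borel_measurable_cis borel_measurable_continuous_onI continuous_intros)
  have Glim: "(\<lambda>j. G j x) \<longlonglongrightarrow> g x" for x
    unfolding G_def g_def
  proof (rule integral_dominated_convergence[where w="\<lambda>z. M1 * M * (M2 * M3) * indicator (cball 0 1) z"])
    show "integrable lborel (\<lambda>z::'a \<times> 'a. M1 * M * (M2 * M3) * indicator (cball 0 1) z :: real)"
      by (intro integrable_mult_right integrable_indicator_cball)
    show "AE z in lborel. (\<lambda>j. cis (x \<bullet> (fst z + snd z)) * P j z) \<longlonglongrightarrow> cis (x \<bullet> (fst z + snd z)) * (\<kappa>
        * (\<eta> (fst z) * \<eta> (snd z)))"
      by (intro AE_I2 tendsto_mult tendsto_const Plim)
    show "AE z in lborel. norm (cis (x \<bullet> (fst z + snd z)) * P j z) \<le> M1 * M * (M2 * M3) * indicator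
        (cball 0 1) z" for j
      using Pb by (auto simp: norm_mult)
  qed auto
  \<comment> \<open>The limit is a tensor product and the phase is a sum, so Fubini factorises the
    integral into two equal transforms.\<close>
  have geq: "g x = \<kappa> * (of_real ((2 * pi) ^ DIM('a)) * inv_fourier \<eta> x)\<^sup>2" for x
  proof -
    have i: "integrable lborel (\<lambda>z. cis (x \<bullet> (fst z + snd z)) * (\<eta> (fst z) * \<eta> (snd z)))"
      by (rule integrable_cis_mult[OF smooth_cc_integrable[OF \<eta>\<eta>]])
         (intro borel_measurable_continuous_onI continuous_intros)
    have "g x = (LINT z|lborel. \<kappa> * (cis (x \<bullet> (fst z + snd z)) * (\<eta> (fst z) * \<eta> (snd z))))"
      unfolding g_def by (simp add: mult_ac)
    also have "\<dots> = \<kappa> * (LINT z|lborel. cis (x \<bullet> (fst z + snd z)) * (\<eta> (fst z) * \<eta> (snd z)))" by simp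
    also have "(LINT z|lborel. cis (x \<bullet> (fst z + snd z)) * (\<eta> (fst z) * \<eta> (snd z)))
       = (LINT u|lborel. LINT v|lborel. (cis (x \<bullet> u) * \<eta> u) * (cis (x \<bullet> v) * \<eta> v))"
      unfolding integral_lborel_pair(1)[OF i] by (simp add: inner_add_right cis_mult[symmetric] mult_ac)
    also have "\<dots> = (LINT u|lborel. cis (x \<bullet> u) * \<eta> u) * (LINT v|lborel. cis (x \<bullet> v) * \<eta> v)" by simp
    also have "(LINT u|lborel. cis (x \<bullet> u) * \<eta> u) = of_real ((2 * pi) ^ DIM('a)) * inv_fourier \<eta> x"
      by (simp add: inv_fourier_def)
    finally show ?thesis by (simp add: power2_eq_square)
  qed
  have nz: "\<not> (AE x in lborel. g x = 0)"
  proof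
    assume "AE x in lborel. g x = 0"
    then have "AE x in lborel. inv_fourier \<eta> x = 0"
      by eventually_elim (use \<kappa> in \<open>simp add: geq\<close>)
    then show False using inv_fourier_not_AE_zero[OF \<eta>(1,3)] by simp
  qed
  have mG: "G j \<in> borel_measurable borel" for j
  proof -
    have [measurable]: "(\<lambda>(x, z). cis (x \<bullet> (fst z + snd z)) * P j z) \<in> borel_measurable (lborel \<Otimes>\<^sub>M
        (lborel :: ('a \<times> 'a) measure))"
    proof -
      have "continuous_on UNIV (\<lambda>w. cis (fst w \<bullet> (fst (snd w) + snd (snd w))) * P j (snd w))"
        unfolding cis_conv_exp
        by (intro continuous_intros continuous_on_compose2[OF smooth_fun_continuous_on[OF smP, of
            UNIV]]) auto
      from borel_measurable_continuous_onI[OF this] show ?thesis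
        by (simp add: lborel_prod case_prod_unfold)
    qed
    have "G j \<in> borel_measurable lborel" unfolding G_def by measurable
    then show ?thesis by simp
  qed
  have mg: "g \<in> borel_measurable borel"
    unfolding geq[abs_def] using smooth_cc_measurable[OF \<eta>(1)] by measurable
  obtain c where c: "0 < c" "eventually (\<lambda>j. \<forall>A f. 0 \<le> A \<longrightarrow> (\<forall>x. cmod (f x) = A * cmod (G j x))
      \<longrightarrow> ennreal (c * A) \<le> Lp_norm p f) sequentially"
    using Lp_norm_liminf_pos[OF p(1,2) mG mg Glim nz] by blast
  obtain K1 where K1: "0 \<le> K1" "\<And>j a. at_frequency j a \<Longrightarrow> besov_norm \<psi>0 s1 p1 q1 (inv_fourier (\<lambda>\<xi>. \<theta>1
      (\<xi> - a))) \<le> ennreal (K1 * 2 powr (real j * s1))"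
    using besov_norm_modulated_le[OF cutoff p(3) q(2) \<theta>1] by blast
  obtain K2 where K2: "0 \<le> K2" "\<And>j a. at_frequency j a \<Longrightarrow> besov_norm \<psi>0 s2 p2 q2 (inv_fourier (\<lambda>\<xi>. \<theta>2
      (\<xi> - a))) \<le> ennreal (K2 * 2 powr (real j * s2))"
    using besov_norm_modulated_le[OF cutoff p(4) q(3) \<theta>2] by blast
  obtain K3 where K3: "0 \<le> K3" "\<And>j a. at_frequency j a \<Longrightarrow> besov_norm \<psi>0 s1' p1' q1' (inv_fourier (\<lambda>\<xi>.
      \<theta>1 (\<xi> - a))) \<le> ennreal (K3 * 2 powr (real j * s1'))"
    using besov_norm_modulated_le[OF cutoff p(5) q(4) \<theta>1] by blast
  obtain K4 where K4: "0 \<le> K4" "\<And>j a. at_frequency j a \<Longrightarrow> besov_norm \<psi>0 s2' p2' q2' (inv_fourier (\<lambda>\<xi>.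
      \<theta>2 (\<xi> - a))) \<le> ennreal (K4 * 2 powr (real j * s2'))"
    using besov_norm_modulated_le[OF cutoff p(6) q(5) \<theta>2] by blast
  define D where "D = C * (K1 * K2 + K3 * K4)"
  define k where "k = 1 / (2 * pi) ^ (2 * DIM('a))"
  have k: "k > 0" by (simp add: k_def)
  show ?thesis
  proof (rule that[of "c * k" D])
    show "0 < c * k" using c k by simp
    show "0 \<le> D" using C K1 K2 K3 K4 by (simp add: D_def)
    show "eventually (\<lambda>j. c * k * (2 powr (real j * \<mu>) * 2 powr (real (l j) * s))
      \<le> D * (2 powr (real (\<alpha> j) * s1) * 2 powr (real (\<beta> j) * s2) + 2 powr (real (\<alpha> j) * s1')
          * 2 powr (real (\<beta> j) * s2'))) sequentially"
      using c(2)
    proof eventually_elim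
      case (elim j)
      define f1 where "f1 = inv_fourier (\<lambda>\<xi>. \<theta>1 (\<xi> - a j))"
      define f2 where "f2 = inv_fourier (\<lambda>\<xi>. \<theta>2 (\<xi> - b j))"
      define T where "T = bilinear_op (\<lambda>z. \<tau> (snd z)) f1 f2"
      define x1 where "x1 = 2 powr (real (\<alpha> j) * s1)"
      define x2 where "x2 = 2 powr (real (\<beta> j) * s2)"
      define x3 where "x3 = 2 powr (real (\<alpha> j) * s1')"
      define x4 where "x4 = 2 powr (real (\<beta> j) * s2')"
      have x: "0 \<le> x1" "0 \<le> x2" "0 \<le> x3" "0 \<le> x4" by (simp_all add: x1_def x2_def x3_def x4_def)
      \<comment> \<open>The modulation by \<open>a j + b j\<close> has modulus one; only the
        constant, the power of two and \<open>G j\<close> are left.\<close>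
      have T: "cmod (multiplier_op (?m j) T x) = (k * 2 powr (real j * \<mu>)) * cmod (G j x)" for x
      proof -
        have PP: "?m j (fst z + snd z + (a j + b j)) * \<tau> (fst z + a j, snd z + b j) * (\<theta>1 (fst z)
            * \<theta>2 (snd z)) = of_real (2 powr (real j * \<mu>)) * P j z" for z
        proof -
          have "complex_of_real (2 powr (real j * \<mu>)) * of_real (2 powr (- (real j * \<mu>))) = 1"
            by (simp add: of_real_mult[symmetric] powr_add[symmetric] del: of_real_mult)
          then show ?thesis unfolding P_def by (simp add: mult_ac)
        qed
        have "multiplier_op (?m j) T x = ?k * (cis (x \<bullet> (a j + b j)) * (LINT z|lborel. cis (x \<bullet> (fst z
            + snd z)) * (of_real (2 powr (real j * \<mu>)) * P j z)))"
          unfolding T_def f1_def f2_def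
          by (subst multiplier_op_bilinear_op[OF \<theta>1(1) \<theta>2(1) dyadic_piece_smooth_cc[OF cutoff] \<tau>])
              (simp only: PP)
        also have "\<dots> = ?k * (cis (x \<bullet> (a j + b j)) * (of_real (2 powr (real j * \<mu>)) * G j x))"
          unfolding G_def by (simp add: mult.left_commute[of "cis _"])
        finally show ?thesis using k by (simp add: norm_mult k_def norm_divide norm_power)
      qed
      have "ennreal (c * k * (2 powr (real j * \<mu>) * 2 powr (real (l j) * s)))
          = ennreal (2 powr (real (l j) * s)) * ennreal (c * (k * 2 powr (real j * \<mu>)))"
        using c k by (simp add: ennreal_mult[symmetric] mult_ac)
      also have "\<dots> \<le> ennreal (2 powr (real (l j) * s)) * Lp_norm p (multiplier_op (?m j) T)"
        using elim T k by (intro mult_left_mono) auto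
      also have "\<dots> \<le> besov_norm \<psi>0 s p q T" by (rule besov_norm_ge[OF q(1)])
      also have "\<dots> \<le> ennreal C * (besov_norm \<psi>0 s1 p1 q1 f1 * besov_norm \<psi>0 s2 p2 q2 f2
                      + besov_norm \<psi>0 s1' p1' q1' f1 * besov_norm \<psi>0 s2' p2' q2' f2)"
        unfolding T_def by (rule hyp) (auto simp: f1_def f2_def intro!: inv_fourier_schwartz
            smooth_cc_translate \<theta>1 \<theta>2)
      also have "\<dots> \<le> ennreal C * (ennreal (K1 * x1) * ennreal (K2 * x2) + ennreal (K3 * x3)
          * ennreal (K4 * x4))"
        unfolding f1_def f2_def x1_def x2_def x3_def x4_def
            by (intro mult_left_mono add_mono mult_mono K1(2) K2(2) K3(2) K4(2) freq) auto
      also have "\<dots> = ennreal (C * (K1 * x1 * (K2 * x2) + K3 * x3 * (K4 * x4)))"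
        using C K1(1) K2(1) K3(1) K4(1) x
            by (simp add: ennreal_mult[symmetric] ennreal_plus[symmetric] del: ennreal_plus)
      finally have "c * k * (2 powr (real j * \<mu>) * 2 powr (real (l j) * s)) \<le> C * (K1 * x1 * (K2 * x2)
          + K3 * x3 * (K4 * x4))"
        using C K1(1) K2(1) K3(1) K4(1) x by (subst (asm) ennreal_le_iff) auto
      also have "\<dots> = C * ((K1 * K2) * (x1 * x2) + (K3 * K4) * (x3 * x4))" by (simp add: mult_ac)
      \<comment> \<open>The nonnegative cross terms are added, which yields a single constant in
        front of both products.\<close>
      also have "\<dots> \<le> C * ((K1 * K2 + K3 * K4) * (x1 * x2 + x3 * x4))"
        using C K1(1) K2(1) K3(1) K4(1) x by (intro mult_left_mono) (auto simp: algebra_simps)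
      finally show ?case by (simp add: D_def x1_def x2_def x3_def x4_def mult.assoc)
    qed
  qed
qed

end

text \<open>After division by \<open>2 powr (real j * x)\<close> the right side would tend to 0 if
  \<open>x\<close> exceeded both exponents, while the left side is the positive constant
  \<open>c\<close>.\<close>

lemma exponent_le_max:
  fixes x y y' :: real
  assumes c: "0 < c" and ev: "eventually (\<lambda>j. c * 2 powr (real j * x) \<le> D * (2 powr (real j * y)
      + 2 powr (real j * y'))) sequentially"
  shows "x \<le> max y y'"
proof (rule ccontr)
  assume a: "\<not> x \<le> max y y'"
  have z: "(\<lambda>j. 2 powr (real j * (w - x))) \<longlonglongrightarrow> 0" if "w < x" for w
  proof -
    have "(\<lambda>j. (2 powr (w - x)) ^ j) \<longlonglongrightarrow> 0"
      using that by (intro LIMSEQ_realpow_zero) (auto simp: powr_less_one)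
    then show ?thesis by (simp add: powr_power mult.commute)
  qed
  have "(\<lambda>j. D * (2 powr (real j * (y - x)) + 2 powr (real j * (y' - x)))) \<longlonglongrightarrow> D * (0 + 0)"
    using a by (intro tendsto_intros z) auto
  moreover have "eventually (\<lambda>j. c \<le> D * (2 powr (real j * (y - x)) + 2 powr (real j * (y'
      - x)))) sequentially"
    using ev
  proof eventually_elim
    case (elim j)
    have "c * 2 powr (real j * x) * 2 powr (- (real j * x)) \<le> D * (2 powr (real j * y) + 2 powr (real
        j * y')) * 2 powr (- (real j * x))"
      using elim by (rule mult_right_mono) simp
    then show ?case by (simp add: distrib_right mult.assoc powr_add[symmetric] right_diff_distrib)
  qed
  ultimately have "c \<le> D * (0 + 0)" using tendsto_lowerbound trivial_limit_sequentially by blast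
  then show False using c by simp
qed

text \<open>Pulling the power of two into the bracket replaces 1 by the square of t = 2^-j and the
  point by t z + u. The limit and the uniform bound can both be read off from this form.\<close>

lemma bessel_rescaled:
  "2 powr (- (real j * m)) * bessel m (z + 2 ^ j *\<^sub>R u) = ((1 / 2 ^ j)\<^sup>2 + (norm ((1 / 2 ^ j) *\<^sub>R z
      + u))\<^sup>2) powr (m / 2)"
proof -
  define t :: real where "t = 1 / 2 ^ j"
  have t: "t > 0" by (simp add: t_def)
  have "t = 2 powr (- real j)" by (simp add: t_def powr_minus powr_realpow inverse_eq_divide)
  then have tm: "2 powr (- (real j * m)) = (t\<^sup>2) powr (m / 2)"
    using t by (simp add: powr_realpow_2[symmetric] powr_powr del: powr_numeral)
  have "(1 / 2 ^ j) *\<^sub>R z + u = t *\<^sub>R (z + 2 ^ j *\<^sub>R u)" by (simp add: t_def scaleR_add_right)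
  then have "(norm ((1 / 2 ^ j) *\<^sub>R z + u))\<^sup>2 = t\<^sup>2 * (norm (z + 2 ^ j *\<^sub>R u))\<^sup>2"
    using t by (simp add: power_mult_distrib)
  then show ?thesis
    unfolding tm bessel_def t_def[symmetric] by (simp add: powr_mult[symmetric] distrib_left)
qed

text \<open>A nonzero \<open>u\<close> keeps the limit of the base positive, where real powers are
  continuous.\<close>

lemma bessel_rescaled_tendsto:
  assumes "u \<noteq> 0"
  shows "(\<lambda>j. 2 powr (- (real j * m)) * bessel m (z + 2 ^ j *\<^sub>R u)) \<longlonglongrightarrow> norm u powr m"
proof -
  have t: "(\<lambda>j. 1 / 2 ^ j :: real) \<longlonglongrightarrow> 0"
    using LIMSEQ_realpow_zero[of "1 / 2 :: real"] by (simp add: power_one_over)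
  have "(\<lambda>j. ((1 / 2 ^ j)\<^sup>2 + (norm ((1 / 2 ^ j) *\<^sub>R z + u))\<^sup>2) powr (m / 2)) \<longlonglongrightarrow> (0\<^sup>2 + (norm (0 *\<^sub>R z
      + u))\<^sup>2) powr (m / 2)"
    by (intro tendsto_powr tendsto_intros t) (use assms in auto)
  also have "(0\<^sup>2 + (norm (0 *\<^sub>R z + u))\<^sup>2) powr (m / 2) = norm u powr m"
    using assms by (simp add: powr_realpow_2[symmetric] powr_powr del: powr_numeral)
  finally show ?thesis by (simp only: bessel_rescaled)
qed

text \<open>With t = 2^-j the base stays between \<open>A\<close> and \<open>B\<close>: for t up to
  |u| / 2 the point t z + u has norm at least |u| / 2, and for larger t the term t^2 alone exceeds
  \<open>A\<close>. \<open>B\<close> serves nonnegative orders and \<open>A\<close> negative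
  ones.\<close>

lemma bessel_rescaled_bounded:
  assumes u: "u \<noteq> 0"
  obtains M where "0 \<le> M" "\<And>j z. norm z \<le> 1 \<Longrightarrow> 2 powr (- (real j * m)) * bessel m (z + 2 ^ j *\<^sub>R u) \<le> M"
proof -
  define A where "A = (norm u / 2)\<^sup>2"
  define B where "B = 1 + (1 + norm u)\<^sup>2"
  have A: "A > 0" using u by (simp add: A_def)
  have "2 powr (- (real j * m)) * bessel m (z + 2 ^ j *\<^sub>R u) \<le> A powr (m / 2) + B powr (m / 2)"
      if z: "norm z \<le> 1" for j z
  proof -
    define t :: real where "t = 1 / 2 ^ j"
    have t: "t > 0" "t \<le> 1" by (simp_all add: t_def)
    define Q where "Q = t\<^sup>2 + (norm (t *\<^sub>R z + u))\<^sup>2"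
    have tz: "norm (t *\<^sub>R z) \<le> t" using z t by (simp add: mult_left_le)
    have "A \<le> Q"
    proof (cases "t \<le> norm u / 2")
      case True
      then have "norm u / 2 \<le> norm (t *\<^sub>R z + u)" using tz norm_triangle_ineq2[of u "- (t *\<^sub>R z)"]
          by (simp add: add.commute)
      then have "(norm u / 2)\<^sup>2 \<le> (norm (t *\<^sub>R z + u))\<^sup>2" by (intro power_mono) auto
      moreover have "0 \<le> t\<^sup>2" by simp
      ultimately show ?thesis unfolding A_def Q_def by linarith
    next
      case False
      then have "(norm u / 2)\<^sup>2 \<le> t\<^sup>2" by (intro power_mono) auto
      moreover have "0 \<le> (norm (t *\<^sub>R z + u))\<^sup>2" by simp
      ultimately show ?thesis unfolding A_def Q_def by linarith
    qed
    moreover have "Q \<le> B"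
    proof -
      have "norm (t *\<^sub>R z + u) \<le> 1 + norm u" using norm_triangle_ineq[of "t *\<^sub>R z" u] tz t by linarith
      then have "(norm (t *\<^sub>R z + u))\<^sup>2 \<le> (1 + norm u)\<^sup>2" by (intro power_mono) auto
      moreover have "t\<^sup>2 \<le> 1" using t by (simp add: power_le_one)
      ultimately show ?thesis unfolding Q_def B_def by linarith
    qed
    ultimately have "Q powr (m / 2) \<le> A powr (m / 2) + B powr (m / 2)"
    proof (cases "m \<ge> 0")
      case True
      then have "Q powr (m / 2) \<le> B powr (m / 2)" using A \<open>A \<le> Q\<close> \<open>Q \<le> B\<close> by (intro powr_mono2) auto
      then show ?thesis by (simp add: add_increasing)
    next
      case False
      then have "Q powr (m / 2) \<le> A powr (m / 2)" using A \<open>A \<le> Q\<close> by (intro powr_mono2') auto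
      then show ?thesis by (simp add: add_increasing2)
    qed
    then show ?thesis unfolding bessel_rescaled by (simp add: Q_def t_def)
  qed
  then show ?thesis using that[of "A powr (m / 2) + B powr (m / 2)"] by simp
qed

section \<open>Conditions on the exponents for a given pair of directions\<close>

locale bilinear_besov =
  fixes \<psi>0 :: "'a::euclidean_space \<Rightarrow> complex"
    and p p1 p2 p1' p2' q q1 q2 q1' q2' :: ennreal and s s1 s2 s1' s2' :: real
  assumes cutoff: "besov_cutoff \<psi>0"
    and p: "1 \<le> p" "p \<le> 2" "2 \<le> p1" "2 \<le> p2" "2 \<le> p1'" "2 \<le> p2'"
    and q: "0 < q" "0 < q1" "0 < q2" "0 < q1'" "0 < q2'"
begin

definition besov_bounded :: "('a \<times> 'a \<times> 'a \<Rightarrow> complex) \<Rightarrow> bool" where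
  "besov_bounded \<sigma> \<longleftrightarrow> (\<exists>C::real. C > 0 \<and> (\<forall>f1\<in>schwartz. \<forall>f2\<in>schwartz.
      besov_norm \<psi>0 s p q (bilinear_op \<sigma> f1 f2)
        \<le> ennreal C * (besov_norm \<psi>0 s1 p1 q1 f1 * besov_norm \<psi>0 s2 p2 q2 f2
                      + besov_norm \<psi>0 s1' p1' q1' f1 * besov_norm \<psi>0 s2' p2' q2' f2)))"

text \<open>The factor 4 shrinks the support from radius 2 to radius 1 / 2, as the frequency
  estimates require.\<close>

definition bump :: "'a \<Rightarrow> complex" where
  "bump \<xi> = \<psi>0 (4 *\<^sub>R \<xi>)"

lemma bump_smooth_cc: "bump \<in> smooth_cc"
  and bump_support: "1 / 2 < norm \<xi> \<Longrightarrow> bump \<xi> = 0"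
  and bump_0: "bump 0 \<noteq> 0"
proof -
  show s: "bump \<xi> = 0" if "1 / 2 < norm \<xi>" for \<xi>
    unfolding bump_def using that by (intro cutoff_eq_0[OF cutoff]) simp
  have "smooth_fun bump"
    using smooth_fun_affine[OF cutoff_smooth[OF cutoff] bounded_linear_scaleR_right, of 4 0]
        by (simp add: bump_def[abs_def])
  then show "bump \<in> smooth_cc" using s smooth_ccI by blast
  show "bump 0 \<noteq> 0" using cutoff_eq_1[OF cutoff, of 0] by (simp add: bump_def)
qed

text \<open>Rescaling by 2^-j moves the argument to \<open>e\<close>, where the two cutoffs have the
  values 1 and 0: a unit vector lies where the first is 1, and \<open>2 e\<close> lies on the sphere
  where the second already vanishes.\<close>

lemma dyadic_piece_shift_tendsto:
  assumes e: "norm e = 1"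
  shows "(\<lambda>j. dyadic_piece \<psi>0 j (\<xi> + 2 ^ j *\<^sub>R e)) \<longlonglongrightarrow> 1"
proof -
  have cont: "continuous_on UNIV \<psi>0" by (rule smooth_fun_continuous_on[OF cutoff_smooth[OF cutoff]])
  have t: "(\<lambda>j. 1 / 2 ^ j :: real) \<longlonglongrightarrow> 0"
    using LIMSEQ_realpow_zero[of "1 / 2 :: real"] by (simp add: power_one_over)
  have y: "(\<lambda>j. (1 / 2 ^ j) *\<^sub>R \<xi> + e) \<longlonglongrightarrow> 0 *\<^sub>R \<xi> + e" by (intro tendsto_intros t)
  have "(\<lambda>j. \<psi>0 ((1 / 2 ^ j) *\<^sub>R \<xi> + e) - \<psi>0 (2 *\<^sub>R ((1 / 2 ^ j) *\<^sub>R \<xi> + e))) \<longlonglongrightarrow> \<psi>0 (0 *\<^sub>R \<xi> + e)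
      - \<psi>0 (2 *\<^sub>R (0 *\<^sub>R \<xi> + e))"
    by (intro tendsto_diff continuous_on_tendsto_compose[OF cont] tendsto_scaleR tendsto_const y) auto
  moreover have "\<psi>0 (0 *\<^sub>R \<xi> + e) - \<psi>0 (2 *\<^sub>R (0 *\<^sub>R \<xi> + e)) = 1"
    using cutoff_eq_1[OF cutoff, of e] cutoff_eq_0[OF cutoff, of "2 *\<^sub>R e"] e by simp
  ultimately have "(\<lambda>j. \<psi>0 ((1 / 2 ^ j) *\<^sub>R \<xi> + e) - \<psi>0 (2 *\<^sub>R ((1 / 2 ^ j) *\<^sub>R \<xi> + e))) \<longlonglongrightarrow> 1" by simp
  then show ?thesis
  proof (rule Lim_transform_eventually)
    \<comment> \<open>Positive \<open>j\<close> is needed because block 0 is \<open>\<psi>0\<close>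
      itself and not a difference.\<close>
    show "eventually (\<lambda>j. \<psi>0 ((1 / 2 ^ j) *\<^sub>R \<xi> + e) - \<psi>0 (2 *\<^sub>R ((1 / 2 ^ j) *\<^sub>R \<xi> + e))
        = dyadic_piece \<psi>0 j (\<xi> + 2 ^ j *\<^sub>R e)) sequentially"
      using eventually_gt_at_top[of 0] by eventually_elim (simp add: dyadic_piece_def Let_def
          scaleR_add_right)
  qed
qed

text \<open>Since \<open>norm u\<close> is \<open>0\<close> or \<open>1\<close>, it records whether the frequency \<open>2 ^ j *\<^sub>R u\<close> stays at the origin
  or is of size \<open>2 ^ j\<close>.\<close>

lemma exponent_condition:
  fixes \<tau> :: "'a \<times> 'a \<Rightarrow> complex" and \<theta>1 \<theta>2 :: "'a \<Rightarrow> complex"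
  assumes \<theta>1: "\<theta>1 \<in> smooth_cc" "\<And>\<xi>. 1 / 2 < norm \<xi> \<Longrightarrow> \<theta>1 \<xi> = 0"
    and \<theta>2: "\<theta>2 \<in> smooth_cc" "\<And>\<xi>. 1 / 2 < norm \<xi> \<Longrightarrow> \<theta>2 \<xi> = 0"
    and \<tau>: "smooth_fun \<tau>" and \<kappa>: "\<kappa> \<noteq> 0"
    and u: "norm u1 \<in> {0, 1}" "norm u2 \<in> {0, 1}" "norm (u1 + u2) \<in> {0, 1}"
    and bd: "\<And>j z. norm (fst z) \<le> 1 / 2 \<Longrightarrow> norm (snd z) \<le> 1 / 2 \<Longrightarrow>
        2 powr (- (real j * \<mu>)) * cmod (\<tau> (fst z + 2 ^ j *\<^sub>R u1, snd z + 2 ^ j *\<^sub>R u2)) \<le> M"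
    and lim: "\<And>z. norm (fst z) \<le> 1 / 2 \<Longrightarrow> norm (snd z) \<le> 1 / 2 \<Longrightarrow>
        (\<lambda>j. of_real (2 powr (- (real j * \<mu>))) * \<tau> (fst z + 2 ^ j *\<^sub>R u1, snd z + 2 ^ j *\<^sub>R u2)
            * (\<theta>1 (fst z) * \<theta>2 (snd z)))
        \<longlonglongrightarrow> \<kappa> * (bump (fst z) * bump (snd z))"
    and hyp: "besov_bounded (\<lambda>z. \<tau> (snd z))"
  shows "\<mu> + norm (u1 + u2) * s \<le> max (norm u1 * s1 + norm u2 * s2) (norm u1 * s1' + norm u2 * s2')"
proof -
  define idx where "idx u j = (if norm u = 0 then 0 else j)" for u :: 'a and j :: nat
  have idx: "real (idx u j) * w = real j * (norm u * w)" if "norm u \<in> {0, 1}" for u j w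
    using that by (auto simp: idx_def)
  have fr: "at_frequency (idx u j) (2 ^ j *\<^sub>R u)" if "norm u \<in> {0, 1}" for u j
    using that by (auto simp: idx_def at_frequency_def)
  \<comment> \<open>If the two directions cancel, the output stays in block 0, where
    \<open>\<psi>0\<close> is 1 on the unit ball. A sum of two frequencies from balls of radius 1 /
    2 stays in that ball.\<close>
  have pc: "(\<lambda>j. dyadic_piece \<psi>0 (idx (u1 + u2) j) (\<xi> + (2 ^ j *\<^sub>R u1 + 2 ^ j *\<^sub>R u2))) \<longlonglongrightarrow> 1"
      if "norm \<xi> \<le> 1" for \<xi>
  proof (cases "norm (u1 + u2) = 0")
    case True
    then have "2 ^ j *\<^sub>R u1 + 2 ^ j *\<^sub>R u2 = 0" for j by (simp add: scaleR_add_right[symmetric])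
    then show ?thesis using True cutoff_eq_1[OF cutoff that] by (simp add: idx_def dyadic_piece_def)
  next
    case False
    then have "norm (u1 + u2) = 1" using u by auto
    from dyadic_piece_shift_tendsto[OF this, of \<xi>] False show ?thesis
        by (simp add: idx_def scaleR_add_right)
  qed
  obtain C where C: "0 < C" "\<And>f1 f2. f1 \<in> schwartz \<Longrightarrow> f2 \<in> schwartz \<Longrightarrow>
        besov_norm \<psi>0 s p q (bilinear_op (\<lambda>z. \<tau> (snd z)) f1 f2)
        \<le> ennreal C * (besov_norm \<psi>0 s1 p1 q1 f1 * besov_norm \<psi>0 s2 p2 q2 f2
                      + besov_norm \<psi>0 s1' p1' q1' f1 * besov_norm \<psi>0 s2' p2' q2' f2)"
    using hyp unfolding besov_bounded_def by blast
  have lim': "(\<lambda>j. dyadic_piece \<psi>0 (idx (u1 + u2) j) (fst z + snd z + (2 ^ j *\<^sub>R u1 + 2 ^ j *\<^sub>R u2)) *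
             (of_real (2 powr (- (real j * \<mu>))) * \<tau> (fst z + 2 ^ j *\<^sub>R u1, snd z + 2 ^ j *\<^sub>R u2))
                 * (\<theta>1 (fst z) * \<theta>2 (snd z)))
        \<longlonglongrightarrow> \<kappa> * (bump (fst z) * bump (snd z))" if z: "norm (fst z) \<le> 1 / 2" "norm (snd z) \<le> 1 / 2" for z
  proof -
    have "norm (fst z + snd z) \<le> 1" using norm_triangle_ineq[of "fst z" "snd z"] z by simp
    from tendsto_mult[OF pc[OF this] lim[OF z]] show ?thesis by (simp add: mult.assoc)
  qed
  obtain c D where cD: "0 < c" "0 \<le> D"
    "eventually (\<lambda>j. c * (2 powr (real j * \<mu>) * 2 powr (real (idx (u1 + u2) j) * s))
      \<le> D * (2 powr (real (idx u1 j) * s1) * 2 powr (real (idx u2 j) * s2) + 2 powr (real (idx u1 j)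
          * s1') * 2 powr (real (idx u2 j) * s2'))) sequentially"
    by (rule frequency_estimate[OF cutoff p q \<theta>1 \<theta>2 bump_smooth_cc bump_support bump_0 \<tau> \<kappa> fr[OF u(1)]
        fr[OF u(2)] bd lim' C])
  have "eventually (\<lambda>j. c * 2 powr (real j * (\<mu> + norm (u1 + u2) * s))
      \<le> D * (2 powr (real j * (norm u1 * s1 + norm u2 * s2)) + 2 powr (real j * (norm u1 * s1'
          + norm u2 * s2')))) sequentially"
    using cD(3) unfolding idx[OF u(1)] idx[OF u(2)] idx[OF u(3)]
        by (simp add: powr_add[symmetric] distrib_left)
  from exponent_le_max[OF cD(1) this] show ?thesis .
qed

text \<open>For \<open>u = 0\<close> the weight is the same for every \<open>j\<close>, so its
  reciprocal \<open>bessel (- m)\<close> is built into \<theta>. For a unit vector the rescaled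
  weight tends to 1 and the bump itself will do.\<close>

lemma bessel_times_bump:
  assumes u: "norm (u::'a) \<in> {0, 1}"
  obtains \<theta> M where "\<theta> \<in> smooth_cc" "\<And>\<xi>. 1 / 2 < norm \<xi> \<Longrightarrow> \<theta> \<xi> = 0"
    "\<And>j \<xi>. norm \<xi> \<le> 1 / 2 \<Longrightarrow> 2 powr (- (real j * (norm u * m))) * bessel m (\<xi> + 2 ^ j *\<^sub>R u) \<le> M"
    "\<And>\<xi>. (\<lambda>j. of_real (2 powr (- (real j * (norm u * m))) * bessel m (\<xi> + 2 ^ j *\<^sub>R u)) * \<theta> \<xi>) \<longlonglongrightarrow> bump \<xi>"
proof (cases "u = 0")
  case True
  show ?thesis
  proof (rule that[of "\<lambda>\<xi>. of_real (bessel (- m) \<xi>) * bump \<xi>" "2 powr \<bar>m / 2\<bar> * (1 + 2 powr \<bar>m\<bar>)"])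
    show "(\<lambda>\<xi>. of_real (bessel (- m) \<xi>) * bump \<xi>) \<in> smooth_cc"
      by (intro smooth_cc_mult bump_smooth_cc bessel_smooth)
    show "of_real (bessel (- m) \<xi>) * bump \<xi> = 0" if "1 / 2 < norm \<xi>" for \<xi> using bump_support[OF that]
        by simp
    show "2 powr (- (real j * (norm u * m))) * bessel m (\<xi> + 2 ^ j *\<^sub>R u) \<le> 2 powr \<bar>m / 2\<bar> * (1
        + 2 powr \<bar>m\<bar>)"
      if "norm \<xi> \<le> 1 / 2" for j \<xi>
    proof -
      have "(1 + norm \<xi>) powr m \<le> (1 + norm \<xi>) powr \<bar>m\<bar>" by (intro powr_mono) auto
      also have "\<dots> \<le> 2 powr \<bar>m\<bar>" using that by (intro powr_mono2) auto
      finally have "bessel m \<xi> \<le> 2 powr \<bar>m / 2\<bar> * (1 + 2 powr \<bar>m\<bar>)"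
        by (intro order_trans[OF bessel_le] mult_left_mono) auto
      then show ?thesis using True by simp
    qed
    have "bessel m \<xi> * bessel (- m) \<xi> = 1" for \<xi> :: 'a
      using add_pos_nonneg[of 1 "(norm \<xi>)\<^sup>2"] by (simp add: bessel_def powr_add[symmetric])
    then have "complex_of_real (bessel m \<xi> * bessel (- m) \<xi>) = 1" for \<xi> :: 'a by simp
    then have E: "complex_of_real (bessel m \<xi>) * (of_real (bessel (- m) \<xi>) * bump \<xi>) = bump \<xi>" for \<xi>
      unfolding of_real_mult mult.assoc[symmetric] by (simp only: mult_1)
    have "2 powr (- (real j * (norm u * m))) * bessel m (\<xi> + 2 ^ j *\<^sub>R u) = bessel m \<xi>" for j \<xi>
      using True by simp
    then show "(\<lambda>j. of_real (2 powr (- (real j * (norm u * m))) * bessel m (\<xi> + 2 ^ j *\<^sub>R u))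
        * (of_real (bessel (- m) \<xi>) * bump \<xi>)) \<longlonglongrightarrow> bump \<xi>" for \<xi>
      by (simp only: E tendsto_const)
  qed
next
  case False
  then have n: "norm u = 1" using u by auto
  obtain M where M: "\<And>j \<xi>. norm \<xi> \<le> 1 \<Longrightarrow> 2 powr (- (real j * m)) * bessel m (\<xi> + 2 ^ j *\<^sub>R u) \<le> M"
    using bessel_rescaled_bounded[OF False] by blast
  show ?thesis
  proof (rule that[OF bump_smooth_cc bump_support])
    show "2 powr (- (real j * (norm u * m))) * bessel m (\<xi> + 2 ^ j *\<^sub>R u) \<le> M" if "norm \<xi> \<le> 1 / 2"
        for j \<xi>
      using M[of \<xi> j] that n by simp
    fix \<xi>
    have "(\<lambda>j. 2 powr (- (real j * m)) * bessel m (\<xi> + 2 ^ j *\<^sub>R u)) \<longlonglongrightarrow> 1"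
      using bessel_rescaled_tendsto[OF False, of m \<xi>] n by simp
    from tendsto_mult[OF tendsto_of_real[OF this, where ?'a=complex] tendsto_const[of "bump \<xi>"]]
    show "(\<lambda>j. of_real (2 powr (- (real j * (norm u * m))) * bessel m (\<xi> + 2 ^ j *\<^sub>R u)) * bump \<xi>)
        \<longlonglongrightarrow> bump \<xi>"
      using n by simp
  qed auto
qed

text \<open>The weight depends on the pair of frequencies as one vector, and (u1, u2) is nonzero.
  Its rescaled limit is therefore the constant \<open>norm (u1, u2) powr m\<close> even if one of
  the two frequencies stays at the origin, so plain bumps suffice.\<close>

lemma BS_exponent_condition:
  fixes u1 u2 :: 'a
  assumes "\<forall>\<sigma>\<in>BS m. besov_bounded \<sigma>"
    and u: "norm u1 \<in> {0, 1}" "norm u2 \<in> {0, 1}" "norm (u1 + u2) \<in> {0, 1}" "(u1, u2) \<noteq> 0"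
  shows "m + norm (u1 + u2) * s \<le> max (norm u1 * s1 + norm u2 * s2) (norm u1 * s1' + norm u2 * s2')"
proof -
  define \<kappa> where "\<kappa> = complex_of_real (norm (u1, u2) powr m)"
  obtain M where M: "\<And>j z. norm z \<le> 1 \<Longrightarrow> 2 powr (- (real j * m)) * bessel m (z + 2 ^ j *\<^sub>R (u1, u2)) \<le> M"
    using bessel_rescaled_bounded[OF u(4)] by blast
  have sh: "z + 2 ^ j *\<^sub>R (u1, u2) = (fst z + 2 ^ j *\<^sub>R u1, snd z + 2 ^ j *\<^sub>R u2)" for z and j :: nat
    by (simp add: plus_prod_def)
  have b: "besov_bounded (\<lambda>z. of_real (bessel m (snd z)))"
    using assms(1) bessel_in_BS by blast
  show ?thesis
  proof (rule exponent_condition[where \<tau>="\<lambda>z. of_real (bessel m z)" and \<kappa>=\<kappa> and M=M,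
        OF bump_smooth_cc bump_support bump_smooth_cc bump_support bessel_smooth _ u(1-3) _ _ b])
    show "\<kappa> \<noteq> 0" using u(4) by (simp add: \<kappa>_def)
    fix z :: "'a \<times> 'a" assume z: "norm (fst z) \<le> 1 / 2" "norm (snd z) \<le> 1 / 2"
    have "norm z \<le> 1" using norm_Pair_le[of "fst z" "snd z"] z by simp
    from M[OF this] show "2 powr (- (real j * m)) * cmod (of_real (bessel m (fst z + 2 ^ j *\<^sub>R u1, snd
        z + 2 ^ j *\<^sub>R u2))) \<le> M" for j
      unfolding sh by (simp add: bessel_def)
    have "(\<lambda>j. 2 powr (- (real j * m)) * bessel m (fst z + 2 ^ j *\<^sub>R u1, snd z + 2 ^ j *\<^sub>R u2))
        \<longlonglongrightarrow> norm (u1, u2) powr m"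
      using bessel_rescaled_tendsto[OF u(4), of m z] unfolding sh .
    from tendsto_mult[OF tendsto_of_real[OF this, where ?'a=complex] tendsto_const[of "bump (fst z)
        * bump (snd z)"]]
    show "(\<lambda>j. of_real (2 powr (- (real j * m))) * of_real (bessel m (fst z + 2 ^ j *\<^sub>R u1, snd z
        + 2 ^ j *\<^sub>R u2)) * (bump (fst z) * bump (snd z)))
      \<longlonglongrightarrow> \<kappa> * (bump (fst z) * bump (snd z))" by (simp add: \<kappa>_def)
  qed
qed

text \<open>Here the two factors of the weight scale independently: one with \<open>u = 0\<close>
  contributes no power of two and is compensated in its bump. Hence the order
  \<open>norm u1 * m1 + norm u2 * m2\<close> and the limit constant 1.\<close>

lemma BS2_exponent_condition:
  fixes u1 u2 :: 'a
  assumes "\<forall>\<sigma>\<in>BS2 m1 m2. besov_bounded \<sigma>"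
    and u: "norm u1 \<in> {0, 1}" "norm u2 \<in> {0, 1}" "norm (u1 + u2) \<in> {0, 1}"
  shows "norm u1 * m1 + norm u2 * m2 + norm (u1 + u2) * s
    \<le> max (norm u1 * s1 + norm u2 * s2) (norm u1 * s1' + norm u2 * s2')"
proof -
  obtain \<theta>1 M1 where \<theta>1: "\<theta>1 \<in> smooth_cc" "\<And>\<xi>. 1 / 2 < norm \<xi> \<Longrightarrow> \<theta>1 \<xi> = 0"
    "\<And>j \<xi>. norm \<xi> \<le> 1 / 2 \<Longrightarrow> 2 powr (- (real j * (norm u1 * m1))) * bessel m1 (\<xi> + 2 ^ j *\<^sub>R u1) \<le> M1"
    "\<And>\<xi>. (\<lambda>j. of_real (2 powr (- (real j * (norm u1 * m1))) * bessel m1 (\<xi> + 2 ^ j *\<^sub>R u1)) * \<theta>1 \<xi>)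
        \<longlonglongrightarrow> bump \<xi>"
    by (rule bessel_times_bump[OF u(1), of m1]) (rule that; blast)
  obtain \<theta>2 M2 where \<theta>2: "\<theta>2 \<in> smooth_cc" "\<And>\<xi>. 1 / 2 < norm \<xi> \<Longrightarrow> \<theta>2 \<xi> = 0"
    "\<And>j \<xi>. norm \<xi> \<le> 1 / 2 \<Longrightarrow> 2 powr (- (real j * (norm u2 * m2))) * bessel m2 (\<xi> + 2 ^ j *\<^sub>R u2) \<le> M2"
    "\<And>\<xi>. (\<lambda>j. of_real (2 powr (- (real j * (norm u2 * m2))) * bessel m2 (\<xi> + 2 ^ j *\<^sub>R u2)) * \<theta>2 \<xi>)
        \<longlonglongrightarrow> bump \<xi>"
    by (rule bessel_times_bump[OF u(2), of m2]) (rule that; blast)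
  define \<mu> where "\<mu> = norm u1 * m1 + norm u2 * m2"
  have pw: "2 powr (- (real j * \<mu>)) = 2 powr (- (real j * (norm u1 * m1))) * 2 powr (- (real j
      * (norm u2 * m2)))" for j
    by (simp add: \<mu>_def powr_add[symmetric] algebra_simps)
  have b: "besov_bounded (\<lambda>z. of_real (bessel m1 (fst (snd z))) * of_real (bessel m2 (snd (snd z))))"
    using assms(1) bessel_in_BS2 by blast
  have sm: "smooth_fun (\<lambda>z::'a \<times> 'a. of_real (bessel m1 (fst z)) * of_real (bessel m2 (snd z)))"
    using smooth_fun_affine[OF bessel_smooth bounded_linear_fst, of m1 0] smooth_fun_affine[OF
        bessel_smooth bounded_linear_snd, of m2 0]
    by (intro smooth_fun_mult) simp_all
  have "\<mu> + norm (u1 + u2) * s \<le> max (norm u1 * s1 + norm u2 * s2) (norm u1 * s1' + norm u2 * s2')"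
  proof (rule exponent_condition[where \<tau>="\<lambda>z. of_real (bessel m1 (fst z)) * of_real (bessel m2 (snd
      z))" and \<kappa>="1 :: complex" and M="M1 * M2",
        OF \<theta>1(1,2) \<theta>2(1,2) sm _ u _ _ b])
    fix z :: "'a \<times> 'a" assume z: "norm (fst z) \<le> 1 / 2" "norm (snd z) \<le> 1 / 2"
    show "2 powr (- (real j * \<mu>)) * cmod (of_real (bessel m1 (fst (fst z + 2 ^ j *\<^sub>R u1, snd z
        + 2 ^ j *\<^sub>R u2))) * of_real (bessel m2 (snd (fst z + 2 ^ j *\<^sub>R u1, snd z + 2 ^ j *\<^sub>R u2))))
        \<le> M1 * M2" for j
    proof -
      \<comment> \<open>Needed to multiply the two bounds; it follows because the weight bounded by
        \<open>M1\<close> is nonnegative at the origin.\<close>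
      have "0 \<le> M1" using \<theta>1(3)[of 0 0] by (rule order_trans[rotated]) (auto simp: bessel_def)
      then have "(2 powr (- (real j * (norm u1 * m1))) * bessel m1 (fst z + 2 ^ j *\<^sub>R u1))
          * (2 powr (- (real j * (norm u2 * m2))) * bessel m2 (snd z + 2 ^ j *\<^sub>R u2)) \<le> M1 * M2"
        by (intro mult_mono \<theta>1(3) \<theta>2(3) z) (auto simp: bessel_def)
      then show ?thesis unfolding pw by (simp add: norm_mult bessel_def mult_ac)
    qed
    from tendsto_mult[OF \<theta>1(4)[of "fst z"] \<theta>2(4)[of "snd z"]]
    show "(\<lambda>j. of_real (2 powr (- (real j * \<mu>))) * (of_real (bessel m1 (fst (fst z + 2 ^ j *\<^sub>R u1, snd
        z + 2 ^ j *\<^sub>R u2))) * of_real (bessel m2 (snd (fst z + 2 ^ j *\<^sub>R u1, snd z + 2 ^ j *\<^sub>R u2))))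
        * (\<theta>1 (fst z) * \<theta>2 (snd z)))
        \<longlonglongrightarrow> 1 * (bump (fst z) * bump (snd z))"
      unfolding pw by (simp add: mult_ac)
  next
    show "1 \<noteq> (0::complex)" by simp
  qed
  then show ?thesis by (simp add: \<mu>_def)
qed

end

theorem theorem1p2:
  fixes \<psi>0 :: "real ^ 'n \<Rightarrow> complex"
    and p p1 p2 p1' p2' q q1 q2 q1' q2' :: ennreal
    and s s1 s2 s1' s2' :: real
    and bounded_op :: "((real ^ 'n) \<times> (real ^ 'n) \<times> (real ^ 'n) \<Rightarrow> complex) \<Rightarrow> bool"
  assumes "besov_cutoff \<psi>0"
    and "1 \<le> p" "p \<le> 2" "2 \<le> p1" "2 \<le> p2" "2 \<le> p1'" "2 \<le> p2'"
    and "0 < q" "0 < q1" "0 < q2" "0 < q1'" "0 < q2'"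
    and "1 / p \<le> 1 / p1 + 1 / p2" "1 / p \<le> 1 / p1' + 1 / p2'"
    and "1 / q = 1 / q1 + 1 / q2" "1 / q = 1 / q1' + 1 / q2'"
    and "s = s1 + s2" "s = s1' + s2'"
  defines "bounded_op \<equiv> (\<lambda>\<sigma>. \<exists>C::real. C > 0 \<and> (\<forall>f1\<in>schwartz. \<forall>f2\<in>schwartz.
      besov_norm \<psi>0 s p q (bilinear_op \<sigma> f1 f2)
        \<le> ennreal C * (besov_norm \<psi>0 s1 p1 q1 f1 * besov_norm \<psi>0 s2 p2 q2 f2
                      + besov_norm \<psi>0 s1' p1' q1' f1 * besov_norm \<psi>0 s2' p2' q2' f2)))"
  shows "((\<forall>\<sigma>\<in>BS (- real CARD('n) / 2). bounded_op \<sigma>) \<longrightarrow>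
            min s1 s1' \<le> real CARD('n) / 2 \<and> min s2 s2' \<le> real CARD('n) / 2 \<and>
            s \<ge> - real CARD('n) / 2)
       \<and> (\<forall>m1 m2 :: real. m1 + m2 = - real CARD('n) / 2 \<longrightarrow>
            (\<forall>\<sigma>\<in>BS2 m1 m2. bounded_op \<sigma>) \<longrightarrow>
            min s1 s1' \<le> m1 + real CARD('n) / 2 \<and> min s2 s2' \<le> m2 + real CARD('n) / 2 \<and>
            s \<ge> - real CARD('n) / 2)"
proof -
  interpret bilinear_besov \<psi>0 p p1 p2 p1' p2' q q1 q2 q1' q2' s s1 s2 s1' s2'
    by unfold_locales (fact assms)+
  have bounded: "bounded_op = besov_bounded"
    by (simp add: fun_eq_iff bounded_op_def besov_bounded_def)
  obtain e :: "real ^ 'n" where e: "norm e = 1" using SOME_Basis norm_Basis by blast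
  then have e0: "e \<noteq> 0" by auto
  show ?thesis
    unfolding bounded
  proof (intro conjI impI allI)
    let ?m = "- real CARD('n) / 2"
    assume a: "\<forall>\<sigma>\<in>BS ?m. besov_bounded \<sigma>"
    \<comment> \<open>Moving only the second frequency gives
      \<open>- n / 2 + s \<le> max s2 s2'\<close>. Subtracting
      \<open>s = s1 + s2 = s1' + s2'\<close> leaves \<open>- n / 2 \<le> max (- s1) (- s1')\<close>,
      a condition on the other input.\<close>
    show "min s1 s1' \<le> real CARD('n) / 2"
      using BS_exponent_condition[OF a, of 0 e] e e0 assms(17,18)
          by (simp add: zero_prod_def max_def min_def split: if_splits)
    show "min s2 s2' \<le> real CARD('n) / 2"
      using BS_exponent_condition[OF a, of e 0] e e0 assms(17,18)
          by (simp add: zero_prod_def max_def min_def split: if_splits)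
    \<comment> \<open>With opposite frequencies the weight of the output block is 1, so the left
      side is the bare order, and both sums on the right equal \<open>s\<close>.\<close>
    show "?m \<le> s"
      using BS_exponent_condition[OF a, of e "- e"] e e0 assms(17,18) by (simp add: zero_prod_def)
  next
    fix m1 m2 :: real
    assume m: "m1 + m2 = - real CARD('n) / 2" and a: "\<forall>\<sigma>\<in>BS2 m1 m2. besov_bounded \<sigma>"
    \<comment> \<open>The second frequency alone gives \<open>m2 + s \<le> max s2 s2'\<close>, hence
      \<open>min s1 s1' \<le> - m2\<close>, and - m2 is m1 + n / 2.\<close>
    show "min s1 s1' \<le> m1 + real CARD('n) / 2"
      using BS2_exponent_condition[OF a, of 0 e] m e assms(17,18)
          by (simp add: zero_prod_def max_def min_def split: if_splits)
    show "min s2 s2' \<le> m2 + real CARD('n) / 2"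
      using BS2_exponent_condition[OF a, of e 0] m e assms(17,18)
          by (simp add: zero_prod_def max_def min_def split: if_splits)
    show "- real CARD('n) / 2 \<le> s"
      using BS2_exponent_condition[OF a, of e "- e"] m e assms(17,18) by simp
  qed
qed

end
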